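(* Let $m,n\ge 1$ and let $S\subset\mathbb{R}^n$ be the union of a finite (nonempty) family of $m$-bricks (each contained in $\mathbb{R}^n$). The following assertions are equivalent: (i) $S$ is connected by analytic paths. (ii) There exists a polynomial map $f:\mathbb{R}^{m+1}\to\mathbb{R}^n$ such that $f(\overline{B}_{m+1})=S$.
   Context: $\overline{B}_m$ denotes the closed unit ball of $\mathbb{R}^m$ centered at the origin. A map $\mathbb{R}^m\to\mathbb{R}^n$ is polynomial if each of its components is a polynomial with real coefficients. An $n$-dimensional semialgebraic set $T\subset\mathbb{R}^n$ is an $m$-brick if there exists a homotopy $H=(H_1,\ldots,H_n):[0,1]\times\overline{B}_m\to T$ such that: (1) each $H_i$ is the restriction to $[0,1]\times\overline{B}_m$ of a polynomial of the ring $\mathcal{C}^0([0,1])[x_1,\ldots,x_m]$, where $\mathcal{C}^0([0,1])$ is the ring of continuous real functions on $[0,1]$; (2) $H(\{0\}\times\overline{B}_m)=T$ and $H(1,\cdot)$ is a constant map; (3) $H(\{t\}\times\overline{B}_m)\subset\operatorname{Int}(T)$ for each $t\in(0,1)$, where $\operatorname{Int}$ is the topological interior in $\mathbb{R}^n$. A semialgebraic set $S\subset\mathbb{R}^n$ is connected by analytic paths if for each pair of points $p_1,p_2\in S$ there exists a (real) analytic path $\alpha:[0,1]\to S$ (i.e. a map that extends to a real analytic map on an open neighborhood of $[0,1]$ in $\mathbb{R}$ with values in $\mathbb{R}^n$) such that $\alpha(0)=p_1$ and $\alpha(1)=p_2$. *)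

theory Defs
  imports "HOL-Analysis.Analysis" "HOL-Library.Extended_Nat" "HOL-Algebra.QuotRing"
begin

section \<open>Polynomial maps\<close>

lemma polynomial_function_vec_iff:
  fixes f :: "real^'k \<Rightarrow> real^'n"
  shows "polynomial_function f \<longleftrightarrow> (\<forall>i. real_polynomial_function (\<lambda>x. f x $ i))"
  unfolding polynomial_function_iff_Basis_inner
  by (auto simp: Basis_vec_def inner_axis)

section \<open>Semialgebraic sets and their dimension\<close>

inductive semialgebraic :: "(real^'n) set \<Rightarrow> bool" where
  eq: "real_polynomial_function p \<Longrightarrow> semialgebraic {x. p x = 0}"
| pos: "real_polynomial_function p \<Longrightarrow> semialgebraic {x. p x > 0}"
| compl: "semialgebraic A \<Longrightarrow> semialgebraic (- A)"
| union: "semialgebraic A \<Longrightarrow> semialgebraic B \<Longrightarrow> semialgebraic (A \<union> B)"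

text \<open>
  The ring \<open>\<real>[x\<^sub>1, \<dots>, x\<^sub>n]\<close>, represented by polynomial functions; this loses nothing
  because \<open>\<real>\<close> is infinite.
\<close>

definition polynomial_ring :: "(real^'n \<Rightarrow> real) ring" where
  "polynomial_ring =
     \<lparr>carrier = {p. real_polynomial_function p},
      mult = (\<lambda>p q x. p x * q x), one = (\<lambda>x. 1),
      zero = (\<lambda>x. 0), add = (\<lambda>p q x. p x + q x)\<rparr>"

definition vanishing_ideal :: "(real^'n) set \<Rightarrow> (real^'n \<Rightarrow> real) set" where
  "vanishing_ideal S = {p. real_polynomial_function p \<and> (\<forall>x\<in>S. p x = 0)}"

text \<open>The zero ring gets dimension 0 here, so the empty set has dimension 0.\<close>

definition krull_dim :: "'a ring \<Rightarrow> enat" where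
  "krull_dim R =
     Sup {enat d | d. \<exists>P. (\<forall>i\<le>d. primeideal (P i) R) \<and> (\<forall>i<d. P i \<subset> P (Suc i))}"

definition semialgebraic_dim :: "(real^'n) set \<Rightarrow> enat" where
  "semialgebraic_dim S = krull_dim (polynomial_ring Quot vanishing_ideal S)"

lemma cring_polynomial_ring: "cring (polynomial_ring :: (real^'n \<Rightarrow> real) ring)"
proof (rule cringI)
  show "abelian_group (polynomial_ring :: (real^'n \<Rightarrow> real) ring)"
  proof (rule abelian_groupI)
    fix p :: "real^'n \<Rightarrow> real"
    assume "p \<in> carrier polynomial_ring"
    then have "real_polynomial_function (\<lambda>x. - p x)"
      by (simp add: polynomial_ring_def real_polynomial_function_minus)
    then show "\<exists>q\<in>carrier polynomial_ring. q \<oplus>\<^bsub>polynomial_ring\<^esub> p = \<zero>\<^bsub>polynomial_ring\<^esub>"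
      by (intro bexI[of _ "\<lambda>x. - p x"]) (auto simp: polynomial_ring_def)
  qed (auto simp: polynomial_ring_def algebra_simps)
  show "Group.comm_monoid (polynomial_ring :: (real^'n \<Rightarrow> real) ring)"
    by (rule comm_monoidI) (auto simp: polynomial_ring_def algebra_simps)
qed (auto simp: polynomial_ring_def algebra_simps)

lemma ideal_vanishing_ideal:
  fixes S :: "(real^'n) set"
  shows "ideal (vanishing_ideal S) polynomial_ring"
proof (rule idealI)
  interpret cring "polynomial_ring :: (real^'n \<Rightarrow> real) ring"
    by (rule cring_polynomial_ring)
  show "ring (polynomial_ring :: (real^'n \<Rightarrow> real) ring)"
    by (rule ring_axioms)
  show "subgroup (vanishing_ideal S) (add_monoid (polynomial_ring :: (real^'n \<Rightarrow> real) ring))"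
  proof (rule group.subgroupI[OF a_group])
    fix p :: "real^'n \<Rightarrow> real"
    assume p: "p \<in> vanishing_ideal S"
    have "\<ominus>\<^bsub>polynomial_ring\<^esub> p = (\<lambda>x. - p x)"
      using p by (intro minus_equality)
        (auto simp: polynomial_ring_def vanishing_ideal_def real_polynomial_function_minus)
    then show "inv\<^bsub>add_monoid polynomial_ring\<^esub> p \<in> vanishing_ideal S"
      using p by (auto simp: a_inv_def vanishing_ideal_def real_polynomial_function_minus)
  next
    have "(\<lambda>x. 0) \<in> vanishing_ideal S"
      by (auto simp: vanishing_ideal_def)
    then show "vanishing_ideal S \<noteq> {}" by blast
  qed (auto simp: polynomial_ring_def vanishing_ideal_def)
qed (auto simp: polynomial_ring_def vanishing_ideal_def)

section \<open>Bricks\<close>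

text \<open>
  The real functions on \<open>[0,1] \<times> B\<close> induced by polynomials \<open>\<Sum>\<^sub>\<alpha> c\<^sub>\<alpha> x\<^sup>\<alpha>\<close> with coefficients
  \<open>c\<^sub>\<alpha>\<close> continuous on \<open>[0,1]\<close>; a multi-index is a function \<open>\<alpha> :: 'm \<Rightarrow> nat\<close> and
  \<open>B\<close> is the closed unit ball.
\<close>

definition restricts_C0_polynomial :: "(real \<times> (real^'m) \<Rightarrow> real) \<Rightarrow> bool" where
  "restricts_C0_polynomial h \<longleftrightarrow>
     (\<exists>(A :: ('m \<Rightarrow> nat) set) (c :: ('m \<Rightarrow> nat) \<Rightarrow> real \<Rightarrow> real).
        finite A \<and> (\<forall>\<alpha>\<in>A. continuous_on {0..1} (c \<alpha>)) \<and>
        (\<forall>t\<in>{0..1}. \<forall>x\<in>cball 0 1. h (t, x) = (\<Sum>\<alpha>\<in>A. c \<alpha> t * (\<Prod>j\<in>UNIV. (x $ j) ^ \<alpha> j))))"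

text \<open>
  The type argument carries the parameter \<open>m = CARD('m)\<close>, which does not occur in the type of \<open>T\<close>.
\<close>

definition brick :: "'m::finite itself \<Rightarrow> (real^'n) set \<Rightarrow> bool" where
  "brick _ T \<longleftrightarrow>
     semialgebraic T \<and> semialgebraic_dim T = enat CARD('n) \<and>
     (\<exists>H :: real \<times> (real^'m) \<Rightarrow> real^'n.
        continuous_on ({0..1} \<times> cball 0 1) H \<and> H ` ({0..1} \<times> cball 0 1) \<subseteq> T \<and>
        (\<forall>i. restricts_C0_polynomial (\<lambda>z. H z $ i)) \<and>
        H ` ({0} \<times> cball 0 1) = T \<and>
        (\<exists>b. \<forall>x\<in>cball 0 1. H (1, x) = b) \<and>
        (\<forall>t\<in>{0<..<1}. H ` ({t} \<times> cball 0 1) \<subseteq> interior T))"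

section \<open>Analytic paths\<close>

definition real_analytic_on :: "(real \<Rightarrow> real^'n) \<Rightarrow> real set \<Rightarrow> bool" where
  "real_analytic_on f U \<longleftrightarrow>
     (\<forall>t\<in>U. \<exists>r>0. \<exists>a :: nat \<Rightarrow> real^'n.
        \<forall>s. \<bar>s - t\<bar> < r \<longrightarrow> (\<lambda>k. (s - t) ^ k *\<^sub>R a k) sums f s)"

definition analytic_path :: "(real \<Rightarrow> real^'n) \<Rightarrow> bool" where
  "analytic_path \<alpha> \<longleftrightarrow>
     (\<exists>U \<beta>. open U \<and> {0..1} \<subseteq> U \<and> real_analytic_on \<beta> U \<and> (\<forall>t\<in>{0..1}. \<alpha> t = \<beta> t))"

definition connected_by_analytic_paths :: "(real^'n) set \<Rightarrow> bool" where
  "connected_by_analytic_paths S \<longleftrightarrow>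
     (\<forall>p\<^sub>1\<in>S. \<forall>p\<^sub>2\<in>S. \<exists>\<alpha>. analytic_path \<alpha> \<and> \<alpha> ` {0..1} \<subseteq> S \<and> \<alpha> 0 = p\<^sub>1 \<and> \<alpha> 1 = p\<^sub>2)"

end

(* From (ii) one gets analytic paths as images of segments. For (i) ==> (ii), write the brick T as the
   image of the unit ball under a polynomial map P_0 which is a limit of maps P with P(B) inside
   Int(T). The coefficient vectors of such maps P form a semialgebraic set (Tarski-Seidenberg), so
   curve selection, with a truncated Puiseux expansion, gives a polynomial curve s |-> Q_s with
   Q_0 = P_0 and dist(Q_s(B), complement of T) >= c s^L for small s > 0. The maps Q_s contract to
   constant maps by x |-> Q_s((1 - l) x). Constant maps with values in Int(S) are linked by analytic
   paths in S starting off a hypersurface {g = 0} that contains the frontier of S; such a path meets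
   the hypersurface only finitely often and with finite order of contact. Concatenation gives a
   continuous curve t |-> F_t of polynomial maps with images in S, visiting a parametrization of every
   brick. It leaves the interior of S at finitely many times, where it has jets of all orders and
   finite contact, so Hermite interpolation together with the Weierstrass approximation theorem makes
   it polynomial without changing those values. Finally (t, x) |-> F_t(U(t) x) is defined on the ball
   of one dimension more, where sin(k theta) = sin(theta) U(cos theta) and the bricks are visited at
   the times t with |sin(k theta)| = 1, at which x |-> U(t) x maps the slice of the ball onto B. *)

theory Submission
  imports Defs
begin

section \<open>Order isomorphisms of the line matching the signs of polynomials\<close>

text \<open>The coefficients of a brick homotopy are merely continuous in the time, so near time 0
  its images may approach the frontier faster than any power of the time. Curve selection is there
  to exclude this: once the margin decays no faster than a power, an approximation error of the form
  W r, with W vanishing to that order at the critical times, stays below it. For the same reason the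
  paths in (i) have to be analytic: finite order of contact is what a polynomial correction can
  respect.

  Quantifier elimination is proved in the form that the signs of finitely many polynomials in the
  parameters determine the sign diagram in one further variable up to an increasing bijection of the
  line. Such bijections replace enumerated roots depending on the parameters. Puiseux expansions are
  needed to finite order only and appear as estimates on one side of 0.

  The factor U(t) is dictated by the shape of the ball: the slice at height cos(theta) has radius
  sin(theta), and U(cos(theta)) stretches it to radius |sin(k theta)|, at most 1 everywhere and
  equal to 1 at the k prescribed heights.\<close>

definition order_iso :: "(real \<Rightarrow> real) \<Rightarrow> bool" where
  "order_iso h \<longleftrightarrow> strict_mono h \<and> surj h"

lemma order_iso_id: "order_iso (\<lambda>x. x)"
  by (auto simp: order_iso_def strict_mono_def surj_def)

lemma order_iso_comp: "order_iso g \<Longrightarrow> order_iso h \<Longrightarrow> order_iso (\<lambda>x. g (h x))"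
  by (auto simp: order_iso_def strict_mono_def surj_def) metis

lemma order_iso_less: "order_iso h \<Longrightarrow> h x < h y \<longleftrightarrow> x < y"
  by (simp add: order_iso_def strict_mono_less)

lemma order_iso_eq: "order_iso h \<Longrightarrow> h x = h y \<longleftrightarrow> x = y"
  by (simp add: order_iso_def strict_mono_eq)

lemma order_iso_le: "order_iso h \<Longrightarrow> h x \<le> h y \<longleftrightarrow> x \<le> y"
  by (simp add: order_iso_def strict_mono_less_eq)

lemma order_iso_surj: "order_iso h \<Longrightarrow> \<exists>x. h x = y"
  by (auto simp: order_iso_def surj_def) metis

lemma order_iso_inv:
  assumes "order_iso h"
  obtains g where "order_iso g" "\<And>y. h (g y) = y" "\<And>x. g (h x) = x"
proof -
  obtain g where 1: "h (g y) = y" for y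
    using order_iso_surj[OF assms] by metis
  have 2: "g (h x) = x" for x
    using 1 order_iso_eq[OF assms] by blast
  have "g x < g y" if "x < y" for x y
    using that 1 order_iso_less[OF assms] by metis
  then have "order_iso g"
    using 2 by (auto simp: order_iso_def strict_mono_def surj_def) metis
  then show thesis using that 1 2 by blast
qed

text \<open>The negation says that \<open>u\<close> and \<open>v\<close> lie in one component of the
  complement of \<open>Z\<close>. A point of \<open>Z\<close> is apart from itself, so statements
  about displacing a point that may lie in \<open>Z\<close> carry the extra alternative that it is
  fixed.\<close>

definition apart :: "real set \<Rightarrow> real \<Rightarrow> real \<Rightarrow> bool" where
  "apart Z u v \<longleftrightarrow> closed_segment u v \<inter> Z \<noteq> {}"

lemma not_apart_trans:
  "\<not> apart Z u v \<Longrightarrow> \<not> apart Z v w \<Longrightarrow> \<not> apart Z u w"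
  by (auto simp: apart_def closed_segment_eq_real_ivl disjoint_iff split: if_splits) (meson linear)+

lemma apart_commute: "apart Z u v \<longleftrightarrow> apart Z v u"
  by (simp add: apart_def closed_segment_commute)

lemma not_apart_memD: "\<not> apart Z u v \<Longrightarrow> u \<notin> Z" "\<not> apart Z u v \<Longrightarrow> v \<notin> Z"
  by (auto simp: apart_def)

lemma order_iso_apart:
  assumes "order_iso h"
  shows "apart (h ` Z) (h u) (h v) \<longleftrightarrow> apart Z u v"
  using order_iso_le[OF assms]
  by (auto simp: apart_def closed_segment_eq_real_ivl disjoint_iff)

text \<open>The piecewise linear bijection with graph through (a, a), (u, v), (b, b), and the
  identity outside the interval; exchanging \<open>u\<close> and \<open>v\<close> inverts
  it.\<close>

definition bump :: "real \<Rightarrow> real \<Rightarrow> real \<Rightarrow> real \<Rightarrow> real \<Rightarrow> real" where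
  "bump a b u v z = (if z \<le> a \<or> b \<le> z then z
     else if z \<le> u then a + (z - a) * (v - a) / (u - a)
     else b - (b - z) * (b - v) / (b - u))"

lemma bump_range:
  assumes "a < u" "u < b" "a < v" "v < b" "a < z" "z < b"
  shows "a < bump a b u v z" "bump a b u v z < b" "bump a b u v z \<le> v \<longleftrightarrow> z \<le> u"
proof -
  have "0 < (z - a) * (v - a) / (u - a)" "0 < (b - z) * (b - v) / (b - u)" using assms by simp_all
  moreover have "(z - a) * (v - a) / (u - a) \<le> v - a" if "z \<le> u"
    using assms that by (simp add: divide_simps mult.commute mult_left_mono)
  moreover have "(b - z) * (b - v) / (b - u) < b - v" if "z > u"
    using assms that by (simp add: divide_simps mult.commute mult_strict_left_mono)
  ultimately show "a < bump a b u v z" "bump a b u v z < b" "bump a b u v z \<le> v \<longleftrightarrow> z \<le> u"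
    using assms by (auto simp: bump_def)
qed

lemma bump_inverse:
  assumes "a < u" "u < b" "a < v" "v < b"
  shows "bump a b v u (bump a b u v z) = z"
proof (cases "a < z \<and> z < b")
  case True
  then have z: "a < z" "z < b" by auto
  note r = bump_range[OF assms z]
  show ?thesis
  proof (cases "z \<le> u")
    case True
    then have "bump a b u v z = a + (z - a) * (v - a) / (u - a)" using z by (simp add: bump_def)
    then show ?thesis using True r z assms unfolding bump_def[of a b v u] by (auto simp: field_simps)
  next
    case False
    then have "bump a b u v z = b - (b - z) * (b - v) / (b - u)" using z by (simp add: bump_def)
    then show ?thesis using False r z assms unfolding bump_def[of a b v u] by (auto simp: field_simps)
  qed
qed (auto simp: bump_def)

lemma bump_mono:
  assumes "a < u" "u < b" "a < v" "v < b" "z < w"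
  shows "bump a b u v z < bump a b u v w"
proof -
  consider "z \<le> a" | "b \<le> w" | "a < z" "w < b" by linarith
  then show ?thesis
  proof cases
    case 1
    then have "bump a b u v z = z" by (simp add: bump_def)
    moreover have "z < bump a b u v w" using bump_range[OF assms(1-4), of w] 1 assms
      by (cases "a < w \<and> w < b") (auto simp: bump_def)
    ultimately show ?thesis by simp
  next
    case 2
    then have "bump a b u v w = w" by (simp add: bump_def)
    moreover have "bump a b u v z < w" using bump_range[OF assms(1-4), of z] 2 assms
      by (cases "a < z \<and> z < b") (auto simp: bump_def)
    ultimately show ?thesis by simp
  next
    case 3
    then have z: "a < z" "z < b" "a < w" "w < b" using assms by auto
    consider "w \<le> u" | "u < z" | "z \<le> u" "u < w" by linarith
    then show ?thesis
    proof cases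
      case 1
      then show ?thesis using z assms by (auto simp: bump_def divide_simps mult_strict_right_mono)
    next
      case 2
      then show ?thesis using z assms by (auto simp: bump_def divide_simps mult_strict_right_mono)
    next
      case 3
      then have "bump a b u v z \<le> v" "\<not> bump a b u v w \<le> v"
        using bump_range[OF assms(1-4)] z by auto
      then show ?thesis by linarith
    qed
  qed
qed

text \<open>A finite set missing the segment also misses a slightly larger open interval. A map that
  moves only points of that interval, and keeps them in it, cannot carry a point across
  \<open>N\<close>.\<close>

lemma exists_bump:
  assumes "finite N" "\<not> apart N u v"
  shows "\<exists>\<psi>. order_iso \<psi> \<and> \<psi> u = v \<and> (\<forall>z. \<psi> z = z \<or> \<not> apart N z (\<psi> z))"
proof -
  \<comment> \<open>Points of the segment are removed here because the induction runs over arbitrary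
    finite sets, not only those missing the segment.\<close>
  have sep: "finite N \<Longrightarrow> \<exists>a b. a < min u v \<and> max u v < b \<and> {a<..<b} \<inter> (N - closed_segment u v) = {}"
    for N
  proof (induction N rule: finite_induct)
    case empty
    show ?case by (rule exI[of _ "min u v - 1"], rule exI[of _ "max u v + 1"]) auto
  next
    case (insert n N)
    then obtain a b where ab: "a < min u v" "max u v < b" "{a<..<b} \<inter> (N - closed_segment u v) = {}"
      by blast
    show ?case
    proof (cases "n \<in> closed_segment u v")
      case True
      then show ?thesis using ab by (intro exI[of _ a] exI[of _ b]) auto
    next
      case False
      then have "n < min u v \<or> max u v < n"
        by (auto simp: closed_segment_eq_real_ivl split: if_splits)
      then show ?thesis
      proof
        assume "n < min u v"
        then show ?thesis using ab by (intro exI[of _ "max n a"] exI[of _ b]) (auto simp: disjoint_iff)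
      next
        assume "max u v < n"
        then show ?thesis using ab by (intro exI[of _ a] exI[of _ "min n b"]) (auto simp: disjoint_iff)
      qed
    qed
  qed
  from sep[OF assms(1)] obtain a b where ab: "a < min u v" "max u v < b" 
    "{a<..<b} \<inter> (N - closed_segment u v) = {}" by blast
  then have N: "{a<..<b} \<inter> N = {}" using assms(2) by (auto simp: apart_def)
  have lt: "a < u" "u < b" "a < v" "v < b" using ab by auto
  show ?thesis
  proof (intro exI[of _ "bump a b u v"] conjI allI)
    show "order_iso (bump a b u v)"
      unfolding order_iso_def strict_mono_def surj_def
      using bump_mono[OF lt] bump_inverse[OF lt(3,4,1,2)] by metis
    show "bump a b u v u = v" using lt by (auto simp: bump_def)
    fix z
    show "bump a b u v z = z \<or> \<not> apart N z (bump a b u v z)"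
    proof (cases "a < z \<and> z < b")
      case True
      then have "closed_segment z (bump a b u v z) \<subseteq> {a<..<b}"
        using bump_range[OF lt, of z] by (auto simp: closed_segment_eq_real_ivl split: if_splits)
      then show ?thesis using N by (auto simp: apart_def)
    qed (auto simp: bump_def)
  qed
qed


text \<open>What the induction on degrees supplies: \<open>h\<close> carries the signs of the
  derivative everywhere, but the signs of \<open>p\<close> itself only on \<open>Z\<close>. Since
  \<open>Z\<close> contains all critical points, \<open>p\<close> is strictly monotone on each
  component of the complement of \<open>Z\<close> (each cell), so a cell holds at most one
  root.\<close>

definition poly_match :: "real poly \<Rightarrow> real poly \<Rightarrow> (real \<Rightarrow> real) \<Rightarrow> real set \<Rightarrow> bool" where
  "poly_match p q h Z \<longleftrightarrow> finite Z \<and> order_iso h \<and> (\<forall>x. x \<notin> Z \<longrightarrow> poly (pderiv p) x \<noteq> 0) \<and>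
     (\<forall>x. sgn (poly (pderiv p) x) = sgn (poly (pderiv q) (h x))) \<and>
     (\<forall>x\<in>Z. sgn (poly p x) = sgn (poly q (h x)))"

text \<open>Matching is symmetric, which turns the transfer statements below into
  equivalences.\<close>

lemma poly_match_inv:
  assumes "poly_match p q h Z"
  obtains g where "poly_match q p g (h ` Z)" "order_iso g" "\<And>y. h (g y) = y" "\<And>x. g (h x) = x"
proof -
  obtain g where g: "order_iso g" "\<And>y. h (g y) = y" "\<And>x. g (h x) = x"
    using order_iso_inv[of h] assms by (auto simp: poly_match_def)
  have "poly (pderiv q) y \<noteq> 0" if "y \<notin> h ` Z" for y
    using that assms g by (metis poly_match_def imageI sgn_zero_iff)
  moreover have "sgn (poly (pderiv q) y) = sgn (poly (pderiv p) (g y))" for y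
    using assms g by (metis poly_match_def)
  ultimately have "poly_match q p g (h ` Z)"
    using assms g by (auto simp: poly_match_def)
  then show thesis using that g by blast
qed

lemma poly_sgn_not_apart:
  fixes p :: "real poly"
  assumes "\<And>x. x \<notin> Z \<Longrightarrow> poly p x \<noteq> 0" "\<not> apart Z u v"
  shows "sgn (poly p u) = sgn (poly p v)"
proof -
  have nz: "poly p x \<noteq> 0" if "x \<in> closed_segment u v" for x
    using that assms by (auto simp: apart_def)
  have *: "sgn (poly p a) = sgn (poly p b)" if "a < b" "closed_segment a b = closed_segment u v" for a b
  proof (rule ccontr)
    assume "\<not> ?thesis"
    moreover have "poly p a \<noteq> 0" "poly p b \<noteq> 0" using that nz by (metis ends_in_segment)+
    ultimately have "poly p a * poly p b < 0"
      by (auto simp: sgn_if mult_less_0_iff split: if_splits)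
    then obtain x where "a < x" "x < b" "poly p x = 0" using poly_IVT \<open>a < b\<close> by blast
    moreover have "closed_segment a b = {a..b}" using that(1) by (simp add: closed_segment_eq_real_ivl)
    ultimately have "x \<in> closed_segment u v" unfolding that(2)[symmetric] by simp
    then show False using nz \<open>poly p x = 0\<close> by blast
  qed
  consider "u = v" | "u < v" | "v < u" by linarith
  then show ?thesis
  proof cases
    case 2
    then show ?thesis using * by blast
  next
    case 3
    then show ?thesis using *[OF 3] closed_segment_commute by metis
  qed simp
qed

text \<open>Mean value theorem. The sign of the derivative as a factor makes \<open>p\<close>
  increasing in either case. Only the open interval has to avoid \<open>Z\<close>: the ends
  \<open>v\<close>, \<open>w\<close> may belong to it, so values inside a cell can be compared with
  the known signs at its ends.\<close>

lemma poly_mono_cell: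
  fixes p :: "real poly"
  assumes "\<And>x. x \<notin> Z \<Longrightarrow> poly (pderiv p) x \<noteq> 0" "x \<notin> Z" "v < w" "v \<le> x" "x \<le> w"
    "{v<..<w} \<inter> Z = {}"
  shows "sgn (poly (pderiv p) x) * poly p v < sgn (poly (pderiv p) x) * poly p w"
proof -
  obtain y where y: "v < y" "y < w" "poly p w - poly p v = (w - v) * poly (pderiv p) y"
    using poly_MVT[OF \<open>v < w\<close>] by blast
  have "y \<notin> Z" using y assms by auto
  have "\<not> apart Z x y"
    using assms y by (auto simp: apart_def closed_segment_eq_real_ivl disjoint_iff) (metis order_le_less order_trans not_le)+
  then have "sgn (poly (pderiv p) x) = sgn (poly (pderiv p) y)"
    using poly_sgn_not_apart[of Z "pderiv p"] assms by blast
  moreover have "0 < (w - v) * (sgn (poly (pderiv p) y) * poly (pderiv p) y)"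
    using assms(1)[OF \<open>y \<notin> Z\<close>] \<open>v < w\<close> by (auto simp: sgn_if)
  ultimately have "0 < sgn (poly (pderiv p) x) * (poly p w - poly p v)"
    unfolding y(3) by (simp add: mult.left_commute)
  then show ?thesis by (simp add: algebra_simps)
qed

text \<open>For the unbounded cells, which lack an end in \<open>Z\<close> with a known sign. An
  increasing nonconstant polynomial has positive leading coefficient, as otherwise its values would
  eventually fall below the one at 0.\<close>

lemma real_poly_unbounded_right:
  fixes p :: "real poly"
  assumes "pderiv p \<noteq> 0" "\<And>t u. 0 \<le> t \<Longrightarrow> t < u \<Longrightarrow> poly p t < poly p u"
  shows "\<exists>t>0. poly p t > C"
proof -
  have deg: "degree p > 0" using assms(1) pderiv_eq_0_iff by blast
  have lc: "lead_coeff p > 0"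
  proof (rule ccontr)
    assume neg: "\<not> 0 < lead_coeff p"
    have "degree ([:poly p 0:] + (- p)) = degree (- p)"
      by (rule degree_add_eq_right) (use deg in simp)
    then have "lead_coeff ([:poly p 0:] - p) = - lead_coeff p"
      using deg by (simp add: coeff_pCons split: nat.splits)
    moreover have "lead_coeff p \<noteq> 0" using deg by (metis degree_0 leading_coeff_0_iff less_irrefl)
    ultimately have "0 < lead_coeff ([:poly p 0:] - p)" using neg by linarith
    from poly_pinfty_gt_lc[OF this] obtain n where n: "\<And>x. n \<le> x \<Longrightarrow> poly ([:poly p 0:] - p) x > 0"
      using \<open>0 < lead_coeff ([:poly p 0:] - p)\<close> by force
    have "poly p (max n 1) < poly p 0" using n[of "max n 1"] by simp
    then show False using assms(2)[of 0 "max n 1"] by linarith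
  qed
  have "degree (p + (- [:C:])) = degree p"
    by (rule degree_add_eq_left) (use deg in simp)
  then have "degree (p - [:C:]) = degree p" unfolding diff_conv_add_uminus .
  then have "lead_coeff (p - [:C:]) = lead_coeff p"
    using deg by (simp add: coeff_pCons split: nat.splits)
  then have "0 < lead_coeff (p - [:C:])" using lc by simp
  from poly_pinfty_gt_lc[OF this] obtain n where n: "\<And>x. n \<le> x \<Longrightarrow> poly (p - [:C:]) x > 0"
    using \<open>0 < lead_coeff (p - [:C:])\<close> by force
  show ?thesis using n[of "max n 1"] by (intro exI[of _ "max n 1"]) simp
qed

text \<open>Normalised to be increasing on the cell of \<open>x\<close>, \<open>p\<close> is
  negative towards the left end of that cell; \<open>v\<close> may be the end itself. Together with
  the mirror image \<open>pos_right\<close> this characterises the cells that contain a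
  root.\<close>

definition neg_left :: "real set \<Rightarrow> real poly \<Rightarrow> real \<Rightarrow> bool" where
  "neg_left Z p x \<longleftrightarrow> (\<exists>v<x. {v<..x} \<inter> Z = {} \<and> sgn (poly (pderiv p) x) * poly p v < 0)"

definition pos_right :: "real set \<Rightarrow> real poly \<Rightarrow> real \<Rightarrow> bool" where
  "pos_right Z p x \<longleftrightarrow> (\<exists>v>x. {x..<v} \<inter> Z = {} \<and> sgn (poly (pderiv p) x) * poly p v > 0)"

text \<open>If the cell has a left end \<open>z\<close> in \<open>Z\<close>, monotonicity moves the
  negative value to \<open>z\<close>, where \<open>h\<close> is known to preserve the sign. If the
  cell extends to minus infinity, the normalised \<open>q\<close> is unbounded below there.\<close>

lemma neg_left_transfer:
  assumes m: "poly_match p q h Z" and x: "x \<notin> Z" and nl: "neg_left Z p x"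
  shows "neg_left (h ` Z) q (h x)"
proof -
  have fin: "finite Z" and h: "order_iso h" and pd: "\<And>x. x \<notin> Z \<Longrightarrow> poly (pderiv p) x \<noteq> 0"
    and sd: "\<And>x. sgn (poly (pderiv p) x) = sgn (poly (pderiv q) (h x))"
    and sz: "\<And>x. x \<in> Z \<Longrightarrow> sgn (poly p x) = sgn (poly q (h x))"
    using m by (auto simp: poly_match_def)
  obtain g where g: "order_iso g" "\<And>y. h (g y) = y" "\<And>x. g (h x) = x"
    using order_iso_inv[OF h] by metis
  have qd: "\<And>y. y \<notin> h ` Z \<Longrightarrow> poly (pderiv q) y \<noteq> 0"
    by (metis g(2) imageI pd sd sgn_zero_iff)
  obtain v where v: "v < x" "{v<..x} \<inter> Z = {}" "sgn (poly (pderiv p) x) * poly p v < 0"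
    using nl by (auto simp: neg_left_def)
  have hx: "h x \<notin> h ` Z" using x order_iso_eq[OF h] by auto
  show ?thesis
  proof (cases "Z \<inter> {..<x} = {}")
    case False
    define z where "z = Max (Z \<inter> {..<x})"
    have z: "z \<in> Z" "z < x" using Max_in[of "Z \<inter> {..<x}"] fin False by (auto simp: z_def)
    have zmax: "w \<le> z" if "w \<in> Z" "w < x" for w using that fin by (auto simp: z_def)
    have zx: "{z<..x} \<inter> Z = {}" using zmax x by (force simp: order_le_less)
    have "z \<le> v"
      using v(2) z by (meson IntI disjoint_iff greaterThanAtMost_iff less_imp_le not_le)
    have "sgn (poly (pderiv p) x) * poly p z < 0"
    proof (cases "z = v")
      case False
      then have "z < v" using \<open>z \<le> v\<close> by auto
      have "v \<notin> Z" using \<open>z < v\<close> zx v by (auto simp: disjoint_iff)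
      have "\<not> apart Z x v" using zx \<open>z < v\<close> v
        by (auto simp: apart_def closed_segment_eq_real_ivl disjoint_iff)
      then have e: "sgn (poly (pderiv p) x) = sgn (poly (pderiv p) v)"
        using poly_sgn_not_apart[of Z "pderiv p"] pd by blast
      have "{z<..<v} \<inter> Z = {}" using zx v(1) by (auto simp: disjoint_iff)
      then show ?thesis using poly_mono_cell[OF pd \<open>v \<notin> Z\<close> \<open>z < v\<close>] v e \<open>z < v\<close> by auto
    qed (use v in simp)
    then have "sgn (poly (pderiv q) (h x)) * poly q (h z) < 0"
      using sd[of x] sz[OF z(1)] by (auto simp: sgn_if mult_less_0_iff split: if_splits)
    moreover have "{h z<..h x} \<inter> h ` Z = {}"
      using zx order_iso_less[OF h] order_iso_le[OF h] by (auto simp: disjoint_iff)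
    ultimately show ?thesis using z order_iso_less[OF h] unfolding neg_left_def by blast
  next
    case True
    then have none: "h ` Z \<inter> {..h x} = {}"
      using order_iso_le[OF h] x by (auto simp: order_le_less)
    define s where "s = sgn (poly (pderiv q) (h x))"
    have s: "s \<noteq> 0" using qd[OF hx] by (simp add: s_def sgn_zero_iff)
    \<comment> \<open>Reflected and normalised so that moving left from \<open>h x\<close> becomes
      moving right from 0 along an increasing polynomial.\<close>
    define r where "r = smult (- s) (pcompose q [:h x, -1:])"
    have r: "poly r t = - s * poly q (h x - t)" for t by (simp add: r_def poly_pcompose)
    have sg: "sgn (poly (pderiv q) y) = s" if "y \<le> h x" for y
      unfolding s_def by (rule poly_sgn_not_apart[of "h ` Z", OF qd])
        (use none that in \<open>auto simp: apart_def closed_segment_eq_real_ivl disjoint_iff\<close>)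
    have "poly r t < poly r u" if "0 \<le> t" "t < u" for t u
    proof -
      have "{h x - u<..<h x - t} \<inter> h ` Z = {}" "h x - t \<notin> h ` Z" using none that
        by (auto simp: disjoint_iff)
      then have "sgn (poly (pderiv q) (h x - t)) * poly q (h x - u) < sgn (poly (pderiv q) (h x - t)) * poly q (h x - t)"
        using that by (intro poly_mono_cell[of "h ` Z", OF qd]) auto
      then show ?thesis using sg[of "h x - t"] that by (simp add: r)
    qed
    moreover have "pderiv r \<noteq> 0"
    proof
      assume "pderiv r = 0"
      then have "poly (pderiv r) 0 = 0" by simp
      moreover have "pderiv r = smult s (pcompose (pderiv q) [:h x, -1:])"
        unfolding r_def pderiv_smult pderiv_pcompose by (simp add: pderiv_pCons)
      ultimately show False using s qd[OF hx] by (simp add: poly_pcompose)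
    qed
    ultimately obtain t where "t > 0" "poly r t > 0" using real_poly_unbounded_right by blast
    then show ?thesis using none unfolding neg_left_def
      by (intro exI[of _ "h x - t"]) (auto simp: r s_def disjoint_iff)
  qed
qed

text \<open>Replacing p(x) by -p(-x) keeps the derivative at corresponding points and exchanges the
  two ends together with their signs, so the right end needs no argument of its own.\<close>

lemma neg_left_reflect:
  "neg_left (uminus ` Z) (- pcompose p [:0, -1:]) (- x) \<longleftrightarrow> pos_right Z p x"
proof -
  have d: "poly (pderiv (- pcompose p [:0, -1:])) (- x) = poly (pderiv p) x"
    by (simp add: pderiv_minus pderiv_pcompose pderiv_pCons poly_pcompose)
  have e: "poly (- pcompose p [:0, -1:]) v = - poly p (- v)" for v by (simp add: poly_pcompose)
  show ?thesis
    unfolding neg_left_def pos_right_def d e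
  proof (intro iffI; elim exE conjE)
    fix v assume v: "v < - x" "{v<..- x} \<inter> uminus ` Z = {}" "sgn (poly (pderiv p) x) * - poly p (- v) < 0"
    have "{x..<-v} \<inter> Z = {}"
    proof (clarsimp simp: disjoint_iff)
      fix z assume "x \<le> z" "z < -v" "z \<in> Z"
      then have "-z \<in> {v<..- x} \<inter> uminus ` Z" by auto
      then show False using v by simp
    qed
    then show "\<exists>v>x. {x..<v} \<inter> Z = {} \<and> 0 < sgn (poly (pderiv p) x) * poly p v"
      using v by (intro exI[of _ "-v"]) auto
  next
    fix v assume v: "x < v" "{x..<v} \<inter> Z = {}" "0 < sgn (poly (pderiv p) x) * poly p v"
    then show "\<exists>v < - x. {v<..- x} \<inter> uminus ` Z = {} \<and> sgn (poly (pderiv p) x) * - poly p (- v) < 0"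
      by (intro exI[of _ "-v"]) (auto simp: disjoint_iff)
  qed
qed

lemma pos_right_transfer:
  assumes m: "poly_match p q h Z" and x: "x \<notin> Z" and pr: "pos_right Z p x"
  shows "pos_right (h ` Z) q (h x)"
proof -
  let ?n = "\<lambda>p. - pcompose p [:0, -1 :: real:]"
  have d: "poly (pderiv (?n p)) y = poly (pderiv p) (- y)" for p y
    by (simp add: pderiv_minus pderiv_pcompose pderiv_pCons poly_pcompose)
  have "order_iso (\<lambda>x. - h (- x))"
  proof -
    obtain g where g: "order_iso g" "\<And>y. h (g y) = y" "\<And>x. g (h x) = x"
      using order_iso_inv[of h] m by (auto simp: poly_match_def)
    have "\<exists>x. y = - h (- x)" for y by (rule exI[of _ "- g (- y)"]) (simp add: g)
    then show ?thesis
      using m by (auto simp: poly_match_def order_iso_def strict_mono_def surj_def)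
  qed
  moreover have "- y \<notin> Z" if "y \<notin> uminus ` Z" for y
    using that by (metis add.inverse_inverse imageI)
  ultimately have "poly_match (?n p) (?n q) (\<lambda>x. - h (- x)) (uminus ` Z)"
    using m unfolding poly_match_def d by (simp add: poly_pcompose sgn_minus)
  from neg_left_transfer[OF this, of "-x"] x pr neg_left_reflect[of Z p x]
  have "neg_left ((\<lambda>x. - h (- x)) ` uminus ` Z) (?n q) (- h x)" by fastforce
  moreover have "(\<lambda>x. - h (- x)) ` uminus ` Z = uminus ` h ` Z" by (auto simp: image_image)
  ultimately show ?thesis using neg_left_reflect by simp
qed

lemma exists_root_in_cell:
  assumes pd: "\<And>x. x \<notin> Z \<Longrightarrow> poly (pderiv p) x \<noteq> 0" and x: "x \<notin> Z"
    and "neg_left Z p x" "pos_right Z p x"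
  shows "\<exists>y. poly p y = 0 \<and> \<not> apart Z x y"
proof -
  obtain v where v: "v < x" "{v<..x} \<inter> Z = {}" "sgn (poly (pderiv p) x) * poly p v < 0"
    using assms by (auto simp: neg_left_def)
  obtain w where w: "w > x" "{x..<w} \<inter> Z = {}" "sgn (poly (pderiv p) x) * poly p w > 0"
    using assms by (auto simp: pos_right_def)
  have "poly p v * poly p w < 0" using v w by (auto simp: sgn_if mult_less_0_iff zero_less_mult_iff split: if_splits)
  then obtain y where y: "v < y" "y < w" "poly p y = 0" using poly_IVT v w by (meson less_trans)
  then have "\<not> apart Z x y" using v w
    by (auto simp: apart_def closed_segment_eq_real_ivl disjoint_iff)
  then show ?thesis using y by blast
qed

text \<open>The sign of \<open>p\<close> at a point of a cell is determined by the sign of the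
  derivative, the behaviour at the two ends, and the side of the root if there is one. These are the
  data that the corrected order isomorphism has to preserve.\<close>

lemma sgn_from_cell:
  assumes pd: "\<And>x. x \<notin> Z \<Longrightarrow> poly (pderiv p) x \<noteq> 0" and x: "x \<notin> Z" and fin: "finite Z"
  shows "\<not> neg_left Z p x \<Longrightarrow> sgn (poly p x) = sgn (poly (pderiv p) x)"
    and "\<not> pos_right Z p x \<Longrightarrow> sgn (poly p x) = - sgn (poly (pderiv p) x)"
    and "poly p y = 0 \<Longrightarrow> \<not> apart Z x y \<Longrightarrow> sgn (poly p x) = sgn (x - y) * sgn (poly (pderiv p) x)"
    and "poly p x = 0 \<Longrightarrow> neg_left Z p x \<and> pos_right Z p x"
proof -
  \<comment> \<open>The points \<open>x - d\<close> and \<open>x + d\<close> still belong to the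
    closed cell of \<open>x\<close>; the strict inequalities \<open>l\<close> and \<open>r\<close>
    also settle the case of a zero at \<open>x\<close>.\<close>
  obtain d where d: "d > 0" "\<forall>z\<in>Z. z \<noteq> x \<longrightarrow> d \<le> dist x z"
    using finite_set_avoid[OF fin] by blast
  have dl: "{x - d<..x} \<inter> Z = {}" "{x..<x + d} \<inter> Z = {}" 
    using d x by (auto simp: dist_real_def disjoint_iff)
  have l: "sgn (poly (pderiv p) x) * poly p (x - d) < sgn (poly (pderiv p) x) * poly p x"
    by (rule poly_mono_cell[of Z, OF pd]) (use d dl x in \<open>auto simp: disjoint_iff\<close>)
  have r: "sgn (poly (pderiv p) x) * poly p x < sgn (poly (pderiv p) x) * poly p (x + d)"
    by (rule poly_mono_cell[of Z, OF pd]) (use d dl x in \<open>auto simp: disjoint_iff\<close>)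
  have nz: "sgn (poly (pderiv p) x) \<in> {1, -1}" using pd[OF x] by (auto simp: sgn_if)
  show "sgn (poly p x) = sgn (poly (pderiv p) x)" if "\<not> neg_left Z p x"
  proof -
    have "\<not> sgn (poly (pderiv p) x) * poly p (x - d) < 0" using that dl d by (auto simp: neg_left_def)
    then show ?thesis using nz l by (auto simp: sgn_if split: if_splits)
  qed
  show "sgn (poly p x) = - sgn (poly (pderiv p) x)" if "\<not> pos_right Z p x"
  proof -
    have "\<not> sgn (poly (pderiv p) x) * poly p (x + d) > 0" using that dl d by (auto simp: pos_right_def)
    then show ?thesis using nz r by (auto simp: sgn_if split: if_splits)
  qed
  show "neg_left Z p x \<and> pos_right Z p x" if "poly p x = 0"
  proof
    show "neg_left Z p x" using that l dl d unfolding neg_left_def by (intro exI[of _ "x - d"]) simp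
    show "pos_right Z p x" using that r dl d unfolding pos_right_def by (intro exI[of _ "x + d"]) simp
  qed
  show "sgn (poly p x) = sgn (x - y) * sgn (poly (pderiv p) x)" if "poly p y = 0" "\<not> apart Z x y"
  proof -
    consider "x = y" | "x < y" | "y < x" by linarith
    then show ?thesis
    proof cases
      case 2
      then have "sgn (poly (pderiv p) x) * poly p x < sgn (poly (pderiv p) x) * poly p y"
        using that by (intro poly_mono_cell[of Z, OF pd]) (auto simp: x apart_def closed_segment_eq_real_ivl disjoint_iff)
      then show ?thesis using 2 that nz by (auto simp: sgn_if split: if_splits)
    next
      case 3
      then have "sgn (poly (pderiv p) x) * poly p y < sgn (poly (pderiv p) x) * poly p x"
        using that by (intro poly_mono_cell[of Z, OF pd]) (auto simp: x apart_def closed_segment_eq_real_ivl disjoint_iff)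
      then show ?thesis using 3 that nz by (auto simp: sgn_if split: if_splits)
    qed (use that in auto)
  qed
qed

lemma root_in_cell_unique:
  assumes pd: "\<And>x. x \<notin> Z \<Longrightarrow> poly (pderiv p) x \<noteq> 0" and "\<not> apart Z x y" "poly p x = 0" "poly p y = 0"
  shows "x = y"
proof (rule ccontr)
  assume "x \<noteq> y"
  have *: False if "a < b" "poly p a = 0" "poly p b = 0" "\<not> apart Z a b" for a b
  proof -
    obtain z where "a < z" "z < b" "poly p b - poly p a = (b - a) * poly (pderiv p) z"
      using poly_MVT[OF \<open>a < b\<close>] by blast
    moreover have "z \<notin> Z" using calculation that by (auto simp: apart_def closed_segment_eq_real_ivl disjoint_iff)
    ultimately show False using that pd by auto
  qed
  show False using *[of x y] *[of y x] assms apart_commute \<open>x \<noteq> y\<close> by (metis linorder_neqE)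
qed

lemma poly_match_ends:
  assumes m: "poly_match p q h Z" and x: "x \<notin> Z"
  shows "neg_left (h ` Z) q (h x) \<longleftrightarrow> neg_left Z p x" "pos_right (h ` Z) q (h x) \<longleftrightarrow> pos_right Z p x"
proof -
  obtain g where g: "order_iso g" "\<And>y. h (g y) = y" "\<And>x. g (h x) = x" "poly_match q p g (h ` Z)"
    using poly_match_inv[OF m] by metis
  have "g ` h ` Z = Z" using g by (auto simp: image_image)
  moreover have "h x \<notin> h ` Z" using x g(3) by (metis imageE)
  ultimately show "neg_left (h ` Z) q (h x) \<longleftrightarrow> neg_left Z p x" "pos_right (h ` Z) q (h x) \<longleftrightarrow> pos_right Z p x"
    using neg_left_transfer[OF m x] neg_left_transfer[OF g(4), of "h x"]
      pos_right_transfer[OF m x] pos_right_transfer[OF g(4), of "h x"] g(3) by auto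
qed

text \<open>By the end criterion a cell contains a root of \<open>p\<close> exactly if the
  corresponding cell contains one of \<open>q\<close>, and then only one. So it is enough to move
  the image of each root of \<open>p\<close> to the root of \<open>q\<close> in the same cell;
  elsewhere the signs follow from the ends and the side of the root.\<close>

lemma poly_match_extend:
  assumes m: "poly_match p q h Z"
  shows "\<exists>k. order_iso k \<and> (\<forall>x. k x = h x \<or> \<not> apart (h ` Z) (h x) (k x)) \<and>
    (\<forall>x. sgn (poly p x) = sgn (poly q (k x)))"
proof -
  have fin: "finite Z" and h: "order_iso h" and pd: "\<And>x. x \<notin> Z \<Longrightarrow> poly (pderiv p) x \<noteq> 0"
    and sd: "\<And>x. sgn (poly (pderiv p) x) = sgn (poly (pderiv q) (h x))"
    and sz: "\<And>x. x \<in> Z \<Longrightarrow> sgn (poly p x) = sgn (poly q (h x))"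
    using m by (auto simp: poly_match_def)
  obtain g where g: "order_iso g" "\<And>y. h (g y) = y" "\<And>x. g (h x) = x" "poly_match q p g (h ` Z)"
    using poly_match_inv[OF m] by metis
  let ?W = "h ` Z"
  have qd: "\<And>y. y \<notin> ?W \<Longrightarrow> poly (pderiv q) y \<noteq> 0"
    using g(4) by (auto simp: poly_match_def)
  have gW: "g ` ?W = Z" using g by (auto simp: image_image)
  have hW: "h x \<in> ?W \<longleftrightarrow> x \<in> Z" for x using order_iso_eq[OF h] by auto
  note ends = poly_match_ends[OF m]
  have step: "\<exists>k. order_iso k \<and> (\<forall>x. k x = h x \<or> \<not> apart ?W (h x) (k x)) \<and> (\<forall>x\<in>S. poly q (k x) = 0)"
    if "finite S" "\<forall>x\<in>S. poly p x = 0 \<and> x \<notin> Z" for S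
    using that
  proof (induction S rule: finite_induct)
    case empty
    then show ?case using h by auto
  next
    case (insert x S)
    then obtain k where k: "order_iso k" "\<And>x. k x = h x \<or> \<not> apart ?W (h x) (k x)" "\<And>x. x \<in> S \<Longrightarrow> poly q (k x) = 0"
      by auto
    have same: "\<not> apart ?W (h x) (k x)" if "x \<notin> Z" for x
      using k(2)[of x] hW[of x] that by (cases "k x = h x") (auto simp: apart_def)
    have xZ: "x \<notin> Z" "poly p x = 0" using insert by auto
    then obtain y where y: "poly q y = 0" "\<not> apart ?W (h x) y"
      using exists_root_in_cell[of ?W q "h x", OF qd] ends sgn_from_cell(4)[of Z p x, OF pd _ fin] hW by blast
    have kxy: "\<not> apart ?W (k x) y"
      using same[OF xZ(1)] y(2) apart_commute not_apart_trans by blast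
    \<comment> \<open>The next displacement must not disturb the roots already matched. One of them
      between \<open>k x\<close> and \<open>y\<close> would put two roots of \<open>p\<close> into a
      single cell.\<close>
    have "\<not> apart (?W \<union> k ` S) (k x) y"
    proof
      assume "apart (?W \<union> k ` S) (k x) y"
      then obtain w where w: "w \<in> S" "k w \<in> closed_segment (k x) y"
        using kxy by (auto simp: apart_def)
      then have "closed_segment (k w) y \<subseteq> closed_segment (k x) y"
        by (meson convex_closed_segment convex_contains_segment ends_in_segment(2))
      then have kwy: "\<not> apart ?W (k w) y" using kxy by (auto simp: apart_def)
      have wZ: "w \<notin> Z" "poly p w = 0" using w insert by auto
      have "\<not> apart ?W (h w) (h x)"
        using same[OF wZ(1)] kwy y(2) not_apart_trans apart_commute by metis
      then have "\<not> apart Z w x" using order_iso_apart[OF h] by blast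
      then have "w = x" using root_in_cell_unique[of Z p, OF pd] wZ xZ by blast
      then show False using w insert by blast
    qed
    then obtain \<psi> where \<psi>: "order_iso \<psi>" "\<psi> (k x) = y" "\<And>z. \<psi> z = z \<or> \<not> apart (?W \<union> k ` S) z (\<psi> z)"
      using exists_bump[of "?W \<union> k ` S"] fin insert by auto
    show ?case
    proof (intro exI[of _ "\<lambda>x. \<psi> (k x)"] conjI allI ballI)
      show "order_iso (\<lambda>x. \<psi> (k x))" using order_iso_comp \<psi> k by blast
      fix z
      have "\<psi> (k z) = k z \<or> \<not> apart ?W (k z) (\<psi> (k z))" using \<psi>(3)[of "k z"] by (auto simp: apart_def)
      then show "\<psi> (k z) = h z \<or> \<not> apart ?W (h z) (\<psi> (k z))"
        using k(2)[of z] not_apart_trans by metis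
    next
      fix z assume "z \<in> insert x S"
      then show "poly q (\<psi> (k z)) = 0"
      proof
        assume "z \<in> S"
        then have "\<psi> (k z) = k z" using \<psi>(3)[of "k z"] by (auto simp: apart_def)
        then show ?thesis using k \<open>z \<in> S\<close> by simp
      qed (use \<psi> y in simp)
    qed
  qed
  have "p \<noteq> 0"
  proof
    assume "p = 0"
    then have "UNIV \<subseteq> Z" using pd by auto
    then show False using fin infinite_UNIV_char_0 finite_subset by blast
  qed
  then have "finite {x. poly p x = 0 \<and> x \<notin> Z}" using poly_roots_finite[of p] by (auto elim: rev_finite_subset)
  then obtain k where k: "order_iso k" "\<And>x. k x = h x \<or> \<not> apart ?W (h x) (k x)"
      "\<And>x. poly p x = 0 \<Longrightarrow> x \<notin> Z \<Longrightarrow> poly q (k x) = 0"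
    using step[of "{x. poly p x = 0 \<and> x \<notin> Z}"] by blast
  have kZ: "k z = h z" if "z \<in> Z" for z using k(2)[of z] that by (auto simp: apart_def)
  then have kW: "k ` Z = ?W" by auto
  have dk: "sgn (poly (pderiv p) x) = sgn (poly (pderiv q) (k x))" for x
  proof (cases "k x = h x")
    case False
    then have "\<not> apart ?W (h x) (k x)" using k(2)[of x] by blast
    from poly_sgn_not_apart[of ?W "pderiv q", OF qd this] show ?thesis using sd by simp
  qed (use sd in simp)
  then have mk: "poly_match p q k Z"
    using fin k(1) pd sz kZ by (simp add: poly_match_def)
  have "sgn (poly p x) = sgn (poly q (k x))" for x
  proof (cases "x \<in> Z")
    case True
    then have "k x = h x" using k(2)[of x] by (auto simp: apart_def)
    then show ?thesis using True sz by simp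
  next
    case x: False
    have "h x \<notin> ?W" using hW x by blast
    then have same: "\<not> apart ?W (h x) (k x)" using k(2)[of x] by (cases "k x = h x") (auto simp: apart_def)
    have kx: "k x \<notin> ?W" using not_apart_memD same by blast
    have finW: "finite ?W" using fin by simp
    show ?thesis
    proof (cases "neg_left Z p x \<and> pos_right Z p x")
      case True
      obtain y where y: "poly p y = 0" "\<not> apart Z x y"
        using exists_root_in_cell[of Z p, OF pd x] True by blast
      have "y \<notin> Z" using y(2) by (auto simp: apart_def)
      have "\<not> apart ?W (k x) (k y)" using order_iso_apart[OF k(1)] y(2) kW by metis
      then have "sgn (poly q (k x)) = sgn (k x - k y) * sgn (poly (pderiv q) (k x))"
        using sgn_from_cell(3)[of ?W q, OF qd kx finW] k(3)[OF y(1) \<open>y \<notin> Z\<close>] by blast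
      moreover have "sgn (k x - k y) = sgn (x - y)"
        using order_iso_less[OF k(1)] order_iso_eq[OF k(1)] by (auto simp: sgn_if)
      ultimately show ?thesis using sgn_from_cell(3)[of Z p x y, OF pd x fin y] dk[of x] by metis
    next
      case False
      show ?thesis using False sgn_from_cell(1,2)[of Z p x, OF pd x fin] 
          sgn_from_cell(1,2)[of ?W q "k x", OF qd kx finW] dk poly_match_ends[OF mk x] kW by auto
    qed
  qed
  then show ?thesis using k by blast
qed

section \<open>The Tarski--Seidenberg theorem\<close>

inductive pfun :: "(('v \<Rightarrow> real) \<Rightarrow> real) \<Rightarrow> bool" where
  pfun_const: "pfun (\<lambda>e. c)"
| pfun_var: "pfun (\<lambda>e. e i)"
| pfun_add: "pfun p \<Longrightarrow> pfun q \<Longrightarrow> pfun (\<lambda>e. p e + q e)"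
| pfun_mult: "pfun p \<Longrightarrow> pfun q \<Longrightarrow> pfun (\<lambda>e. p e * q e)"

lemma pfun_minus: "pfun p \<Longrightarrow> pfun (\<lambda>e. - p e)"
  using pfun_mult[OF pfun_const[of "-1"]] by simp

lemma pfun_diff: "pfun p \<Longrightarrow> pfun q \<Longrightarrow> pfun (\<lambda>e. p e - q e)"
  using pfun_add[OF _ pfun_minus] by simp

lemma pfun_power: "pfun p \<Longrightarrow> pfun (\<lambda>e. p e ^ n)"
  by (induction n) (auto intro: pfun_const pfun_mult)

lemma pfun_sum: "(\<And>i. i \<in> I \<Longrightarrow> pfun (p i)) \<Longrightarrow> pfun (\<lambda>e. \<Sum>i\<in>I. p i e)"
  by (induction I rule: infinite_finite_induct) (auto intro: pfun_const pfun_add)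

lemma pfun_prod: "(\<And>i. i \<in> I \<Longrightarrow> pfun (p i)) \<Longrightarrow> pfun (\<lambda>e. \<Prod>i\<in>I. p i e)"
  by (induction I rule: infinite_finite_induct) (auto intro: pfun_const pfun_mult)

lemmas pfun_intros = pfun_const pfun_var pfun_add pfun_mult pfun_minus pfun_diff pfun_power pfun_sum pfun_prod

lemma pfun_subst:
  assumes "pfun p" "\<And>i. pfun (\<lambda>e. \<sigma> e i)" shows "pfun (\<lambda>e. p (\<sigma> e))"
  using assms by (induction rule: pfun.induct) (auto intro: pfun_intros)

text \<open>Semantic quantifier-free formulas: predicates on assignments of reals to the variables.
  Strict positivity suffices as an atom, equality being a conjunction of two negated strict
  inequalities.\<close>

inductive sa :: "(('v \<Rightarrow> real) \<Rightarrow> bool) \<Rightarrow> bool" where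
  sa_pos: "pfun p \<Longrightarrow> sa (\<lambda>e. 0 < p e)"
| sa_not: "sa P \<Longrightarrow> sa (\<lambda>e. \<not> P e)"
| sa_disj: "sa P \<Longrightarrow> sa Q \<Longrightarrow> sa (\<lambda>e. P e \<or> Q e)"

lemma sa_conj: "sa P \<Longrightarrow> sa Q \<Longrightarrow> sa (\<lambda>e. P e \<and> Q e)"
  using sa_not[OF sa_disj[OF sa_not sa_not], of P Q] by simp

lemma sa_imp: "sa P \<Longrightarrow> sa Q \<Longrightarrow> sa (\<lambda>e. P e \<longrightarrow> Q e)"
  unfolding imp_conv_disj by (intro sa_disj sa_not)

lemma sa_less: "pfun p \<Longrightarrow> pfun q \<Longrightarrow> sa (\<lambda>e. p e < q e)"
  using sa_pos[OF pfun_diff, of q p] by simp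

lemma sa_le: "pfun p \<Longrightarrow> pfun q \<Longrightarrow> sa (\<lambda>e. p e \<le> q e)"
  using sa_not[OF sa_less, of q p] by (simp add: not_less)

lemma sa_eq: "pfun p \<Longrightarrow> pfun q \<Longrightarrow> sa (\<lambda>e. p e = q e)"
  using sa_conj[OF sa_le sa_le, of p q q p] by (simp add: order_eq_iff)

lemma sa_const: "sa (\<lambda>e. b)"
  using sa_less[OF pfun_const pfun_const, of 0 1] sa_less[OF pfun_const pfun_const, of 1 0] by (cases b) simp_all

lemma sa_ball: "finite I \<Longrightarrow> (\<And>i. i \<in> I \<Longrightarrow> sa (P i)) \<Longrightarrow> sa (\<lambda>e. \<forall>i\<in>I. P i e)"
  by (induction I rule: finite_induct) (auto intro: sa_const sa_conj)

lemma sa_subst: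
  assumes "sa P" "\<And>i. pfun (\<lambda>e. \<sigma> e i)" shows "sa (\<lambda>e. P (\<sigma> e))"
  using assms
proof (induction rule: sa.induct)
  case (sa_pos p)
  then show ?case using sa.sa_pos[OF pfun_subst] by blast
next
  case (sa_not P)
  then show ?case using sa.sa_not by blast
next
  case (sa_disj P Q)
  then show ?case using sa.sa_disj by blast
qed

definition same_sgns :: "('e \<Rightarrow> real) set \<Rightarrow> 'e \<Rightarrow> 'e \<Rightarrow> bool" where
  "same_sgns F e e' \<longleftrightarrow> (\<forall>a\<in>F. sgn (a e) = sgn (a e'))"

text \<open>One polynomial \<open>a\<close> is removed at a time by a case distinction on its sign.
  \<open>R s\<close> is a saturation: it asks for some assignment that satisfies \<open>P\<close>,
  gives \<open>a\<close> the sign \<open>s\<close> and agrees in the signs of \<open>F\<close>. It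
  therefore depends on the signs of \<open>F\<close> only.\<close>

lemma sa_if_same_sgns:
  assumes "finite F" "\<And>a. a \<in> F \<Longrightarrow> pfun a" "\<And>e e'. same_sgns F e e' \<Longrightarrow> P e \<longleftrightarrow> P e'"
  shows "sa P"
  using assms
proof (induction F arbitrary: P rule: finite_induct)
  case empty
  then have "P = (\<lambda>e. P undefined)" by (auto simp: same_sgns_def)
  then show ?case using sa_const by metis
next
  case (insert a F)
  define R where "R s e \<longleftrightarrow> (\<exists>e'. sgn (a e') = s \<and> same_sgns F e e' \<and> P e')" for s :: real and e
  have R: "sa (R s)" for s
  proof (rule insert.IH)
    show "R s e = R s e'" if "same_sgns F e e'" for e e'
      using that by (auto simp: R_def same_sgns_def)
  qed (use insert in auto)
  have RP: "R (sgn (a e)) e \<longleftrightarrow> P e" for e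
  proof
    assume "R (sgn (a e)) e"
    then obtain e' where "sgn (a e') = sgn (a e)" "same_sgns F e e'" "P e'" unfolding R_def by blast
    moreover from this have "same_sgns (insert a F) e e'" by (simp add: same_sgns_def)
    ultimately show "P e" using insert.prems(2) by blast
  qed (auto simp: R_def same_sgns_def)
  have a: "pfun a" using insert by auto
  have "sa (\<lambda>e. (0 < a e \<and> R 1 e) \<or> (a e = 0 \<and> R 0 e) \<or> (a e < 0 \<and> R (-1) e))"
    by (intro sa_disj sa_conj R sa_less sa_eq a pfun_const)
  moreover have "(0 < a e \<and> R 1 e) \<or> (a e = 0 \<and> R 0 e) \<or> (a e < 0 \<and> R (-1) e) \<longleftrightarrow> P e" for e
    using RP[of e] by (cases "a e" "0 :: real" rule: linorder_cases) auto
  ultimately show ?case by simp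
qed

text \<open>A polynomial in one distinguished variable whose coefficients are polynomial in the
  parameters. The number \<open>d\<close> is only a bound: leading coefficients may vanish for
  particular parameters, and the elimination is organised around this.\<close>

definition ppoly :: "nat \<Rightarrow> (('v \<Rightarrow> real) \<Rightarrow> real poly) \<Rightarrow> bool" where
  "ppoly d P \<longleftrightarrow> (\<forall>e. degree (P e) \<le> d) \<and> (\<forall>k. pfun (\<lambda>e. coeff (P e) k))"

lemma ppoly_mono: "ppoly d P \<Longrightarrow> d \<le> d' \<Longrightarrow> ppoly d' P"
  by (auto simp: ppoly_def intro: order_trans)

lemma pfun_if_const: "pfun p \<Longrightarrow> pfun q \<Longrightarrow> pfun (\<lambda>e. if b then p e else q e)"
  by (cases b) auto

lemma ppoly_cutoff:
  assumes "ppoly d P" shows "ppoly j (\<lambda>e. poly_cutoff (Suc j) (P e))"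
  using assms by (auto simp: ppoly_def coeff_poly_cutoff intro!: degree_le pfun_if_const pfun_const)

lemma ppoly_pderiv:
  assumes "ppoly d P" shows "ppoly (d - 1) (\<lambda>e. pderiv (P e))"
  using assms by (auto simp: ppoly_def coeff_pderiv degree_pderiv diff_le_mono intro!: pfun_intros)

lemma ppoly_const: "ppoly 0 (\<lambda>e. [:c:])"
  by (auto simp: ppoly_def coeff_pCons split: nat.splits intro: pfun_const)

lemma pfun_coeff_const: "pfun p \<Longrightarrow> pfun (\<lambda>e. coeff [:p e:] k)"
  by (cases k) (auto intro: pfun_const)

lemma pfun_as_ppoly:
  assumes "pfun p" shows "\<exists>d P. ppoly d P \<and> (\<forall>e x. p (e(i := x)) = poly (P e) x)"
  using assms
proof (induction rule: pfun.induct)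
  case (pfun_const c)
  then show ?case by (intro exI[of _ 0] exI[of _ "\<lambda>e. [:c:]"]) (simp add: ppoly_const)
next
  case (pfun_var j)
  show ?case
  proof (cases "j = i")
    case True
    then show ?thesis by (intro exI[of _ 1] exI[of _ "\<lambda>e. [:0, 1:]"])
       (auto simp: ppoly_def coeff_pCons split: nat.splits intro: pfun_const)
  next
    case False
    then show ?thesis by (intro exI[of _ 0] exI[of _ "\<lambda>e. [:e j:]"])
       (auto simp: ppoly_def intro!: pfun_coeff_const pfun.pfun_var)
  qed
next
  case (pfun_add p q)
  then obtain d P d' P' where "ppoly d P" "\<forall>e x. p (e(i := x)) = poly (P e) x"
    "ppoly d' P'" "\<forall>e x. q (e(i := x)) = poly (P' e) x" by blast
  moreover have "ppoly (max d d') (\<lambda>e. P e + P' e)"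
    unfolding ppoly_def coeff_add
  proof (intro conjI allI)
    show "degree (P e + P' e) \<le> max d d'" for e
      using calculation by (intro degree_add_le) (auto simp: ppoly_def le_max_iff_disj)
    show "pfun (\<lambda>e. coeff (P e) k + coeff (P' e) k)" for k
      by (rule pfun.pfun_add) (use calculation in \<open>auto simp: ppoly_def\<close>)
  qed
  ultimately show ?case
    by (intro exI[of _ "max d d'"] exI[of _ "\<lambda>e. P e + P' e"]) (simp del: fun_upd_apply)
next
  case (pfun_mult p q)
  then obtain d P d' P' where *: "ppoly d P" "\<forall>e x. p (e(i := x)) = poly (P e) x"
    "ppoly d' P'" "\<forall>e x. q (e(i := x)) = poly (P' e) x" by blast
  have "degree (P e * P' e) \<le> d + d'" for e
    using * by (intro order_trans[OF degree_mult_le] add_mono) (auto simp: ppoly_def)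
  then have "ppoly (d + d') (\<lambda>e. P e * P' e)"
    unfolding ppoly_def coeff_mult
  proof (intro conjI allI)
    show "pfun (\<lambda>e. \<Sum>i\<le>k. coeff (P e) i * coeff (P' e) (k - i))" for k
      by (intro pfun_sum pfun.pfun_mult) (use * in \<open>auto simp: ppoly_def\<close>)
  qed
  then show ?case using *
    by (intro exI[of _ "d + d'"] exI[of _ "\<lambda>e. P e * P' e"]) (simp del: fun_upd_apply)
qed

text \<open>Pseudo-division by the truncation of \<open>R\<close> at degree \<open>j\<close>. For
  parameters where the degree is exactly \<open>j\<close> the truncation is \<open>R\<close> itself,
  and each division step preserves the sign of \<open>P\<close> at the roots of
  \<open>R\<close>.\<close>

lemma ppoly_remainder:
  assumes "ppoly d P" "ppoly m R" "j \<ge> 1"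
  shows "\<exists>Q. ppoly (j - 1) Q \<and> (\<forall>e x. degree (R e) = j \<longrightarrow> poly (R e) x = 0 \<longrightarrow>
           sgn (poly (Q e) x) = sgn (poly (P e) x))"
  using assms(1)
proof (induction d arbitrary: P rule: less_induct)
  case (less d P)
  show ?case
  proof (cases "d < j")
    case True
    then have "ppoly (j - 1) P" using less.prems by (auto intro: ppoly_mono)
    then show ?thesis by blast
  next
    case False
    define S where "S e = poly_cutoff (Suc j) (R e)" for e
    have S: "ppoly j S" unfolding S_def by (rule ppoly_cutoff[OF assms(2)])
    define c where "c e = coeff (R e) j" for e
    \<comment> \<open>The square of the leading coefficient \<open>c e\<close> avoids denominators
      without affecting signs.\<close>
    define P1 where "P1 e = smult (c e * c e) (P e) - smult (c e * coeff (P e) d) (monom 1 (d - j) * S e)" for e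
    have Pd: "coeff (P e) k = 0" if "k > d" for e k
      using that less.prems by (auto simp: ppoly_def intro!: coeff_eq_0 le_less_trans[of _ d])
    have cP1: "coeff (P1 e) k = c e * c e * coeff (P e) k - c e * coeff (P e) d * (if k < d - j then 0 else coeff (S e) (k - (d - j)))" for e k
      by (simp add: P1_def coeff_monom_mult)
    have "coeff (P1 e) k = 0" if "k > d - 1" for k e
    proof (cases "k = d")
      case True
      then show ?thesis using False by (simp add: cP1 S_def coeff_poly_cutoff c_def)
    next
      case False
      then have "k > d" using that by simp
      then show ?thesis using \<open>\<not> d < j\<close> by (simp add: cP1 Pd S_def coeff_poly_cutoff)
    qed
    moreover have "pfun (\<lambda>e. coeff (P1 e) k)" for k
      unfolding cP1 c_def using less.prems S assms(2)
      by (auto simp: ppoly_def intro!: pfun_intros pfun_if_const)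
    ultimately have "ppoly (d - 1) P1" by (auto simp: ppoly_def intro!: degree_le)
    moreover have "d - 1 < d" using False assms(3) by auto
    ultimately obtain Q where Q: "ppoly (j - 1) Q" "\<And>e x. degree (R e) = j \<Longrightarrow> poly (R e) x = 0 \<Longrightarrow>
           sgn (poly (Q e) x) = sgn (poly (P1 e) x)" using less.IH by blast
    have "sgn (poly (P1 e) x) = sgn (poly (P e) x)" if "degree (R e) = j" "poly (R e) x = 0" for e x
    proof -
      have "S e = R e" using that by (auto simp: S_def poly_eq_iff coeff_poly_cutoff coeff_eq_0)
      then have "poly (P1 e) x = c e * c e * poly (P e) x" using that by (simp add: P1_def)
      moreover have "c e \<noteq> 0" using that assms(3) by (auto simp: c_def)
      ultimately show ?thesis by (simp add: sgn_mult)
    qed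
    then show ?thesis using Q by auto
  qed
qed


text \<open>The induction of Cohen and Hoermander: a polynomial of maximal degree is replaced by its derivative and
  its remainders modulo the other polynomials. Since leading coefficients may vanish, the remainders
  are taken modulo all truncations.\<close>

lemma ppoly_family_determined:
  fixes L :: "(nat \<times> (('v \<Rightarrow> real) \<Rightarrow> real poly)) list"
  assumes "\<forall>(d, P)\<in>set L. ppoly d P"
  shows "\<exists>F. finite F \<and> (\<forall>a\<in>F. pfun a) \<and> (\<forall>e e'. same_sgns F e e' \<longrightarrow>
           (\<exists>h. order_iso h \<and> (\<forall>(d, P)\<in>set L. \<forall>x. sgn (poly (P e) x) = sgn (poly (P e') (h x)))))"
  using assms
\<comment> \<open>The multiset order on formal degrees admits replacing one degree by any number of
  smaller ones, as the remainders require.\<close>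
proof (induction L rule: wf_induct_rule[OF wf_inv_image[OF wf_mult[OF wf_less_than], of "\<lambda>L. mset (map fst L)"], case_names less])
  case (less L)
  show ?case
  proof (cases "\<exists>(d, P)\<in>set L. d > 0")
    case False
    define F where "F = (\<lambda>(d, P). \<lambda>e. coeff (P e) 0) ` set L"
    have "\<forall>e e'. same_sgns F e e' \<longrightarrow>
      (\<exists>h. order_iso h \<and> (\<forall>(d, P)\<in>set L. \<forall>x. sgn (poly (P e) x) = sgn (poly (P e') (h x))))"
    proof (intro allI impI exI[of _ "\<lambda>x. x"] conjI order_iso_id, clarify)
      fix e e' d P x assume s: "same_sgns F e e'" and "(d, P) \<in> set L"
      then have "d = 0" "ppoly d P" using False less.prems by auto
      then have "degree (P e) = 0" for e by (auto simp: ppoly_def)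
      then have "poly (P e) x = coeff (P e) 0" for e x by (simp add: poly_altdef)
      moreover have "sgn (coeff (P e) 0) = sgn (coeff (P e') 0)"
        using s \<open>(d, P) \<in> set L\<close> by (auto simp: same_sgns_def F_def)
      ultimately show "sgn (poly (P e) x) = sgn (poly (P e') x)" by simp
    qed
    moreover have "finite F" "\<forall>a\<in>F. pfun a" using less.prems by (auto simp: F_def ppoly_def)
    ultimately show ?thesis by blast
  next
    case True
    define d where "d = Max (fst ` set L)"
    have "set L \<noteq> {}" using True by auto
    then have "d \<in> fst ` set L" unfolding d_def by (intro Max_in) auto
    then obtain P where P: "(d, P) \<in> set L" by auto
    have dmax: "d' \<le> d" if "(d', R) \<in> set L" for d' R using that unfolding d_def by (force intro: Max_ge)
    have "d > 0" using True dmax by force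
    have pP: "ppoly d P" using P less.prems by auto
    define L0 where "L0 = remove1 (d, P) L"
    have ms: "mset L = add_mset (d, P) (mset L0)" using P by (simp add: L0_def)
    then have setL: "set L = insert (d, P) (set L0)"
      by (metis set_mset_add_mset_insert set_mset_mset)
    have L0: "\<forall>(d, P)\<in>set L0. ppoly d P" using less.prems setL by auto
    have msL: "mset (map fst L) = mset (map fst L0) + {#d#}"
      using ms by simp
    \<comment> \<open>\<open>L1\<close> serves the parameters at which the coefficient of index
      \<open>d\<close> of \<open>P\<close> vanishes; there \<open>P\<close> agrees with its
      truncation.\<close>
    define L1 where "L1 = L0 @ [(d - 1, \<lambda>e. poly_cutoff d (P e))]"
    define R where "R = L0 @ [(d - 1, \<lambda>e. pderiv (P e))]"
    have R: "\<forall>(d, P)\<in>set R. ppoly d P" using L0 ppoly_pderiv[OF pP] by (auto simp: R_def)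
    define Q where "Q r j = (SOME Q. ppoly (j - 1) Q \<and> (\<forall>e x. degree (snd r e) = j \<longrightarrow> poly (snd r e) x = 0 \<longrightarrow>
           sgn (poly (Q e) x) = sgn (poly (P e) x)))" for r :: "nat \<times> (('v \<Rightarrow> real) \<Rightarrow> real poly)" and j
    have Q: "ppoly (j - 1) (Q r j)" "degree (snd r e) = j \<Longrightarrow> poly (snd r e) x = 0 \<Longrightarrow>
           sgn (poly (Q r j e) x) = sgn (poly (P e) x)" if "r \<in> set R" "j \<ge> 1" for r j e x
    proof -
      have "ppoly (fst r) (snd r)" using R that by auto
      from someI_ex[OF ppoly_remainder[OF pP this that(2)]]
      show "ppoly (j - 1) (Q r j)" "degree (snd r e) = j \<Longrightarrow> poly (snd r e) x = 0 \<Longrightarrow>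
           sgn (poly (Q r j e) x) = sgn (poly (P e) x)" unfolding Q_def by blast+
    qed
    define K where "K = concat (map (\<lambda>r. map (\<lambda>j. (j - 1, Q r j)) [1..<Suc (fst r)]) R)"
    define L2 where "L2 = R @ K"
    have K: "(j - 1, Q r j) \<in> set K" if "r \<in> set R" "j \<ge> 1" "j \<le> fst r" for r j
    proof -
      have "(j - 1, Q r j) \<in> (\<lambda>j. (j - 1, Q r j)) ` set [1..<Suc (fst r)]" using that by (intro imageI) auto
      then show ?thesis using that(1) by (auto simp: K_def simp del: upt_Suc)
    qed
    have Kd: "d' < d \<and> ppoly d' P'" if K: "(d', P') \<in> set K" for d' P'
    proof -
      obtain r j where r: "r \<in> set R" "1 \<le> j" "j \<le> fst r" "d' = j - 1" "P' = Q r j"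
        using K by (auto simp: K_def)
      have "fst r \<le> d" using r(1) dmax[of "fst r" "snd r"] setL by (auto simp: R_def)
      then show ?thesis using r Q(1) by auto
    qed
    have lt1: "(mset (map fst L1), mset (map fst L)) \<in> Multiset.mult less_than"
      unfolding msL L1_def map_append mset_append
      by (rule one_step_implies_mult) (use \<open>d > 0\<close> in auto)
    have "(mset (map fst L0) + mset ((d - 1) # map fst K), mset (map fst L0) + {#d#}) \<in> Multiset.mult less_than"
    proof (rule one_step_implies_mult)
      show "\<forall>k\<in>#mset ((d - 1) # map fst K). \<exists>j\<in>#{#d#}. (k, j) \<in> less_than"
        using Kd \<open>d > 0\<close> by auto
    qed simp
    moreover have "mset (map fst L2) = mset (map fst L0) + mset ((d - 1) # map fst K)"
      by (simp add: L2_def R_def)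
    ultimately have lt2: "(mset (map fst L2), mset (map fst L)) \<in> Multiset.mult less_than"
      unfolding msL by metis
    have "ppoly (d - 1) (\<lambda>e. poly_cutoff d (P e))" using ppoly_cutoff[OF pP, of "d - 1"] \<open>d > 0\<close> by simp
    then have "\<forall>(d, P)\<in>set L1. ppoly d P" using L0 by (auto simp: L1_def)
    then obtain F1 where F1: "finite F1" "\<forall>a\<in>F1. pfun a"
      "\<forall>e e'. same_sgns F1 e e' \<longrightarrow>
           (\<exists>h. order_iso h \<and> (\<forall>(d, P)\<in>set L1. \<forall>x. sgn (poly (P e) x) = sgn (poly (P e') (h x))))"
      using less.IH[of L1] lt1 unfolding in_inv_image by blast
    have "\<forall>(d, P)\<in>set L2. ppoly d P" using R Kd by (auto simp: L2_def)
    then obtain F2 where F2: "finite F2" "\<forall>a\<in>F2. pfun a"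
      "\<forall>e e'. same_sgns F2 e e' \<longrightarrow>
           (\<exists>h. order_iso h \<and> (\<forall>(d, P)\<in>set L2. \<forall>x. sgn (poly (P e) x) = sgn (poly (P e') (h x))))"
      using less.IH[of L2] lt2 unfolding in_inv_image by blast
    \<comment> \<open>The signs of all coefficients fix which of them vanish, hence the true degrees
      of the polynomials at \<open>e\<close> and \<open>e'\<close>. So the same remainders
      \<open>Q r j\<close> apply on both sides.\<close>
    define C where "C = (\<lambda>(r, k). \<lambda>e. coeff (snd r e) k) ` (insert (d, P) (set R) \<times> {..d})"
    have C: "finite C" "\<forall>a\<in>C. pfun a" using R pP by (auto simp: C_def ppoly_def)
    show ?thesis
    proof (intro exI[of _ "F1 \<union> F2 \<union> C"] conjI allI impI)
      show "finite (F1 \<union> F2 \<union> C)" "\<forall>a\<in>F1 \<union> F2 \<union> C. pfun a" using F1 F2 C by auto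
      fix e e' assume "same_sgns (F1 \<union> F2 \<union> C) e e'"
      then have s1: "same_sgns F1 e e'" and s2: "same_sgns F2 e e'" and sC: "same_sgns C e e'"
        by (auto simp: same_sgns_def)
      have co: "coeff (snd r e) k = 0 \<longleftrightarrow> coeff (snd r e') k = 0" if "r \<in> insert (d, P) (set R)" for r k
      proof (cases "k \<le> d")
        case True
        then have "sgn (coeff (snd r e) k) = sgn (coeff (snd r e') k)"
          using sC that unfolding same_sgns_def C_def by force
        then show ?thesis by (metis sgn_zero_iff)
      next
        case False
        have "ppoly (fst r) (snd r)" using R pP that by auto
        moreover have "fst r \<le> d" using that dmax[of "fst r" "snd r"] setL by (auto simp: R_def)
        ultimately show ?thesis using False by (metis coeff_eq_0 le_trans not_le ppoly_def)
      qed
      show "\<exists>h. order_iso h \<and> (\<forall>(d, P)\<in>set L. \<forall>x. sgn (poly (P e) x) = sgn (poly (P e') (h x)))"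
      proof (cases "coeff (P e) d = 0")
        case True
        then have "coeff (P e') d = 0" using co[of "(d, P)" d] by simp
        have cut: "poly_cutoff d (P e) = P e" if "coeff (P e) d = 0" for e
        proof (rule poly_eqI)
          fix k
          have "coeff (P e) k = 0" if "k > d" using that pP by (metis coeff_eq_0 le_less_trans ppoly_def)
          then show "coeff (poly_cutoff d (P e)) k = coeff (P e) k"
            using \<open>coeff (P e) d = 0\<close> by (auto simp: coeff_poly_cutoff not_less order_le_less)
        qed
        obtain h where h: "order_iso h" "\<forall>(d, P)\<in>set L1. \<forall>x. sgn (poly (P e) x) = sgn (poly (P e') (h x))"
          using F1(3) s1 by blast
        then have "\<forall>x. sgn (poly (P e) x) = sgn (poly (P e') (h x))"
          using cut[OF True] cut[OF \<open>coeff (P e') d = 0\<close>] by (auto simp: L1_def)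
        then show ?thesis using h setL by (intro exI[of _ h]) (auto simp: L1_def)
      next
        case False
        then have Pd': "coeff (P e') d \<noteq> 0" using co[of "(d, P)" d] by simp
        obtain h where h: "order_iso h" "\<And>d P x. (d, P) \<in> set L2 \<Longrightarrow> sgn (poly (P e) x) = sgn (poly (P e') (h x))"
          using F2(3) s2 by blast
        \<comment> \<open>Roots of the polynomials that do not vanish identically at
          \<open>e\<close>. The derivative is among them, so the critical points of
          \<open>P e\<close> are included, and at every point of \<open>Z\<close> some remainder
          tells the sign of \<open>P e\<close>.\<close>
        define Z where "Z = {x. \<exists>r\<in>set R. snd r e \<noteq> 0 \<and> poly (snd r e) x = 0}"
        have degP: "degree (P e) = d" using pP False by (metis le_antisym le_degree ppoly_def)
        have dP0: "pderiv (P e) \<noteq> 0" using degP \<open>d > 0\<close> by (simp add: pderiv_eq_0_iff)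
        have dR: "(d - 1, \<lambda>e. pderiv (P e)) \<in> set R" by (simp add: R_def)
        have m: "poly_match (P e) (P e') h Z"
          unfolding poly_match_def
        proof (intro conjI allI impI ballI h(1))
          have "Z = (\<Union>r\<in>{r\<in>set R. snd r e \<noteq> 0}. {x. poly (snd r e) x = 0})" by (auto simp: Z_def)
          then show "finite Z" by (auto simp: poly_roots_finite)
          show "poly (pderiv (P e)) x \<noteq> 0" if "x \<notin> Z" for x
            using that dP0 dR by (force simp: Z_def)
          show "sgn (poly (pderiv (P e)) x) = sgn (poly (pderiv (P e')) (h x))" for x
            using h(2)[of "d - 1" "\<lambda>e. pderiv (P e)"] dR by (simp add: L2_def)
          fix x assume "x \<in> Z"
          then obtain r where r: "r \<in> set R" "snd r e \<noteq> 0" "poly (snd r e) x = 0" by (auto simp: Z_def)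
          define j where "j = degree (snd r e)"
          have j1: "j \<ge> 1" using r(2,3) unfolding j_def
            by (cases "degree (snd r e) = 0") (auto elim!: degree_eq_zeroE)
          have jr: "j \<le> fst r" using R r(1) by (auto simp: j_def ppoly_def)
          have j': "degree (snd r e') = j"
            unfolding j_def using co[of r] r(1)
            by (metis insertI2 le_antisym le_degree leading_coeff_0_iff degree_0 zero_le)
          have "sgn (poly (snd r e) x) = sgn (poly (snd r e') (h x))"
            using h(2)[of "fst r" "snd r"] r(1) by (simp add: L2_def)
          then have r': "poly (snd r e') (h x) = 0" using r(3) by (metis sgn_zero_iff)
          have "sgn (poly (P e) x) = sgn (poly (Q r j e) x)"
            using Q(2)[OF r(1) j1, of e x] r(3) j_def by simp
          also have "\<dots> = sgn (poly (Q r j e') (h x))"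
            using h(2)[of "j - 1" "Q r j"] K[OF r(1) j1 jr] by (simp add: L2_def)
          also have "\<dots> = sgn (poly (P e') (h x))"
            using Q(2)[OF r(1) j1, of e' "h x"] r' j' by simp
          finally show "sgn (poly (P e) x) = sgn (poly (P e') (h x))" .
        qed
        obtain k where k: "order_iso k" "\<And>x. k x = h x \<or> \<not> apart (h ` Z) (h x) (k x)"
          "\<And>x. sgn (poly (P e) x) = sgn (poly (P e') (k x))"
          using poly_match_extend[OF m] by blast
        \<comment> \<open>The correction from \<open>h\<close> to \<open>k\<close> moves points only
          inside cells, where no polynomial of \<open>R\<close> changes its sign.\<close>
        have "sgn (poly (snd r e) x) = sgn (poly (snd r e') (k x))" if "r \<in> set L0" for r x
        proof -
          have rR: "r \<in> set R" using that by (simp add: R_def)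
          have hr: "sgn (poly (snd r e) x) = sgn (poly (snd r e') (h x))" for x
            using h(2)[of "fst r" "snd r"] rR by (simp add: L2_def)
          show ?thesis
          proof (cases "snd r e = 0")
            case True
            have "poly (snd r e') y = 0" for y
            proof -
              obtain x where "h x = y" using order_iso_surj[OF h(1)] by blast
              then show ?thesis using hr[of x] True by (auto simp: sgn_zero_iff)
            qed
            then show ?thesis using True by simp
          next
            case False
            have nz: "poly (snd r e') y \<noteq> 0" if "y \<notin> h ` Z" for y
            proof
              assume "poly (snd r e') y = 0"
              moreover obtain x where "h x = y" using order_iso_surj[OF h(1)] by blast
              ultimately have "poly (snd r e) x = 0" using hr[of x] by (simp add: sgn_zero_iff)
              then have "x \<in> Z" using rR False by (auto simp: Z_def)
              then show False using that \<open>h x = y\<close> by blast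
            qed
            show ?thesis
            proof (cases "k x = h x")
              case True
              then show ?thesis using hr by simp
            next
              case False
              then have "\<not> apart (h ` Z) (h x) (k x)" using k(2)[of x] by blast
              from poly_sgn_not_apart[of "h ` Z" "snd r e'", OF nz this] show ?thesis using hr by simp
            qed
          qed
        qed
        then show ?thesis using k setL by (intro exI[of _ k]) auto
      qed
    qed
  qed
qed

section \<open>Elimination of quantifiers\<close>

lemma sa_atoms:
  assumes "sa Q"
  shows "\<exists>A. finite A \<and> (\<forall>a\<in>A. pfun a) \<and> (\<forall>e e'. same_sgns A e e' \<longrightarrow> Q e = Q e')"
  using assms
proof (induction rule: sa.induct)
  case (sa_pos p)
  have "0 < p e \<longleftrightarrow> 0 < p e'" if "sgn (p e) = sgn (p e')" for e e'
    using that by (auto simp: sgn_if split: if_splits)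
  then have "\<forall>e e'. same_sgns {p} e e' \<longrightarrow> (0 < p e) = (0 < p e')"
    unfolding same_sgns_def by blast
  then show ?case using sa_pos by (intro exI[of _ "{p}"]) simp
next
  case (sa_not P)
  then show ?case by metis
next
  case (sa_disj P Q)
  then obtain A B where "finite A" "\<forall>a\<in>A. pfun a" "\<forall>e e'. same_sgns A e e' \<longrightarrow> P e = P e'"
     "finite B" "\<forall>a\<in>B. pfun a" "\<forall>e e'. same_sgns B e e' \<longrightarrow> Q e = Q e'" by blast
  moreover from this have "P e = P e' \<and> Q e = Q e'" if "same_sgns (A \<union> B) e e'" for e e'
    using that unfolding same_sgns_def by blast
  ultimately show ?case by (intro exI[of _ "A \<union> B"]) auto
qed

text \<open>The atoms are read as polynomials in the variable \<open>i\<close>. Equal signs of the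
  parameter polynomials \<open>F\<close> give an order isomorphism matching all atoms, and it
  carries a witness for \<open>e\<close> to one for \<open>e'\<close>. The projection thus depends
  on finitely many signs only.\<close>

theorem sa_ex:
  assumes "sa Q" shows "sa (\<lambda>e. \<exists>x. Q (e(i := x)))"
proof -
  obtain A where A: "finite A" "\<forall>a\<in>A. pfun a" "\<And>e e'. same_sgns A e e' \<Longrightarrow> Q e = Q e'"
    using sa_atoms[OF assms] by blast
  have "\<forall>a\<in>A. \<exists>r. ppoly (fst r) (snd r) \<and> (\<forall>e x. a (e(i := x)) = poly (snd r e) x)"
    using pfun_as_ppoly[of _ i] A(2) by fastforce
  then obtain r where r: "\<And>a. a \<in> A \<Longrightarrow> ppoly (fst (r a)) (snd (r a))"
    "\<And>a e x. a \<in> A \<Longrightarrow> a (e(i := x)) = poly (snd (r a) e) x" by metis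
  obtain l where l: "set l = A" using finite_list[OF A(1)] by blast
  have "\<forall>(d, P)\<in>set (map r l). ppoly d P" using r(1) l by (auto simp: case_prod_beta)
  from ppoly_family_determined[OF this] obtain F where F: "finite F" "\<forall>a\<in>F. pfun a"
     "\<And>e e'. same_sgns F e e' \<Longrightarrow> (\<exists>h. order_iso h \<and> (\<forall>(d, P)\<in>set (map r l). \<forall>x. sgn (poly (P e) x) = sgn (poly (P e') (h x))))"
    by blast
  have *: "\<exists>x. Q (e'(i := x))" if s: "same_sgns F e e'" and "Q (e(i := x))" for e e' x
  proof -
    obtain h where h: "\<And>d P x. (d, P) \<in> set (map r l) \<Longrightarrow> sgn (poly (P e) x) = sgn (poly (P e') (h x))"
      using F(3)[OF s] by blast
    have "same_sgns A (e(i := x)) (e'(i := h x))"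
      unfolding same_sgns_def
    proof
      fix a assume "a \<in> A"
      then show "sgn (a (e(i := x))) = sgn (a (e'(i := h x)))"
        unfolding r(2)[OF \<open>a \<in> A\<close>] using h[of "fst (r a)" "snd (r a)" x] l by auto
    qed
    then show ?thesis using A(3) that by blast
  qed
  show ?thesis
  proof (rule sa_if_same_sgns[OF F(1)])
    show "(\<exists>x. Q (e(i := x))) = (\<exists>x. Q (e'(i := x)))" if "same_sgns F e e'" for e e'
    proof -
      have "same_sgns F e' e" using that by (simp add: same_sgns_def)
      then show ?thesis using * that by blast
    qed
  qed (use F in auto)
qed

lemma sa_all: "sa Q \<Longrightarrow> sa (\<lambda>e. \<forall>x. Q (e(i := x)))"
  using sa_not[OF sa_ex[OF sa_not[of Q]]] by simp

lemma sa_ex_finite: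
  assumes "finite I" "sa Q" shows "sa (\<lambda>e. \<exists>e'. (\<forall>i. i \<notin> I \<longrightarrow> e' i = e i) \<and> Q e')"
  using assms
proof (induction I rule: finite_induct)
  case empty
  then show ?case by (simp flip: fun_eq_iff)
next
  case (insert i I)
  have "(\<exists>e'. (\<forall>j. j \<notin> insert i I \<longrightarrow> e' j = e j) \<and> Q e') \<longleftrightarrow>
        (\<exists>x e'. (\<forall>j. j \<notin> I \<longrightarrow> e' j = (e(i := x)) j) \<and> Q e')" for e
  proof
    assume "\<exists>e'. (\<forall>j. j \<notin> insert i I \<longrightarrow> e' j = e j) \<and> Q e'"
    then obtain e' where "\<forall>j. j \<notin> insert i I \<longrightarrow> e' j = e j" "Q e'" by blast
    then show "\<exists>x e'. (\<forall>j. j \<notin> I \<longrightarrow> e' j = (e(i := x)) j) \<and> Q e'"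
      by (intro exI[of _ "e' i"] exI[of _ e']) auto
  next
    assume "\<exists>x e'. (\<forall>j. j \<notin> I \<longrightarrow> e' j = (e(i := x)) j) \<and> Q e'"
    then obtain x e' where "\<forall>j. j \<notin> I \<longrightarrow> e' j = (e(i := x)) j" "Q e'" by blast
    then show "\<exists>e'. (\<forall>j. j \<notin> insert i I \<longrightarrow> e' j = e j) \<and> Q e'"
      by (intro exI[of _ e']) auto
  qed
  then show ?case using sa_ex[OF insert.IH[OF insert.prems], of i] by simp
qed

lemma sa_all_finite:
  assumes "finite I" "sa Q" shows "sa (\<lambda>e. \<forall>e'. (\<forall>i. i \<notin> I \<longrightarrow> e' i = e i) \<longrightarrow> Q e')"
proof -
  have "(\<forall>e'. (\<forall>i. i \<notin> I \<longrightarrow> e' i = e i) \<longrightarrow> Q e') \<longleftrightarrow> \<not> (\<exists>e'. (\<forall>i. i \<notin> I \<longrightarrow> e' i = e i) \<and> \<not> Q e')" for e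
    by blast
  then show ?thesis using sa_not[OF sa_ex_finite[OF assms(1) sa_not[OF assms(2)]]] by simp
qed

section \<open>Definable choice\<close>

text \<open>A bound variable that is not among the given ones occupies the extra place
  \<open>None\<close>; iterating \<open>option\<close> handles nested quantifiers by plain
  introduction rules. The filler 0 in the proof stands in a bound place.\<close>

lemma sa_exI:
  assumes "sa (\<lambda>e. Q (\<lambda>i. e (Some i)) (e None))"
  shows "sa (\<lambda>e. \<exists>x. Q e x)"
proof -
  have "sa (\<lambda>e. \<exists>x. Q (\<lambda>i. e (Some i)) x)"
    using sa_ex[OF assms, of None] by simp
  moreover have "pfun (\<lambda>e. case_option 0 e i)" for i :: "'a option"
    by (cases i) (auto intro: pfun_const pfun_var)
  ultimately show ?thesis using sa_subst[of _ "\<lambda>e. case_option 0 e"] by fastforce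
qed

lemma sa_allI:
  assumes "sa (\<lambda>e. Q (\<lambda>i. e (Some i)) (e None))"
  shows "sa (\<lambda>e. \<forall>x. Q e x)"
  using sa_not[OF sa_exI[where Q = "\<lambda>e x. \<not> Q e x", OF sa_not[OF assms]]] by simp

lemma poly_sgn_at_right:
  fixes p :: "real poly"
  shows "\<exists>s. \<forall>\<^sub>F x in at_right a. sgn (poly p x) = s"
proof (cases "p = 0")
  case False
  let ?Z = "{x. poly p x = 0}"
  have "finite ?Z" using poly_roots_finite[OF False] .
  then obtain d where d: "d > 0" "\<forall>z\<in>?Z. z \<noteq> a \<longrightarrow> d \<le> dist a z"
    using finite_set_avoid by blast
  have "sgn (poly p x) = sgn (poly p (a + d / 2))" if "a < x" "x < a + d" for x
  proof (rule poly_sgn_not_apart[of ?Z])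
    show "\<not> apart ?Z x (a + d / 2)"
      using that d by (auto simp: apart_def closed_segment_eq_real_ivl dist_real_def disjoint_iff)
  qed auto
  then have "\<forall>\<^sub>F x in at_right a. sgn (poly p x) = sgn (poly p (a + d / 2))"
    unfolding eventually_at_right_field using d(1) by (metis less_add_same_cancel1)
  then show ?thesis by blast
qed auto

text \<open>One-sided form of o-minimality: a definable subset of a line does not oscillate to the
  right of any point, because a polynomial has constant sign there.\<close>

lemma sa_decided_at_right:
  assumes "sa Q"
  shows "(\<forall>\<^sub>F x in at_right a. Q (e(i := x))) \<or> (\<forall>\<^sub>F x in at_right a. \<not> Q (e(i := x)))"
  using assms
proof (induction rule: sa.induct)
  case (sa_pos p)
  obtain P where P: "\<And>x. p (e(i := x)) = poly (P e) x"
    using pfun_as_ppoly[OF sa_pos, of i] by blast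
  obtain s where s: "\<forall>\<^sub>F x in at_right a. sgn (poly (P e) x) = s"
    using poly_sgn_at_right by blast
  show ?case unfolding P
  proof (cases "s = 1")
    case True
    show "(\<forall>\<^sub>F x in at_right a. 0 < poly (P e) x) \<or> (\<forall>\<^sub>F x in at_right a. \<not> 0 < poly (P e) x)"
      by (rule disjI1, rule eventually_mono[OF s]) (auto simp: True sgn_if split: if_splits)
  next
    case False
    show "(\<forall>\<^sub>F x in at_right a. 0 < poly (P e) x) \<or> (\<forall>\<^sub>F x in at_right a. \<not> 0 < poly (P e) x)"
      by (rule disjI2, rule eventually_mono[OF s]) (use False in \<open>auto simp: sgn_if split: if_splits\<close>)
  qed
next
  case (sa_not P)
  then show ?case by auto
next
  case (sa_disj P Q)
  show ?case
  proof (cases "(\<forall>\<^sub>F x in at_right a. P (e(i := x))) \<or> (\<forall>\<^sub>F x in at_right a. Q (e(i := x)))")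
    case True
    then have "\<forall>\<^sub>F x in at_right a. P (e(i := x)) \<or> Q (e(i := x))"
    proof
      assume "\<forall>\<^sub>F x in at_right a. P (e(i := x))"
      then show ?thesis by eventually_elim blast
    next
      assume "\<forall>\<^sub>F x in at_right a. Q (e(i := x))"
      then show ?thesis by eventually_elim blast
    qed
    then show ?thesis by blast
  next
    case False
    then have "\<forall>\<^sub>F x in at_right a. \<not> P (e(i := x))" "\<forall>\<^sub>F x in at_right a. \<not> Q (e(i := x))"
      using sa_disj.IH by blast+
    then have "\<forall>\<^sub>F x in at_right a. \<not> (P (e(i := x)) \<or> Q (e(i := x)))" by eventually_elim blast
    then show ?thesis by blast
  qed
qed

text \<open>A canonical element of a bounded set of reals: its minimum if there is one, and otherwise
  the midpoint of the leftmost component, which is an interval when membership in the set does not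
  oscillate to the right of the infimum.\<close>

definition canonical_elt :: "real set \<Rightarrow> real \<Rightarrow> bool" where
  "canonical_elt X z \<longleftrightarrow> (z \<in> X \<and> (\<forall>w. w \<in> X \<longrightarrow> z \<le> w)) \<or>
     (\<not> (\<exists>m. m \<in> X \<and> (\<forall>w. w \<in> X \<longrightarrow> m \<le> w)) \<and>
      (\<exists>l u. l < u \<and> (\<forall>w. w \<in> X \<longrightarrow> l < w) \<and> (\<forall>w. l < w \<and> w < u \<longrightarrow> w \<in> X) \<and>
         (\<forall>u'. u < u' \<longrightarrow> (\<exists>w. l < w \<and> w < u' \<and> w \<notin> X)) \<and> 2 * z = l + u))"

text \<open>The two alternatives exclude each other. In the second one \<open>l\<close> is forced to
  be the infimum, and \<open>u\<close> the right end of the maximal interval starting there.\<close>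

lemma canonical_elt_unique:
  assumes "canonical_elt X z" "canonical_elt X z'" shows "z = z'"
proof -
  consider "z \<in> X" "\<forall>w. w \<in> X \<longrightarrow> z \<le> w" "z' \<in> X" "\<forall>w. w \<in> X \<longrightarrow> z' \<le> w"
    | l u l' u' where "l < u" "\<forall>w. w \<in> X \<longrightarrow> l < w" "\<forall>w. l < w \<and> w < u \<longrightarrow> w \<in> X"
      "\<forall>u'. u < u' \<longrightarrow> (\<exists>w. l < w \<and> w < u' \<and> w \<notin> X)" "2 * z = l + u"
      "l' < u'" "\<forall>w. w \<in> X \<longrightarrow> l' < w" "\<forall>w. l' < w \<and> w < u' \<longrightarrow> w \<in> X"
      "\<forall>u. u' < u \<longrightarrow> (\<exists>w. l' < w \<and> w < u \<and> w \<notin> X)" "2 * z' = l' + u'"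
    using assms unfolding canonical_elt_def by blast
  then show ?thesis
  proof cases
    case 1
    then show ?thesis by (intro antisym) blast+
  next
    case 2
    have "\<not> l < l'"
    proof
      assume "l < l'"
      then obtain w where "l < w" "w < min l' u" using dense[of l "min l' u"] 2(1) by auto
      then show False using 2(3,7) by force
    qed
    moreover have "\<not> l' < l"
    proof
      assume "l' < l"
      then obtain w where "l' < w" "w < min l u'" using dense[of l' "min l u'"] 2(6) by auto
      then show False using 2(8,2) by force
    qed
    ultimately have "l = l'" by linarith
    have "\<not> u < u'" using 2(4,8) \<open>l = l'\<close> by blast
    moreover have "\<not> u' < u" using 2(3,9) \<open>l = l'\<close> by blast
    ultimately have "u = u'" by simp
    then show ?thesis using 2(5,10) \<open>l = l'\<close> by linarith
  qed
qed

lemma canonical_elt_exists: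
  assumes "X \<noteq> {}" "\<And>x. x \<in> X \<Longrightarrow> \<bar>x\<bar> \<le> B"
    and dec: "\<And>a. (\<forall>\<^sub>F x in at_right a. x \<in> X) \<or> (\<forall>\<^sub>F x in at_right a. x \<notin> X)"
  shows "\<exists>z. canonical_elt X z \<and> z \<in> X"
proof (cases "\<exists>m. m \<in> X \<and> (\<forall>w. w \<in> X \<longrightarrow> m \<le> w)")
  case True
  then show ?thesis unfolding canonical_elt_def by blast
next
  case False
  define l where "l = Inf X"
  have bd: "bdd_below X" using assms(2) by (intro bdd_belowI[of _ "-B"]) (simp add: abs_le_iff, fastforce)
  have "l \<le> w" if "w \<in> X" for w using cInf_lower[OF that bd] by (simp add: l_def)
  then have lw: "l < w" if "w \<in> X" for w using that False by (metis order_le_less)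
  have "\<exists>x\<in>X. x < b" if "l < b" for b
    using that cInf_less_iff[OF assms(1) bd] by (auto simp: l_def)
  then have "\<not> (\<forall>\<^sub>F x in at_right l. x \<notin> X)"
    unfolding eventually_at_right_field using lw by blast
  then obtain b where b: "b > l" "\<And>x. l < x \<Longrightarrow> x < b \<Longrightarrow> x \<in> X"
    using dec[of l] unfolding eventually_at_right_field by blast
  \<comment> \<open>Right ends of the intervals starting at the infimum and contained in
    \<open>X\<close>. The bound on \<open>X\<close> makes this set bounded, so its supremum
    exists.\<close>
  define U where "U = {u. \<forall>w. l < w \<and> w < u \<longrightarrow> w \<in> X}"
  define u where "u = Sup U"
  have bU: "b \<in> U" using b by (auto simp: U_def)
  have bdU: "u \<le> max l B + 1" if "u \<in> U" for u
  proof (rule ccontr)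
    assume "\<not> ?thesis"
    then have "max l B + 1 \<in> X" using that by (auto simp: U_def)
    then show False using assms(2)[of "max l B + 1"] by simp
  qed
  then have bd': "bdd_above U" by (auto simp: bdd_above_def)
  have lu: "l < u" using cSup_upper[OF bU bd'] b by (simp add: u_def)
  have in_X: "w \<in> X" if "l < w" "w < u" for w
    using that less_cSup_iff[of U w] bU bd' by (auto simp: u_def U_def)
  have mx: "\<exists>w. l < w \<and> w < u' \<and> w \<notin> X" if "u < u'" for u'
    using cSup_upper[OF _ bd', of u'] that by (auto simp: u_def U_def)
  have "canonical_elt X ((l + u) / 2)" unfolding canonical_elt_def
    using False lu lw in_X mx by (intro disjI2 conjI exI[of _ l] exI[of _ u]) auto
  moreover have "(l + u) / 2 \<in> X" using in_X lu by simp
  ultimately show ?thesis by blast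
qed

text \<open>Definability of a map is stated through preimages, so that composition is immediate and
  no graph in a doubled set of variables has to be formed.\<close>

definition sa_map :: "(('w \<Rightarrow> real) \<Rightarrow> ('v \<Rightarrow> real)) \<Rightarrow> bool" where
  "sa_map \<sigma> \<longleftrightarrow> (\<forall>Q. sa Q \<longrightarrow> sa (\<lambda>e. Q (\<sigma> e)))"

lemma sa_mapD: "sa_map \<sigma> \<Longrightarrow> sa Q \<Longrightarrow> sa (\<lambda>e. Q (\<sigma> e))"
  by (simp add: sa_map_def)

lemma sa_map_pfun: "(\<And>i. pfun (\<lambda>e. \<sigma> e i)) \<Longrightarrow> sa_map \<sigma>"
  by (simp add: sa_map_def sa_subst)

lemma sa_canonical_elt:
  assumes "sa Q" shows "sa (\<lambda>e. canonical_elt {x. Q (e(i := x))} (e i))"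
proof -
  have Q: "sa (\<lambda>e. Q (\<sigma> e))" if "\<And>i. pfun (\<lambda>e. \<sigma> e i)" for \<sigma> :: "('w \<Rightarrow> real) \<Rightarrow> _"
    using sa_subst[OF assms that] .
  have if_pfun: "pfun (\<lambda>e. if b then p e else q e)" if "pfun p" "pfun q" for b and p q :: "('w \<Rightarrow> real) \<Rightarrow> real"
    using that by (cases b) auto
  show ?thesis
    unfolding canonical_elt_def mem_Collect_eq
    by (intro sa_disj sa_conj sa_imp sa_not sa_less sa_le sa_eq sa_exI sa_allI Q)
      (auto simp: fun_upd_def intro!: pfun_intros if_pfun)
qed

text \<open>The canonical element has a first-order description in terms of \<open>Q\<close>, which
  makes the choice definable. The last clause records that the choice ignores every variable that
  \<open>Q\<close> ignores; it keeps a spare variable free for later comparisons.\<close>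

lemma sa_choice1:
  assumes Q: "sa Q" and B: "\<And>e. Q e \<Longrightarrow> \<bar>e i\<bar> \<le> B"
  shows "\<exists>\<sigma>. sa_map \<sigma> \<and> (\<forall>e j. j \<noteq> i \<longrightarrow> \<sigma> e j = e j) \<and> (\<forall>e. (\<exists>x. Q (e(i := x))) \<longrightarrow> Q (\<sigma> e)) \<and>
    (\<forall>z. z \<noteq> i \<longrightarrow> (\<forall>e x. Q (e(z := x)) = Q e) \<longrightarrow> (\<forall>e x. \<sigma> (e(z := x)) = (\<sigma> e)(z := x)))"
proof -
  define X where "X e = {x. Q (e(i := x))}" for e
  have ex: "\<exists>z. canonical_elt (X e) z \<and> z \<in> X e" if "X e \<noteq> {}" for e
  proof (rule canonical_elt_exists[OF that])
    show "\<bar>x\<bar> \<le> B" if "x \<in> X e" for x using that B[of "e(i := x)"] by (simp add: X_def)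
    show "(\<forall>\<^sub>F x in at_right a. x \<in> X e) \<or> (\<forall>\<^sub>F x in at_right a. x \<notin> X e)" for a
      using sa_decided_at_right[OF Q, of e i a] by (simp add: X_def)
  qed
  define r where "r e = (if X e = {} then 0 else THE z. canonical_elt (X e) z)" for e
  have r: "canonical_elt (X e) z \<longleftrightarrow> z = r e" "r e \<in> X e" if "X e \<noteq> {}" for e z
  proof -
    obtain y where y: "canonical_elt (X e) y" "y \<in> X e" using ex \<open>X e \<noteq> {}\<close> by blast
    have "(THE z. canonical_elt (X e) z) = y"
      using y(1) canonical_elt_unique[OF _ y(1)] by (rule the_equality)
    then have ry: "r e = y" using that by (simp add: r_def)
    then show "r e \<in> X e" using y by simp
    show "canonical_elt (X e) z \<longleftrightarrow> z = r e" using y(1) canonical_elt_unique[OF _ y(1)] unfolding ry by blast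
  qed
  define \<sigma> where "\<sigma> e = e(i := r e)" for e
  have "sa_map \<sigma>" unfolding sa_map_def
  proof (intro allI impI)
    fix R :: "('a \<Rightarrow> real) \<Rightarrow> bool" assume R: "sa R"
    \<comment> \<open>The graph of \<open>r\<close>, including its default value 0 where there is no
      witness.\<close>
    define C where "C e \<longleftrightarrow> canonical_elt (X e) (e i) \<or> ((\<forall>x. \<not> Q (e(i := x))) \<and> e i = 0)" for e
    have "sa C" unfolding C_def X_def
      by (intro sa_disj sa_conj sa_canonical_elt sa_eq pfun_intros Q sa_all sa_not)
    then have "sa (\<lambda>e. \<exists>x. C (e(i := x)) \<and> R (e(i := x)))"
      using sa_ex[OF sa_conj[OF _ R]] by blast
    moreover have "C (e(i := x)) \<longleftrightarrow> x = r e" for e x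
    proof (cases "X e = {}")
      case True
      then have "\<not> canonical_elt (X e) x" 
        by (auto simp: canonical_elt_def dest: dense)
      then show ?thesis using True by (auto simp: C_def X_def r_def)
    next
      case False
      then show ?thesis using r(1)[OF False, of x] by (auto simp: C_def X_def)
    qed
    ultimately show "sa (\<lambda>e. R (\<sigma> e))" by (simp add: \<sigma>_def)
  qed
  moreover have "Q (\<sigma> e)" if "\<exists>x. Q (e(i := x))" for e
  proof -
    have "X e \<noteq> {}" using that by (auto simp: X_def)
    then show ?thesis using r(2)[of e] by (simp add: X_def \<sigma>_def)
  qed
  moreover have "\<sigma> (e(z := x)) = (\<sigma> e)(z := x)" if "z \<noteq> i" "\<forall>e x. Q (e(z := x)) = Q e" for z e x
  proof -
    have "Q (e(z := x, i := y)) = Q (e(i := y))" for y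
      unfolding fun_upd_twist[OF that(1)] using that(2) by blast
    then have "X (e(z := x)) = X e" by (simp add: X_def)
    then have "r (e(z := x)) = r e" by (simp add: r_def)
    then show ?thesis unfolding \<sigma>_def by (simp only: fun_upd_twist[OF that(1)])
  qed
  moreover have "\<sigma> e j = e j" if "j \<noteq> i" for e j using that by (simp add: \<sigma>_def)
  ultimately show ?thesis by blast
qed

text \<open>Coordinate by coordinate: variable \<open>i\<close> gets a value for which the remaining
  ones can still be completed, as expressed by the projection \<open>R\<close>, and those are then
  chosen by induction.\<close>

lemma sa_choice:
  assumes "finite I" "sa Q" "\<And>e i. Q e \<Longrightarrow> i \<in> I \<Longrightarrow> \<bar>e i\<bar> \<le> B"
  shows "\<exists>\<sigma>. sa_map \<sigma> \<and> (\<forall>e j. j \<notin> I \<longrightarrow> \<sigma> e j = e j) \<and>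
    (\<forall>e e'. (\<forall>j. j \<notin> I \<longrightarrow> e' j = e j) \<and> Q e' \<longrightarrow> Q (\<sigma> e)) \<and>
    (\<forall>z. z \<notin> I \<longrightarrow> (\<forall>e x. Q (e(z := x)) = Q e) \<longrightarrow> (\<forall>e x. \<sigma> (e(z := x)) = (\<sigma> e)(z := x)))"
  using assms
proof (induction I rule: finite_induct)
  case empty
  have "e' = e" if "\<forall>j. e' j = e j" for e e' :: "'a \<Rightarrow> real" using that by blast
  then show ?case by (intro exI[of _ "\<lambda>e. e"]) (auto simp: sa_map_def)
next
  case (insert i I)
  have bI: "\<bar>e j\<bar> \<le> B" if "Q e" "j \<in> I" for e j using insert.prems(2) that by blast
  obtain \<sigma> where \<sigma>: "sa_map \<sigma>" "\<And>e j. j \<notin> I \<Longrightarrow> \<sigma> e j = e j"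
    "\<And>e e'. (\<forall>j. j \<notin> I \<longrightarrow> e' j = e j) \<Longrightarrow> Q e' \<Longrightarrow> Q (\<sigma> e)"
    "\<And>z e x. z \<notin> I \<Longrightarrow> (\<And>e x. Q (e(z := x)) = Q e) \<Longrightarrow> \<sigma> (e(z := x)) = (\<sigma> e)(z := x)"
    by (rule exE[OF insert.IH[OF insert.prems(1)]], erule (1) bI, blast)
  define R where "R e \<longleftrightarrow> (\<exists>e'. (\<forall>j. j \<notin> I \<longrightarrow> e' j = e j) \<and> Q e')" for e
  have R: "sa R" unfolding R_def by (rule sa_ex_finite[OF insert.hyps(1) insert.prems(1)])
  have Rb: "\<bar>e i\<bar> \<le> B" if "R e" for e
    using that insert.prems(2) insert.hyps(2) unfolding R_def by (metis insertI1)
  obtain \<tau> where \<tau>: "sa_map \<tau>" "\<And>e j. j \<noteq> i \<Longrightarrow> \<tau> e j = e j"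
    "\<And>e x. R (e(i := x)) \<Longrightarrow> R (\<tau> e)"
    "\<And>z e x. z \<noteq> i \<Longrightarrow> (\<And>e x. R (e(z := x)) = R e) \<Longrightarrow> \<tau> (e(z := x)) = (\<tau> e)(z := x)"
    using sa_choice1[of R i B] R Rb by blast
  show ?case
  proof (intro exI[of _ "\<lambda>e. \<sigma> (\<tau> e)"] conjI allI impI; (elim conjE)?)
    show "sa_map (\<lambda>e. \<sigma> (\<tau> e))" 
      unfolding sa_map_def using sa_mapD[OF \<tau>(1) sa_mapD[OF \<sigma>(1)]] by blast
    show "\<sigma> (\<tau> e) j = e j" if "j \<notin> insert i I" for e j using that \<sigma>(2) \<tau>(2) by auto
    show "\<sigma> (\<tau> (e(z := x))) = (\<sigma> (\<tau> e))(z := x)"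
      if z: "z \<notin> insert i I" and inv: "\<forall>e x. Q (e(z := x)) = Q e" for z e x
    proof -
      have *: "R (e(z := x))" if Re: "R e" for e x
      proof -
        obtain e' where "\<forall>j. j \<notin> I \<longrightarrow> e' j = e j" "Q e'" using Re unfolding R_def by blast
        then show ?thesis unfolding R_def using inv by (intro exI[of _ "e'(z := x)"]) auto
      qed
      have "R (e(z := x)) = R e" for e x using *[of e x] *[of "e(z := x)" "e z"] by auto
      then have "\<tau> (e(z := x)) = (\<tau> e)(z := x)" using \<tau>(4) z by blast
      then show ?thesis using \<sigma>(4)[of z] z inv by simp
    qed
    fix e e' assume *: "\<forall>j. j \<notin> insert i I \<longrightarrow> e' j = e j" "Q e'"
    then have "R (e(i := e' i))" unfolding R_def by (intro exI[of _ e']) auto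
    then have "R (\<tau> e)" by (rule \<tau>(3))
    then show "Q (\<sigma> (\<tau> e))" using \<sigma>(3) unfolding R_def by blast
  qed
qed

section \<open>Algebraicity of graphs of definable functions\<close>

definition poly2 :: "real poly poly \<Rightarrow> real \<Rightarrow> real \<Rightarrow> real" where
  "poly2 G t y = poly (poly G [:y:]) t"

lemma poly2_simps [simp]:
  "poly2 (G + H) t y = poly2 G t y + poly2 H t y"
  "poly2 (G * H) t y = poly2 G t y * poly2 H t y"
  "poly2 0 t y = 0" "poly2 1 t y = 1" "poly2 [:p:] t y = poly p t" "poly2 [:0, 1:] t y = y"
  by (auto simp: poly2_def)

lemma pfun_as_poly2:
  assumes "pfun p" "T \<noteq> Z" shows "\<exists>P. \<forall>t y. p (e(T := t, Z := y)) = poly2 P t y"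
  using assms(1)
proof (induction rule: pfun.induct)
  case (pfun_const c)
  show ?case by (rule exI[of _ "[:[:c:]:]"]) simp
next
  case (pfun_var i)
  have "\<forall>t y. (e(T := t, Z := y)) i = poly2 (if i = Z then [:0, 1:] else if i = T then [:[:0, 1:]:] else [:[:e i:]:]) t y"
    by simp
  then show ?case by blast
next
  case (pfun_add p q)
  then show ?case by (metis poly2_simps(1))
next
  case (pfun_mult p q)
  then show ?case by (metis poly2_simps(2))
qed

lemma pfun_tendsto:
  assumes "pfun p" shows "((\<lambda>y. p (e(i := y))) \<longlongrightarrow> p (e(i := a))) (at a)"
  using assms
proof (induction rule: pfun.induct)
  case (pfun_var j)
  then show ?case by (cases "j = i") (auto intro: tendsto_ident_at tendsto_const)
qed (auto intro: tendsto_intros)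

text \<open>\<open>G\<close> is the product of the atoms that are nonzero as polynomials in two
  variables. Where it does not vanish, every atom keeps its sign under small changes of the variable
  \<open>Z\<close>. Atoms that vanish identically are constantly false and contribute the factor
  1.\<close>

lemma sa_locally_constant:
  assumes "sa Q" "T \<noteq> Z"
  shows "\<exists>G. G \<noteq> 0 \<and> (\<forall>t y. poly2 G t y \<noteq> 0 \<longrightarrow>
           (\<forall>\<^sub>F z in at y. Q (e(T := t, Z := z)) \<longleftrightarrow> Q (e(T := t, Z := y))))"
  using assms(1)
proof (induction rule: sa.induct)
  case (sa_pos p)
  obtain P where P: "\<And>t y. p (e(T := t, Z := y)) = poly2 P t y"
    using pfun_as_poly2[OF sa_pos assms(2)] by blast
  show ?case
  proof (cases "P = 0")
    case True
    then show ?thesis by (intro exI[of _ 1]) (simp add: P del: fun_upd_apply)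
  next
    case False
    have "\<forall>\<^sub>F z in at y. (0 < poly2 P t z) = (0 < poly2 P t y)" if "poly2 P t y \<noteq> 0" for t y
    proof -
      have lim: "(poly2 P t \<longlongrightarrow> poly2 P t y) (at y)"
        using pfun_tendsto[OF sa_pos, of "e(T := t)" Z y] by (simp add: P)
      show ?thesis
      proof (cases "poly2 P t y" "0 :: real" rule: linorder_cases)
        case less
        then show ?thesis using order_tendstoD(2)[OF lim less] by (auto elim: eventually_mono)
      next
        case greater
        then show ?thesis using order_tendstoD(1)[OF lim greater] by (auto elim: eventually_mono)
      qed (use that in auto)
    qed
    then show ?thesis using False by (intro exI[of _ P]) (simp add: P del: fun_upd_apply)
  qed
next
  case (sa_not P)
  then show ?case by simp
next
  case (sa_disj P Q)
  then obtain G H where G: "G \<noteq> 0" "\<forall>t y. poly2 G t y \<noteq> 0 \<longrightarrow>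
           (\<forall>\<^sub>F z in at y. P (e(T := t, Z := z)) \<longleftrightarrow> P (e(T := t, Z := y)))"
    and H: "H \<noteq> 0" "\<forall>t y. poly2 H t y \<noteq> 0 \<longrightarrow>
           (\<forall>\<^sub>F z in at y. Q (e(T := t, Z := z)) \<longleftrightarrow> Q (e(T := t, Z := y)))" by blast
  show ?case
  proof (intro exI[of _ "G * H"] conjI allI impI)
    fix t y assume "poly2 (G * H) t y \<noteq> 0"
    then have "\<forall>\<^sub>F z in at y. P (e(T := t, Z := z)) \<longleftrightarrow> P (e(T := t, Z := y))"
      "\<forall>\<^sub>F z in at y. Q (e(T := t, Z := z)) \<longleftrightarrow> Q (e(T := t, Z := y))" using G H by auto
    then show "\<forall>\<^sub>F z in at y. P (e(T := t, Z := z)) \<or> Q (e(T := t, Z := z)) \<longleftrightarrow>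
        P (e(T := t, Z := y)) \<or> Q (e(T := t, Z := y))"
      by eventually_elim simp
  qed (use G H in simp)
qed

text \<open>A point is not open in the line. So the truth of a single-valued relation is not locally
  constant on its graph, and the polynomial of the previous lemma has to vanish there.\<close>

lemma sa_graph_algebraic:
  assumes "sa Q" "T \<noteq> Z"
  shows "\<exists>G. G \<noteq> 0 \<and> (\<forall>t y. (\<forall>z. Q (e(T := t, Z := z)) \<longleftrightarrow> z = y) \<longrightarrow> poly2 G t y = 0)"
proof -
  obtain G where G: "G \<noteq> 0" "\<And>t y. poly2 G t y \<noteq> 0 \<Longrightarrow>
           (\<forall>\<^sub>F z in at y. Q (e(T := t, Z := z)) \<longleftrightarrow> Q (e(T := t, Z := y)))"
    using sa_locally_constant[OF assms] by blast
  have "poly2 G t y = 0" if *: "\<And>z. Q (e(T := t, Z := z)) \<longleftrightarrow> z = y" for t y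
  proof (rule ccontr)
    assume "poly2 G t y \<noteq> 0"
    then have "\<forall>\<^sub>F z in at y. z = y" using G(2)[of t y] by (simp add: *)
    moreover have "\<forall>\<^sub>F z in at y. z \<noteq> y" by (simp add: eventually_at_filter)
    ultimately have "\<forall>\<^sub>F z in at y. False" by eventually_elim simp
    then show False by simp
  qed
  then show ?thesis using G(1) by blast
qed

section \<open>Puiseux expansions\<close>

text \<open>No oscillation against polynomials to the right of 0. The powers \<open>s ^ k\<close>
  and \<open>s ^ r\<close> are built in so that the class is closed under the substitutions of the
  Newton-Puiseux algorithm.\<close>

definition tame :: "(real \<Rightarrow> real) \<Rightarrow> bool" where
  "tame f \<longleftrightarrow> (\<forall>k\<ge>1. \<forall>r b. (\<forall>\<^sub>F s in at_right 0. s ^ r * f (s ^ k) > poly b s) \<or>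
     (\<forall>\<^sub>F s in at_right 0. \<not> s ^ r * f (s ^ k) > poly b s))"

text \<open>Approximation by truncated Puiseux series: with t = s^k the error is at most t^L. The
  ramification \<open>k\<close> may depend on \<open>L\<close>, so neither an infinite series nor
  its convergence is involved.\<close>

definition puiseux :: "(real \<Rightarrow> real) \<Rightarrow> bool" where
  "puiseux f \<longleftrightarrow> (\<forall>L. \<exists>k\<ge>1. \<exists>q. \<forall>\<^sub>F s in at_right 0. \<bar>f (s ^ k) - poly q s\<bar> \<le> s ^ (k * L))"

lemma eventually_at_right_0_pos: "\<forall>\<^sub>F s in at_right (0::real). 0 < s"
  by (simp add: eventually_at_right_less)

lemma eventually_at_right_0_less: "0 < d \<Longrightarrow> \<forall>\<^sub>F s in at_right (0::real). s < d"
  by (auto simp: eventually_at_right_field)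

lemma filterlim_power_at_right_0:
  assumes "k \<ge> 1" shows "filterlim (\<lambda>s::real. s ^ k) (at_right 0) (at_right 0)"
proof -
  have "((\<lambda>s::real. s ^ k) \<longlongrightarrow> 0 ^ k) (at_right 0)" by (intro tendsto_intros)
  moreover have "\<forall>\<^sub>F s::real in at_right 0. s ^ k \<in> {0<..}"
    using eventually_at_right_0_pos by eventually_elim simp
  ultimately show ?thesis
    using assms by (auto simp: filterlim_at eventually_conj_iff power_0_left elim: eventually_mono)
qed

lemma eventually_power_at_right_0:
  "k \<ge> 1 \<Longrightarrow> \<forall>\<^sub>F s in at_right (0::real). P s \<Longrightarrow> \<forall>\<^sub>F s in at_right 0. P (s ^ k)"
  using filterlim_power_at_right_0[of k] by (simp add: filterlim_iff)

lemma tame_transform: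
  assumes f: "tame f" and k: "k \<ge> 1"
  shows "tame (\<lambda>s. (f (s ^ k) - poly q s) / s ^ r)"
  unfolding tame_def
proof (intro allI impI)
  fix k' r' :: nat and b :: "real poly" assume k': "k' \<ge> 1"
  \<comment> \<open>Clears the denominator \<open>s ^ (k' * r)\<close> in the inequality with
    \<open>b\<close>.\<close>
  define c where "c = b * monom 1 (k' * r) + monom 1 r' * pcompose q (monom 1 k')"
  have "s ^ r' * ((f ((s ^ k') ^ k) - poly q (s ^ k')) / (s ^ k') ^ r) > poly b s \<longleftrightarrow>
        s ^ r' * f (s ^ (k' * k)) > poly c s" if "s > 0" for s
  proof -
    have "s ^ r' * ((f ((s ^ k') ^ k) - poly q (s ^ k')) / (s ^ k') ^ r) =
      (s ^ r' * f (s ^ (k' * k)) - s ^ r' * poly q (s ^ k')) / s ^ (k' * r)"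
      by (simp add: power_mult right_diff_distrib)
    then show ?thesis
      using that by (simp add: c_def poly_monom poly_pcompose pos_less_divide_eq) argo
  qed
  then have "\<forall>\<^sub>F s in at_right 0. s ^ r' * ((f ((s ^ k') ^ k) - poly q (s ^ k')) / (s ^ k') ^ r) > poly b s \<longleftrightarrow>
        s ^ r' * f (s ^ (k' * k)) > poly c s"
    using eventually_at_right_0_pos by (auto elim: eventually_mono)
  note * = this
  have "k' * k \<ge> 1" using k k' by simp
  then consider "\<forall>\<^sub>F s in at_right 0. s ^ r' * f (s ^ (k' * k)) > poly c s"
    | "\<forall>\<^sub>F s in at_right 0. \<not> s ^ r' * f (s ^ (k' * k)) > poly c s"
    using f unfolding tame_def by blast
  then show "(\<forall>\<^sub>F s in at_right 0. s ^ r' * ((f ((s ^ k') ^ k) - poly q (s ^ k')) / (s ^ k') ^ r) > poly b s) \<or>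
    (\<forall>\<^sub>F s in at_right 0. \<not> s ^ r' * ((f ((s ^ k') ^ k) - poly q (s ^ k')) / (s ^ k') ^ r) > poly b s)"
  proof cases
    case 1
    then have "\<forall>\<^sub>F s in at_right 0. s ^ r' * ((f ((s ^ k') ^ k) - poly q (s ^ k')) / (s ^ k') ^ r) > poly b s"
      using * by eventually_elim metis
    then show ?thesis by blast
  next
    case 2
    then have "\<forall>\<^sub>F s in at_right 0. \<not> s ^ r' * ((f ((s ^ k') ^ k) - poly q (s ^ k')) / (s ^ k') ^ r) > poly b s"
      using * by eventually_elim metis
    then show ?thesis by blast
  qed
qed

text \<open>The limit is the supremum of the constants that are eventually exceeded; by tameness
  every other constant is eventually an upper bound.\<close>

lemma tame_bounded_tendsto:
  assumes f: "tame f" and B: "\<forall>\<^sub>F s in at_right 0. \<bar>f s\<bar> \<le> B"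
  shows "\<exists>c. (f \<longlongrightarrow> c) (at_right 0)"
proof -
  have dec: "(\<forall>\<^sub>F s in at_right 0. f s > x) \<or> (\<forall>\<^sub>F s in at_right 0. \<not> f s > x)" for x
    using f[unfolded tame_def, rule_format, of 1 "[:x:]" 0] by simp
  define A where "A = {x. \<forall>\<^sub>F s in at_right 0. f s > x}"
  have "-B - 1 \<in> A" unfolding A_def mem_Collect_eq using B by eventually_elim auto
  moreover have ub: "x \<le> B" if "x \<in> A" for x
  proof -
    have "\<forall>\<^sub>F s in at_right (0::real). x \<le> B"
      using that[unfolded A_def mem_Collect_eq] B by eventually_elim auto
    then show ?thesis by simp
  qed
  ultimately have bdd: "bdd_above A" "A \<noteq> {}" by (auto simp: bdd_above_def)
  have "(f \<longlongrightarrow> Sup A) (at_right 0)"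
  proof (rule order_tendstoI)
    fix a assume "a < Sup A"
    then obtain x where "x \<in> A" "a < x" using less_cSup_iff[OF bdd(2,1)] by blast
    then show "\<forall>\<^sub>F s in at_right 0. a < f s" unfolding A_def by (auto elim: eventually_mono)
  next
    fix a assume "Sup A < a"
    then obtain x where x: "Sup A < x" "x < a" using dense by blast
    then have "x \<notin> A" using cSup_upper[OF _ bdd(1), of x] by auto
    then have "\<forall>\<^sub>F s in at_right 0. \<not> f s > x" using dec[of x] by (auto simp: A_def)
    then show "\<forall>\<^sub>F s in at_right 0. f s < a" by eventually_elim (use x in auto)
  qed
  then show ?thesis by blast
qed

lemma poly_tendsto_at_right_0: "(poly (p :: real poly) \<longlongrightarrow> poly p 0) (at_right 0)"
  by (intro tendsto_poly tendsto_ident_at)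

text \<open>If |g| > K s^a, each term of index below \<mu> is bounded by a constant times s^a
  |g|^(\<mu> - 1). The remaining terms add up to g^\<mu> times a quantity tending to
  \<open>poly (b \<mu>) 0\<close>, so the sum cannot vanish when \<open>K\<close> is large.\<close>

lemma newton_bound:
  fixes b :: "nat \<Rightarrow> real poly"
  assumes g: "(g \<longlongrightarrow> 0) (at_right 0)" and n: "\<mu> \<le> n" "\<mu> \<ge> 1" and nz: "poly (b \<mu>) 0 \<noteq> 0"
    and dv: "\<And>j. j < \<mu> \<Longrightarrow> monom 1 (a * (\<mu> - j)) dvd b j"
    and z: "\<forall>\<^sub>F s in at_right 0. (\<Sum>j\<le>n. poly (b j) s * g s ^ j) = 0"
  shows "\<exists>K. \<forall>\<^sub>F s in at_right 0. \<bar>g s\<bar> \<le> K * s ^ a"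
proof -
  define A where "A = \<bar>poly (b \<mu>) 0\<bar>"
  have A: "A > 0" using nz by (simp add: A_def)
  have "\<forall>j\<in>{..<\<mu>}. \<exists>c. b j = monom 1 (a * (\<mu> - j)) * c" using dv by (auto elim: dvdE)
  then obtain c where c: "\<And>j. j < \<mu> \<Longrightarrow> b j = monom 1 (a * (\<mu> - j)) * c j" by (metis lessThan_iff)
  define C where "C = 1 + (\<Sum>j<\<mu>. \<bar>poly (c j) 0\<bar>)"
  have C: "C > 0" by (auto simp: C_def intro!: add_pos_nonneg sum_nonneg)
  have "((\<lambda>s. \<Sum>j<\<mu>. \<bar>poly (c j) s\<bar>) \<longlongrightarrow> (\<Sum>j<\<mu>. \<bar>poly (c j) 0\<bar>)) (at_right 0)"
    by (intro tendsto_intros poly_tendsto_at_right_0)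
  then have ev1: "\<forall>\<^sub>F s in at_right 0. (\<Sum>j<\<mu>. \<bar>poly (c j) s\<bar>) < C"
    by (rule order_tendstoD) (simp add: C_def)
  define tl where "tl s = (\<Sum>j\<in>{\<mu>..n}. poly (b j) s * g s ^ (j - \<mu>))" for s
  have "(tl \<longlongrightarrow> (\<Sum>j\<in>{\<mu>..n}. poly (b j) 0 * 0 ^ (j - \<mu>))) (at_right 0)"
    unfolding tl_def by (intro tendsto_intros poly_tendsto_at_right_0 g)
  moreover have "(\<Sum>j\<in>{\<mu>..n}. poly (b j) 0 * 0 ^ (j - \<mu>)) = (\<Sum>j\<in>{\<mu>}. poly (b j) 0 * 0 ^ (j - \<mu>))"
    using n by (intro sum.mono_neutral_right) auto
  ultimately have "((\<lambda>s. \<bar>tl s\<bar>) \<longlongrightarrow> A) (at_right 0)" unfolding A_def by (intro tendsto_rabs) simp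
  then have ev2: "\<forall>\<^sub>F s in at_right 0. \<bar>tl s\<bar> > A / 2" by (rule order_tendstoD) (use A in simp)
  \<comment> \<open>The bound 1 gives \<open>s ^ a < \<bar>g s\<bar>\<close>, used to replace powers
    of s^a by powers of |g|; the other bound is the largest factor that the equation
    permits.\<close>
  define K where "K = max 1 (2 * C / A)"
  have "\<forall>\<^sub>F s in at_right 0. \<bar>g s\<bar> \<le> K * s ^ a"
    using z ev1 ev2 eventually_at_right_0_pos
  proof eventually_elim
    case (elim s)
    show ?case
    proof (rule ccontr)
      assume "\<not> ?thesis"
      then have gs: "\<bar>g s\<bar> > K * s ^ a" by simp
      have sa: "s ^ a \<ge> 0" using elim by simp
      have "1 * s ^ a \<le> K * s ^ a" by (rule mult_right_mono[OF _ sa]) (simp add: K_def)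
      then have sg: "s ^ a < \<bar>g s\<bar>" using gs by simp
      then have g0: "\<bar>g s\<bar> > 0" using sa by simp
      have split: "{..n} = {..<\<mu>} \<union> {\<mu>..n}" using n by auto
      have "(\<Sum>j\<in>{\<mu>..n}. poly (b j) s * g s ^ j) = g s ^ \<mu> * tl s"
        unfolding tl_def sum_distrib_left by (intro sum.cong) (auto simp: mult_ac simp flip: power_add)
      then have "(\<Sum>j<\<mu>. poly (b j) s * g s ^ j) + g s ^ \<mu> * tl s = 0"
        using elim(1) unfolding split by (subst (asm) sum.union_disjoint) auto
      then have "\<bar>g s\<bar> ^ \<mu> * \<bar>tl s\<bar> = \<bar>\<Sum>j<\<mu>. poly (b j) s * g s ^ j\<bar>"
        by (metis abs_minus_cancel abs_mult add.commute add_eq_0_iff power_abs)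
      also have "\<dots> \<le> (\<Sum>j<\<mu>. \<bar>poly (c j) s\<bar> * (s ^ a * \<bar>g s\<bar> ^ (\<mu> - 1)))"
      proof (rule order_trans[OF sum_abs], rule sum_mono)
        fix j assume "j \<in> {..<\<mu>}"
        then have j: "j < \<mu>" by simp
        have "s ^ (a * (\<mu> - j)) * \<bar>g s\<bar> ^ j = s ^ a * ((s ^ a) ^ (\<mu> - 1 - j) * \<bar>g s\<bar> ^ j)"
        proof -
          have "\<mu> - j = Suc (\<mu> - 1 - j)" using j by simp
          then show ?thesis by (simp add: power_mult[symmetric] power_add)
        qed
        also have "\<dots> \<le> s ^ a * (\<bar>g s\<bar> ^ (\<mu> - 1 - j) * \<bar>g s\<bar> ^ j)"
          using sg sa by (intro mult_left_mono mult_right_mono power_mono) auto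
        also have "\<dots> = s ^ a * \<bar>g s\<bar> ^ (\<mu> - 1)" using j by (simp flip: power_add)
        finally have "\<bar>poly (c j) s\<bar> * (s ^ (a * (\<mu> - j)) * \<bar>g s\<bar> ^ j) \<le> \<bar>poly (c j) s\<bar> * (s ^ a * \<bar>g s\<bar> ^ (\<mu> - 1))"
          by (rule mult_left_mono) simp
        moreover have "\<bar>poly (b j) s * g s ^ j\<bar> = \<bar>poly (c j) s\<bar> * (s ^ (a * (\<mu> - j)) * \<bar>g s\<bar> ^ j)"
          using elim by (simp add: c[OF j] poly_monom abs_mult power_abs)
        ultimately show "\<bar>poly (b j) s * g s ^ j\<bar> \<le> \<bar>poly (c j) s\<bar> * (s ^ a * \<bar>g s\<bar> ^ (\<mu> - 1))" by simp
      qed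
      also have "\<dots> = (\<Sum>j<\<mu>. \<bar>poly (c j) s\<bar>) * (s ^ a * \<bar>g s\<bar> ^ (\<mu> - 1))" by (simp add: sum_distrib_right)
      also have "\<dots> \<le> C * (s ^ a * \<bar>g s\<bar> ^ (\<mu> - 1))" using elim sa by (intro mult_right_mono) auto
      finally have "\<bar>g s\<bar> ^ \<mu> * \<bar>tl s\<bar> \<le> C * (s ^ a * \<bar>g s\<bar> ^ (\<mu> - 1))" .
      moreover have "\<bar>g s\<bar> ^ \<mu> = \<bar>g s\<bar> * \<bar>g s\<bar> ^ (\<mu> - 1)" using n by (cases \<mu>) auto
      ultimately have "(\<bar>g s\<bar> * \<bar>tl s\<bar>) * \<bar>g s\<bar> ^ (\<mu> - 1) \<le> (C * s ^ a) * \<bar>g s\<bar> ^ (\<mu> - 1)" by (simp add: mult_ac)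
      then have "\<bar>g s\<bar> * \<bar>tl s\<bar> \<le> C * s ^ a" using g0 by (simp add: mult_le_cancel_right)
      moreover have "\<bar>g s\<bar> * (A / 2) \<le> \<bar>g s\<bar> * \<bar>tl s\<bar>" using elim by (intro mult_left_mono) auto
      ultimately have "\<bar>g s\<bar> \<le> 2 * C / A * s ^ a" using A by (simp add: field_simps)
      also have "\<dots> \<le> K * s ^ a" using sa by (intro mult_right_mono) (auto simp: K_def)
      finally show False using gs by simp
    qed
  qed
  then show ?thesis by blast
qed

section \<open>Shifts and multiplicities for polynomials with polynomial coefficients\<close>

lemma coeff_pcompose_shift:
  fixes p :: "'a::comm_ring_1 poly"
  shows "coeff (pcompose p [:q, 1:]) n = (\<Sum>j\<le>degree p. coeff p j * of_nat (j choose n) * q ^ (j - n))"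
proof -
  have c: "coeff ([:q, 1:] ^ j) n = of_nat (j choose n) * q ^ (j - n)" for j
  proof (cases "n \<le> j")
    case True
    then show ?thesis using coeff_linear_poly_power[of n j q 1] by simp
  next
    case False
    have "degree ([:q, 1:] ^ j) \<le> j" using degree_power_le[of "[:q, 1:]" j] by simp
    then have "coeff ([:q, 1:] ^ j) n = 0" using False by (intro coeff_eq_0) simp
    then show ?thesis using False by (simp add: binomial_eq_0)
  qed
  have "p = (\<Sum>j\<le>degree p. smult (coeff p j) (monom 1 j))" 
    by (subst poly_as_sum_of_monoms[symmetric]) (simp add: smult_monom)
  then have "pcompose p [:q, 1:] = (\<Sum>j\<le>degree p. smult (coeff p j) (pcompose (monom 1 j) [:q, 1:]))"
    by (metis (no_types, lifting) pcompose_smult pcompose_sum sum.cong)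
  moreover have "pcompose (monom 1 j) [:q, 1:] = [:q, 1:] ^ j" for j
    by (induction j) (simp_all add: monom_Suc pcompose_pCons monom_0 algebra_simps pcompose_1 flip: one_pCons)
  ultimately show ?thesis by (simp add: coeff_sum c mult.assoc)
qed

lemma poly2_altdef: "poly2 p t y = (\<Sum>j\<le>degree p. poly (coeff p j) t * y ^ j)"
  by (simp add: poly2_def poly_altdef[of p] poly_sum poly_power)

lemma poly_poly: "poly (poly p r) t = poly2 p t (poly r t)"
  by (simp add: poly2_def poly_altdef[of p] poly_sum poly_power)

lemma poly2_shift: "poly2 (pcompose p [:q, 1:]) t y = poly2 p t (poly q t + y)"
proof -
  have "poly2 (pcompose p [:q, 1:]) t y = poly (poly p (q + [:y:])) t"
    by (simp add: poly2_def poly_pcompose)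
  then show ?thesis by (simp add: poly_poly)
qed

text \<open>At time 0 the specialised polynomial in \<open>y\<close> has 0 as a root of multiplicity
  exactly \<mu>.\<close>

definition root_mult :: "real poly poly \<Rightarrow> nat \<Rightarrow> bool" where
  "root_mult p \<mu> \<longleftrightarrow> (\<forall>j<\<mu>. poly (coeff p j) 0 = 0) \<and> poly (coeff p \<mu>) 0 \<noteq> 0"

lemma poly_coeff_shift:
  fixes p :: "real poly poly" shows
  "poly (coeff (pcompose p [:q, 1:]) n) t =
     (\<Sum>j\<le>degree p. poly (coeff p j) t * of_nat (j choose n) * poly q t ^ (j - n))"
  unfolding coeff_pcompose_shift by (simp add: poly_sum poly_power)

lemma root_mult_shift:
  assumes "root_mult p \<mu>" "poly q 0 = 0" shows "root_mult (pcompose p [:q, 1:]) \<mu>"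
proof -
  have "poly (coeff (pcompose p [:q, 1:]) n) 0 = poly (coeff p n) 0" for n
  proof -
    have "poly (coeff p j) 0 * of_nat (j choose n) * 0 ^ (j - n) = (if j = n then poly (coeff p n) 0 else 0)" for j
      by (cases j n rule: linorder_cases) (auto simp: binomial_eq_0)
    then have "poly (coeff (pcompose p [:q, 1:]) n) 0 = (\<Sum>j\<le>degree p. if j = n then poly (coeff p n) 0 else 0)"
      unfolding poly_coeff_shift assms(2) by simp
    also have "\<dots> = poly (coeff p n) 0" by (auto simp: coeff_eq_0 not_le)
    finally show ?thesis .
  qed
  then show ?thesis using assms by (simp add: root_mult_def)
qed

text \<open>The classical shift would divide by the coefficient of index \<mu>, which is only known
  to be nonzero at 0. Instead the shift is built up one power of the variable at a time, to any
  prescribed order.\<close>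

lemma tschirnhaus:
  assumes p: "root_mult p \<mu>" "\<mu> \<ge> 1"
  shows "\<exists>q. poly q 0 = 0 \<and> monom 1 (Suc M) dvd coeff (pcompose p [:q, 1:]) (\<mu> - 1)"
proof (induction M)
  case 0
  have "poly (coeff p (\<mu> - 1)) 0 = 0" using p by (simp add: root_mult_def)
  then show ?case by (intro exI[of _ 0]) (simp add: monom_1_dvd_iff' poly_0_coeff_0)
next
  case (Suc M)
  then obtain q where q: "poly q 0 = 0" "monom 1 (Suc M) dvd coeff (pcompose p [:q, 1:]) (\<mu> - 1)" by blast
  define P where "P = pcompose p [:q, 1:]"
  have P: "root_mult P \<mu>" unfolding P_def by (rule root_mult_shift[OF p(1) q(1)])
  obtain h where h: "coeff P (\<mu> - 1) = monom 1 (Suc M) * h" using q(2) by (auto simp: P_def elim: dvdE)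
  define A where "A = poly (coeff P \<mu>) 0"
  have A: "A \<noteq> 0" using P by (simp add: A_def root_mult_def)
  \<comment> \<open>Solves \<open>poly h 0 + of_nat \<mu> * d * A = 0\<close>, which raises the
    order of vanishing by one.\<close>
  define d where "d = - poly h 0 / (of_nat \<mu> * A)"
  define \<delta> where "\<delta> = monom d (Suc M)"
  have \<mu>n: "\<mu> \<le> degree P" using A by (intro le_degree) (auto simp: A_def)
  have "pcompose P [:\<delta>, 1:] = pcompose p [:q + \<delta>, 1:]"
    by (simp add: P_def pcompose_assoc[symmetric] pcompose_pCons)
  moreover have "monom 1 (Suc (Suc M)) dvd coeff (pcompose P [:\<delta>, 1:]) (\<mu> - 1)"
  proof -
    define T where "T j = coeff P j * of_nat (j choose (\<mu> - 1)) * \<delta> ^ (j - (\<mu> - 1))" for j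
    have "coeff (pcompose P [:\<delta>, 1:]) (\<mu> - 1) = (\<Sum>j\<le>degree P. T j)"
      by (simp add: coeff_pcompose_shift T_def)
    also have "\<dots> = (\<Sum>j\<in>{\<mu> - 1, \<mu>}. T j) + (\<Sum>j\<in>{..degree P} - {\<mu> - 1, \<mu>}. T j)"
      using \<mu>n by (subst sum.subset_diff[of "{\<mu> - 1, \<mu>}"]) auto
    also have "(\<Sum>j\<in>{\<mu> - 1, \<mu>}. T j) = monom 1 (Suc M) * (h + smult (of_nat \<mu> * d) (coeff P \<mu>))"
    proof -
      have "\<mu> choose (\<mu> - 1) = \<mu>" using p(2) by (metis Suc_diff_le binomial_Suc_n diff_Suc_1 One_nat_def)
      moreover have "\<mu> - (\<mu> - 1) = 1" "\<mu> - 1 \<noteq> \<mu>" using p(2) by auto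
      moreover have "\<delta> = smult d (monom 1 (Suc M))" by (simp add: \<delta>_def smult_monom)
      ultimately have "T \<mu> = monom 1 (Suc M) * smult (of_nat \<mu> * d) (coeff P \<mu>)"
        by (simp add: T_def of_nat_poly mult.commute)
      moreover have "T (\<mu> - 1) = monom 1 (Suc M) * h" by (simp add: T_def h[unfolded One_nat_def])
      ultimately show ?thesis using \<open>\<mu> - 1 \<noteq> \<mu>\<close> by (simp add: distrib_left)
    qed
    finally have e: "coeff (pcompose P [:\<delta>, 1:]) (\<mu> - 1) = monom 1 (Suc M) * (h + smult (of_nat \<mu> * d) (coeff P \<mu>)) +
       (\<Sum>j\<in>{..degree P} - {\<mu> - 1, \<mu>}. T j)" .
    have "poly (h + smult (of_nat \<mu> * d) (coeff P \<mu>)) 0 = 0"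
      using A p(2) by (simp add: d_def A_def)
    then have "monom 1 1 dvd h + smult (of_nat \<mu> * d) (coeff P \<mu>)" by (simp add: monom_1_dvd_iff' poly_0_coeff_0)
    then have "monom 1 (Suc M) * monom 1 1 dvd monom 1 (Suc M) * (h + smult (of_nat \<mu> * d) (coeff P \<mu>))"
      by (rule mult_dvd_mono[OF dvd_refl])
    then have d1: "monom 1 (Suc (Suc M)) dvd monom 1 (Suc M) * (h + smult (of_nat \<mu> * d) (coeff P \<mu>))"
      by (simp add: mult_monom)
    \<comment> \<open>Below \<mu> - 1 the binomial coefficient is zero; above \<mu> at least two
      factors \<delta> occur, each divisible by the power with exponent M + 1.\<close>
    have d2: "monom 1 (Suc (Suc M)) dvd T j" if "j \<in> {..degree P} - {\<mu> - 1, \<mu>}" for j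
    proof (cases "j < \<mu> - 1")
      case True
      then show ?thesis by (simp add: T_def binomial_eq_0)
    next
      case False
      then have "j \<ge> Suc \<mu>" using that by auto
      then have i: "j - (\<mu> - 1) = Suc (Suc (j - Suc \<mu>))" using p(2) by linarith
      have "monom 1 (Suc (Suc M)) dvd (monom 1 (Suc M) * monom 1 (Suc M) :: real poly)"
        by (simp add: mult_monom monom_1_dvd_iff')
      then have "monom 1 (Suc (Suc M)) dvd \<delta> * \<delta>" 
        by (simp add: \<delta>_def mult_monom monom_1_dvd_iff')
      then have "monom 1 (Suc (Suc M)) dvd \<delta> ^ (j - (\<mu> - 1))" unfolding i by (simp add: mult.assoc[symmetric])
      then show ?thesis unfolding T_def by (rule dvd_mult)
    qed
    show ?thesis unfolding e by (intro dvd_add d1 dvd_sum d2)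
  qed
  ultimately show ?case using q(1) by (intro exI[of _ "q + \<delta>"]) (simp add: \<delta>_def poly_monom)
qed

text \<open>After a Tschirnhaus shift the coefficient of index \<open>\<mu> - 1\<close> is negligible. The substitution
  \<open>t = s\<^bsup>k\<^esup>\<close>, \<open>y = s\<^bsup>a\<^esup> Y\<close> along the first edge of the Newton polygon then yields at \<open>s = 0\<close> a polynomial in
  \<open>Y\<close> of degree \<open>\<mu>\<close> that is not a pure power, so that all its roots have multiplicity less than \<open>\<mu>\<close>.
  Choosing \<open>k = \<mu>!\<close> makes the slope \<open>a\<close> an integer.\<close>

lemma puiseux_root_mult:
  assumes "root_mult p \<mu>" "\<mu> \<ge> 1" "tame f" "(f \<longlongrightarrow> 0) (at_right 0)"
    "\<forall>\<^sub>F s in at_right 0. poly2 p s (f s) = 0"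
  shows "puiseux f"
  using assms
proof (induction \<mu> arbitrary: p f rule: less_induct)
  case (less \<mu> p f)
  show ?case unfolding puiseux_def
  proof (intro allI)
    fix L :: nat
    define k :: nat where "k = fact \<mu>"
    have k1: "k \<ge> 1" by (simp add: k_def)
    obtain q where q: "poly q 0 = 0" "monom 1 (Suc L) dvd coeff (pcompose p [:q, 1:]) (\<mu> - 1)"
      using tschirnhaus[OF less.prems(1,2)] by blast
    define P where "P = pcompose p [:q, 1:]"
    define n where "n = degree P"
    have P: "root_mult P \<mu>" unfolding P_def by (rule root_mult_shift[OF less.prems(1) q(1)])
    have \<mu>n: "\<mu> \<le> n" unfolding n_def using P by (intro le_degree) (auto simp: root_mult_def)
    define b where "b j = pcompose (coeff P j) (monom 1 k)" for j
    have b0: "poly (b j) 0 = poly (coeff P j) 0" for j using k1 by (simp add: b_def poly_pcompose poly_monom power_0_left)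
    define g where "g s = f (s ^ k) - poly q (s ^ k)" for s
    \<comment> \<open>Order to which the coefficient of index \<mu> - 1 vanishes after both
      substitutions. It exceeds the wanted precision \<open>k * L\<close> by \<open>k\<close>, which
      absorbs a constant.\<close>
    define N where "N = k * Suc L"
    have lim_g: "(g \<longlongrightarrow> 0) (at_right 0)"
    proof -
      have "((\<lambda>s. f (s ^ k) - poly q (s ^ k)) \<longlongrightarrow> 0 - poly q 0) (at_right 0)"
        by (intro tendsto_diff filterlim_compose[OF less.prems(4) filterlim_power_at_right_0[OF k1]]
            filterlim_compose[OF poly_tendsto_at_right_0 filterlim_power_at_right_0[OF k1]])
      then show ?thesis by (simp add: g_def[abs_def] q(1))
    qed
    have root_g: "\<forall>\<^sub>F s in at_right 0. (\<Sum>j\<le>n. poly (b j) s * g s ^ j) = 0"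
      using eventually_power_at_right_0[OF k1 less.prems(5)]
    proof eventually_elim
      case (elim s)
      have "(\<Sum>j\<le>n. poly (b j) s * g s ^ j) = poly2 P (s ^ k) (g s)"
        by (simp add: poly2_altdef n_def b_def poly_pcompose poly_monom)
      also have "\<dots> = poly2 p (s ^ k) (f (s ^ k))" unfolding P_def poly2_shift by (simp add: g_def)
      finally show ?case using elim by simp
    qed
    have nzb: "poly (b \<mu>) 0 \<noteq> 0" using P by (simp add: b0 root_mult_def)
    \<comment> \<open>All points (j, order of \<open>b j\<close>) of the Newton polygon with j <
      \<mu> lie on or above the line of slope -a through (\<mu>, 0).\<close>
    define D where "D a \<longleftrightarrow> (\<forall>j<\<mu>. monom 1 (a * (\<mu> - j)) dvd b j)" for a
    have Kbound: "\<exists>K. \<forall>\<^sub>F s in at_right 0. \<bar>g s\<bar> \<le> K * s ^ a" if "D a" for a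
      using that by (intro newton_bound[OF lim_g \<mu>n less.prems(2) nzb _ root_g]) (auto simp: D_def)
    have b_fac: "b j = monom 1 (k * v) * pcompose u (monom 1 k)" if "coeff P j = monom 1 v * u" for j v u
    proof -
      have "pcompose (monom 1 v) (monom 1 k) = monom (1::real) (k * v)"
        by (induction v) (simp_all add: monom_Suc pcompose_pCons pcompose_1 monom_0 mult_monom add.commute flip: one_pCons)
      then show ?thesis by (simp add: b_def that pcompose_mult)
    qed
    show "\<exists>k\<ge>1. \<exists>q. \<forall>\<^sub>F s in at_right 0. \<bar>f (s ^ k) - poly q s\<bar> \<le> s ^ (k * L)"
    proof (cases "D N")
      case True
      then obtain K where K: "\<forall>\<^sub>F s in at_right 0. \<bar>g s\<bar> \<le> K * s ^ N" using Kbound by blast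
      have "((\<lambda>s. K * s ^ k) \<longlongrightarrow> K * 0 ^ k) (at_right 0)" by (intro tendsto_intros)
      then have "\<forall>\<^sub>F s in at_right 0. K * s ^ k < 1" by (rule order_tendstoD) (use k1 in \<open>simp add: power_0_left\<close>)
      then have "\<forall>\<^sub>F s in at_right 0. \<bar>f (s ^ k) - poly (pcompose q (monom 1 k)) s\<bar> \<le> s ^ (k * L)"
        using K eventually_at_right_0_pos
      proof eventually_elim
        case (elim s)
        have "\<bar>g s\<bar> \<le> (K * s ^ k) * s ^ (k * L)" using elim by (simp add: N_def power_add mult_ac)
        also have "\<dots> \<le> 1 * s ^ (k * L)" using elim by (intro mult_right_mono) auto
        finally show ?case by (simp add: g_def poly_pcompose poly_monom)
      qed
      then show ?thesis using k1 by blast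
    next
      case False
      have D1: "D 1" unfolding D_def
      proof (intro allI impI)
        fix j assume j: "j < \<mu>"
        have "monom 1 1 dvd coeff P j" using P j by (simp add: root_mult_def monom_1_dvd_iff' poly_0_coeff_0)
        then obtain u where "coeff P j = monom 1 1 * u" by (auto elim: dvdE)
        then have "b j = monom 1 (k * 1) * pcompose u (monom 1 k)" by (rule b_fac)
        moreover have "\<mu> - j \<le> k" using fact_ge_self[of \<mu>] by (simp add: k_def)
        then have "monom 1 (1 * (\<mu> - j)) dvd (monom 1 (k * 1) :: real poly)" by (simp add: monom_1_dvd_iff')
        ultimately show "monom 1 (1 * (\<mu> - j)) dvd b j" by simp
      qed
      \<comment> \<open>The largest integral \<open>a\<close> whose line still lies below the
        polygon.\<close>
      have "\<exists>a\<ge>1. D a \<and> \<not> D (Suc a) \<and> a < N"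
      proof (rule ccontr)
        assume *: "\<not> ?thesis"
        have "Suc i \<le> N \<Longrightarrow> D (Suc i)" for i
          by (induction i) (use D1 * in \<open>auto simp: Suc_le_eq\<close>)
        moreover have "N \<ge> 1" using k1 by (simp add: N_def)
        ultimately show False using False by (metis Suc_pred' less_eq_Suc_le order_refl One_nat_def)
      qed
      then obtain a where a: "a \<ge> 1" "D a" "\<not> D (Suc a)" "a < N" by blast
      then obtain j0 where j0: "j0 < \<mu>" "\<not> monom 1 (Suc a * (\<mu> - j0)) dvd b j0" by (auto simp: D_def)
      have "\<forall>j\<in>{..<\<mu>}. \<exists>c. b j = monom 1 (a * (\<mu> - j)) * c" using a(2) by (auto simp: D_def elim: dvdE)
      then obtain c where c: "\<And>j. j < \<mu> \<Longrightarrow> b j = monom 1 (a * (\<mu> - j)) * c j" by (metis lessThan_iff)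
      \<comment> \<open>The order of \<open>b j0\<close> is a multiple of \<open>k\<close>, hence of
        \<mu> - j0. It is at least a (\<mu> - j0) and less than (a + 1)(\<mu> - j0), so it equals
        the former: the point of index \<open>j0\<close> lies on the edge.\<close>
      have cj0: "poly (c j0) 0 \<noteq> 0"
      proof -
        have P0: "coeff P j0 \<noteq> 0" using j0(2) by (auto simp: b_def)
        define v where "v = Polynomial.order 0 (coeff P j0)"
        obtain u where u: "coeff P j0 = [:-0, 1:] ^ v * u" "\<not> [:-0, 1:] dvd u"
          using order_decomp[OF P0, of 0] unfolding v_def by blast
        have u': "coeff P j0 = monom 1 v * u" using u(1) by (simp add: monom_altdef)
        have u0: "poly u 0 \<noteq> 0" using u(2) by (simp add: poly_eq_0_iff_dvd)
        have bj: "b j0 = monom 1 (k * v) * pcompose u (monom 1 k)" by (rule b_fac[OF u'])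
        have bu: "poly (pcompose u (monom 1 k)) 0 \<noteq> 0"
          using u0 k1 by (simp add: poly_pcompose poly_monom power_0_left)
        have co: "coeff (b j0) i = (if i < k * v then 0 else coeff (pcompose u (monom 1 k)) (i - k * v))" for i
          unfolding bj by (simp add: coeff_monom_mult)
        have "monom 1 (a * (\<mu> - j0)) dvd b j0" using c[OF j0(1)] by simp
        then have "a * (\<mu> - j0) \<le> k * v"
          using bu co[of "k * v"] unfolding monom_1_dvd_iff' poly_0_coeff_0 by (metis diff_self_eq_0 less_irrefl not_le)
        moreover have "k * v < Suc a * (\<mu> - j0)"
        proof (rule ccontr)
          assume "\<not> ?thesis"
          then have "\<forall>i<Suc a * (\<mu> - j0). coeff (b j0) i = 0" unfolding co by auto
          then show False using j0(2) unfolding monom_1_dvd_iff' by blast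
        qed
        moreover obtain k' where "k = (\<mu> - j0) * k'"
          using dvd_fact[of "\<mu> - j0" \<mu>] j0(1) unfolding k_def by (auto simp: Suc_le_eq elim: dvdE)
        ultimately have "(\<mu> - j0) * a \<le> (\<mu> - j0) * (k' * v)" "(\<mu> - j0) * (k' * v) < (\<mu> - j0) * Suc a"
          by (simp_all add: mult_ac)
        then have "a \<le> k' * v" "k' * v < Suc a"
          using nat_mult_le_cancel1[of "\<mu> - j0"] nat_mult_less_cancel1[of "\<mu> - j0"] j0(1) by (metis zero_less_diff)+
        then have "k' * v = a" by simp
        then have kv: "k * v = a * (\<mu> - j0)" using \<open>k = (\<mu> - j0) * k'\<close> by (simp add: mult_ac)
        have "c j0 = pcompose u (monom 1 k)"
          using c[OF j0(1)] unfolding bj kv by (simp add: monom_eq_0_iff)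
        then show ?thesis using bu by simp
      qed
      \<comment> \<open>Since \<open>a < N\<close>, the point of index \<mu> - 1 lies strictly above
        the edge.\<close>
      have cm: "poly (c (\<mu> - 1)) 0 = 0"
      proof -
        obtain u where "coeff P (\<mu> - 1) = monom 1 (Suc L) * u" using q(2) by (auto simp: P_def elim: dvdE)
        then have "b (\<mu> - 1) = monom 1 N * pcompose u (monom 1 k)" unfolding N_def by (rule b_fac)
        moreover have "b (\<mu> - 1) = monom 1 a * c (\<mu> - 1)" using c[of "\<mu> - 1"] less.prems(2) by simp
        ultimately have "coeff (monom 1 a * c (\<mu> - 1)) a = coeff (monom 1 N * pcompose u (monom 1 k)) a" by simp
        then show ?thesis using a(4) by (simp add: coeff_monom_mult poly_0_coeff_0)
      qed
      define Y where "Y s = (f (s ^ k) - poly (pcompose q (monom 1 k)) s) / s ^ a" for s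
      have Yg: "Y s = g s / s ^ a" for s by (simp add: Y_def g_def poly_pcompose poly_monom)
      have tY: "tame Y" unfolding Y_def by (rule tame_transform[OF less.prems(3) k1])
      obtain K where K: "\<forall>\<^sub>F s in at_right 0. \<bar>g s\<bar> \<le> K * s ^ a" using Kbound[OF a(2)] by blast
      have "\<forall>\<^sub>F s in at_right 0. \<bar>Y s\<bar> \<le> K"
        using K eventually_at_right_0_pos by eventually_elim (simp add: Yg divide_le_eq)
      then obtain y0 where y0: "(Y \<longlongrightarrow> y0) (at_right 0)" using tame_bounded_tendsto[OF tY] by blast
      \<comment> \<open>Coefficients of the equation for \<open>Y\<close> after division by s^(a
        \<mu>).\<close>
      define d where "d j = (if j < \<mu> then c j else b j * monom 1 (a * (j - \<mu>)))" for j
      define R where "R = (\<Sum>j\<le>n. monom (d j) j)"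
      have cR: "coeff R j = (if j \<le> n then d j else 0)" for j by (simp add: R_def coeff_sum if_distrib cong: if_cong)
      have R2: "poly2 R s y = (\<Sum>j\<le>n. poly (d j) s * y ^ j)" for s y
        by (simp add: R_def poly2_def poly_sum poly_monom poly_power)
      have rootY: "\<forall>\<^sub>F s in at_right 0. poly2 R s (Y s) = 0"
        using root_g eventually_at_right_0_pos
      proof eventually_elim
        case (elim s)
        have "poly (b j) s * g s ^ j = s ^ (a * \<mu>) * (poly (d j) s * Y s ^ j)" for j
        proof -
          have g: "g s = s ^ a * Y s" using elim by (simp add: Yg)
          show ?thesis
          proof (cases "j < \<mu>")
            case True
            have "a * (\<mu> - j) + a * j = a * \<mu>" using True by (simp flip: distrib_left)
            then have "s ^ (a * \<mu>) = s ^ (a * (\<mu> - j)) * (s ^ a) ^ j" by (simp flip: power_add power_mult)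
            then show ?thesis using True by (simp add: g d_def c poly_monom power_mult_distrib mult_ac)
          next
            case False
            have "a * \<mu> + a * (j - \<mu>) = a * j" using False by (simp flip: distrib_left)
            then have "(s ^ a) ^ j = s ^ (a * \<mu>) * s ^ (a * (j - \<mu>))" by (simp flip: power_add power_mult)
            then show ?thesis using False by (simp add: g d_def poly_monom power_mult_distrib mult_ac)
          qed
        qed
        then have "s ^ (a * \<mu>) * poly2 R s (Y s) = 0" using elim unfolding R2 sum_distrib_left by simp
        then show ?case using elim by simp
      qed
      define R0 where "R0 = (\<Sum>j\<le>\<mu>. monom (poly (d j) 0) j)"
      have cR0: "coeff R0 j = (if j \<le> \<mu> then poly (d j) 0 else 0)" for j by (simp add: R0_def coeff_sum if_distrib cong: if_cong)
      have d0: "poly (d j) 0 = 0" if "j > \<mu>" for j using that a(1) by (simp add: d_def poly_monom power_0_left)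
      have cRR0: "poly (coeff R j) 0 = coeff R0 j" for j using \<mu>n d0 by (auto simp: cR cR0)
      have degR0: "degree R0 = \<mu>"
        using nzb by (intro antisym degree_le le_degree) (auto simp: cR0 d_def poly_monom)
      have R0R: "poly R0 y = poly2 R 0 y" for y
      proof -
        have "poly2 R 0 y = (\<Sum>j\<le>n. poly (d j) 0 * y ^ j)" by (rule R2)
        also have "\<dots> = (\<Sum>j\<le>\<mu>. poly (d j) 0 * y ^ j)"
          using \<mu>n d0 by (intro sum.mono_neutral_right) auto
        finally show ?thesis by (simp add: R0_def poly_sum poly_monom)
      qed
      have "((\<lambda>s. poly2 R s (Y s)) \<longlongrightarrow> poly2 R 0 y0) (at_right 0)"
        unfolding R2 by (intro tendsto_intros poly_tendsto_at_right_0 y0)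
      moreover have "((\<lambda>s. poly2 R s (Y s)) \<longlongrightarrow> 0) (at_right 0)"
        using rootY by (simp add: tendsto_eventually)
      ultimately have root0: "poly R0 y0 = 0" unfolding R0R by (rule tendsto_unique[rotated]) simp
      have R00: "R0 \<noteq> 0" using degR0 less.prems(2) by auto
      define \<mu>' where "\<mu>' = Polynomial.order y0 R0"
      have \<mu>'1: "\<mu>' \<ge> 1" using root0 R00 by (simp add: \<mu>'_def order_root Suc_le_eq)
      obtain U where U: "R0 = [:-y0, 1:] ^ \<mu>' * U" "\<not> [:-y0, 1:] dvd U"
        using order_decomp[OF R00] unfolding \<mu>'_def by blast
      have "\<mu>' \<le> \<mu>" using order_degree[OF R00, of y0] by (simp add: \<mu>'_def degR0)
      \<comment> \<open>A multiple of a pure power of Y - y0 without a term of degree \<mu> - 1 has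
        y0 = 0, hence no lower terms at all, contrary to the one of index \<open>j0\<close>.\<close>
      moreover have "\<mu>' \<noteq> \<mu>"
      proof
        assume e: "\<mu>' = \<mu>"
        have U0: "U \<noteq> 0" using R00 U by auto
        then have "degree R0 = \<mu>' + degree U"
          unfolding U(1) by (subst degree_mult_eq) (auto simp: degree_linear_power)
        then have "degree U = 0" using degR0 e by simp
        then obtain A where A: "U = [:A:]" by (rule degree_eq_zeroE)
        then have "A \<noteq> 0" using U0 by auto
        have R0c: "coeff R0 i = A * (of_nat (\<mu> choose i) * (-y0) ^ (\<mu> - i))" if "i \<le> \<mu>" for i
          unfolding U(1) A e using coeff_linear_poly_power[OF that, of "-y0" 1] by simp
        have "coeff R0 (\<mu> - 1) = 0" using cm less.prems(2) by (simp add: cR0 d_def)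
        then have "y0 = 0" using R0c[of "\<mu> - 1"] less.prems(2) \<open>A \<noteq> 0\<close> by (auto simp: binomial_eq_0_iff)
        then have "coeff R0 j0 = 0" using R0c[of j0] j0(1) by simp
        then show False using cj0 j0(1) by (simp add: cR0 d_def)
      qed
      ultimately have lt: "\<mu>' < \<mu>" by simp
      define S where "S = pcompose R [:[:y0:], 1:]"
      have S0: "poly (coeff S i) 0 = coeff (pcompose R0 [:y0, 1:]) i" for i
      proof -
        have "degree R0 \<le> degree R"
        proof (rule le_degree)
          have "poly (coeff R (degree R0)) 0 \<noteq> 0" using cRR0[of "degree R0"] R00 by simp
          then show "coeff R (degree R0) \<noteq> 0" by auto
        qed
        then show ?thesis
          unfolding S_def poly_coeff_shift unfolding coeff_pcompose_shift cRR0
          by (intro sum.mono_neutral_cong_right) (auto simp: coeff_eq_0)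
      qed
      have "pcompose R0 [:y0, 1:] = monom 1 \<mu>' * pcompose U [:y0, 1:]"
      proof -
        have "pcompose ([:-y0, 1:] ^ i) [:y0, 1:] = monom 1 i" for i
        proof (induction i)
          case (Suc i)
          have "pcompose [:-y0, 1:] [:y0, 1:] = monom 1 1" by (simp add: pcompose_pCons monom_altdef)
          then show ?case unfolding power_Suc pcompose_mult Suc.IH by (simp add: mult_monom)
        qed (simp add: pcompose_1)
        then show ?thesis by (subst U(1)) (simp add: pcompose_mult)
      qed
      moreover have "poly (pcompose U [:y0, 1:]) 0 \<noteq> 0" using U(2) by (simp add: poly_pcompose poly_eq_0_iff_dvd)
      ultimately have rS: "root_mult S \<mu>'"
        unfolding root_mult_def S0 by (simp add: coeff_monom_mult poly_0_coeff_0)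
      have lim: "((\<lambda>s. Y s - y0) \<longlongrightarrow> 0) (at_right 0)" using y0 by (rule LIM_zero)
      have "tame (\<lambda>s. Y s - y0)" using tame_transform[OF tY, of 1 "[:y0:]" 0] by simp
      moreover have "\<forall>\<^sub>F s in at_right 0. poly2 S s (Y s - y0) = 0"
        using rootY by eventually_elim (simp add: S_def poly2_shift)
      ultimately have "puiseux (\<lambda>s. Y s - y0)" using less.IH[OF lt rS \<mu>'1 _ lim] by blast
      then obtain k2 q2 where k2: "k2 \<ge> 1" "\<forall>\<^sub>F s in at_right 0. \<bar>Y (s ^ k2) - y0 - poly q2 s\<bar> \<le> s ^ (k2 * (k * L))"
        unfolding puiseux_def by blast
      \<comment> \<open>Undoes both substitutions. The induction hypothesis was used with precision
        \<open>k * L\<close>, so that the exponents fit the ramification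
        \<open>k2 * k\<close>.\<close>
      define q3 where "q3 = pcompose q (monom 1 (k2 * k)) + monom 1 (k2 * a) * ([:y0:] + q2)"
      have "\<forall>\<^sub>F s in at_right 0. \<bar>f (s ^ (k2 * k)) - poly q3 s\<bar> \<le> s ^ (k2 * k * L)"
        using k2(2) eventually_at_right_0_pos eventually_at_right_0_less[of 1, simplified]
      proof eventually_elim
        case (elim s)
        have "f (s ^ (k2 * k)) = poly q (s ^ (k2 * k)) + s ^ (k2 * a) * Y (s ^ k2)"
          using elim by (simp add: Y_def poly_pcompose poly_monom flip: power_mult)
        then have "f (s ^ (k2 * k)) - poly q3 s = s ^ (k2 * a) * (Y (s ^ k2) - y0 - poly q2 s)"
          by (simp add: q3_def poly_pcompose poly_monom algebra_simps)
        then have "\<bar>f (s ^ (k2 * k)) - poly q3 s\<bar> = s ^ (k2 * a) * \<bar>Y (s ^ k2) - y0 - poly q2 s\<bar>"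
          using elim by (simp add: abs_mult)
        also have "\<dots> \<le> 1 * s ^ (k2 * (k * L))"
          using elim by (intro mult_mono) (auto intro: power_le_one)
        finally show ?case by (simp add: mult_ac)
      qed
      moreover have "k2 * k \<ge> 1" using k1 k2(1) by simp
      ultimately show ?thesis by blast
    qed
  qed
qed

text \<open>Powers of the variable common to all coefficients are divided out, which lowers the
  degree of the leading coefficient. Then \<open>G\<close> does not vanish identically at time 0,
  and subtracting the limit of \<open>f\<close> puts the root at 0 with a positive finite
  multiplicity.\<close>

theorem puiseux_algebraic:
  assumes f: "tame f" "\<forall>\<^sub>F s in at_right 0. \<bar>f s\<bar> \<le> B"
    and G: "G \<noteq> 0" "\<forall>\<^sub>F s in at_right 0. poly2 G s (f s) = 0"
  shows "puiseux f"
  using G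
proof (induction "degree (lead_coeff G)" arbitrary: G rule: less_induct)
  case (less G)
  show ?case
  proof (cases "\<forall>j. poly (coeff G j) 0 = 0")
    case True
    then have "\<forall>j. [:0, 1:] dvd coeff G j" using poly_eq_0_iff_dvd[of _ "0::real"] by simp
    then have "[:[:0, 1:]:] dvd G" by (subst const_poly_dvd_iff) auto
    then obtain H where H: "G = [:[:0, 1:]:] * H" by (auto elim: dvdE)
    then have "H \<noteq> 0" using less.prems by auto
    then have "degree (lead_coeff H) < degree (lead_coeff G)" by (simp add: H degree_pCons_eq)
    moreover have "\<forall>\<^sub>F s in at_right 0. poly2 H s (f s) = 0"
      using less.prems(2) eventually_at_right_0_pos unfolding H poly2_simps by eventually_elim simp
    ultimately show ?thesis using less.hyps \<open>H \<noteq> 0\<close> by blast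
  next
    case False
    then obtain j where j: "poly (coeff G j) 0 \<noteq> 0" by blast
    obtain c where c: "(f \<longlongrightarrow> c) (at_right 0)" using tame_bounded_tendsto[OF f] by blast
    have "((\<lambda>s. poly2 G s (f s)) \<longlongrightarrow> poly2 G 0 c) (at_right 0)"
      unfolding poly2_altdef by (intro tendsto_intros poly_tendsto_at_right_0 c)
    moreover have "((\<lambda>s. poly2 G s (f s)) \<longlongrightarrow> 0) (at_right 0)" using less.prems(2) by (simp add: tendsto_eventually)
    ultimately have G0: "poly2 G 0 c = 0" by (rule tendsto_unique[rotated]) simp
    define S where "S = pcompose G [:[:c:], 1:]"
    have S2: "poly2 S s y = poly2 G s (c + y)" for s y by (simp add: S_def poly2_shift)
    have "\<exists>i. poly (coeff S i) 0 \<noteq> 0"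
    proof (rule ccontr)
      assume "\<not> ?thesis"
      then have "poly2 S 0 (y - c) = 0" for y by (simp add: poly2_altdef)
      then have z: "poly2 G 0 y = 0" for y by (simp add: S2)
      define H where "H = (\<Sum>i\<le>degree G. monom (poly (coeff G i) 0) i)"
      have "poly H y = 0" for y using z[of y] by (simp add: H_def poly2_altdef poly_sum poly_monom)
      then have "H = 0" using poly_all_0_iff_0 by blast
      moreover have "j \<le> degree G" using j by (intro le_degree) auto
      then have "coeff H j = poly (coeff G j) 0" by (simp add: H_def coeff_sum if_distrib cong: if_cong)
      ultimately show False using j by simp
    qed
    then have rm: "root_mult S (LEAST i. poly (coeff S i) 0 \<noteq> 0)"
      unfolding root_mult_def by (metis (mono_tags, lifting) LeastI_ex not_less_Least)
    have "poly (coeff S 0) 0 = poly2 S 0 0" by (simp add: poly2_def poly_0_coeff_0)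
    then have "poly (coeff S 0) 0 = 0" by (simp add: S2 G0)
    then have "(LEAST i. poly (coeff S i) 0 \<noteq> 0) \<noteq> 0" using rm by (metis root_mult_def)
    moreover have "tame (\<lambda>s. f s - c)" using tame_transform[OF f(1), of 1 "[:c:]" 0] by simp
    moreover have "\<forall>\<^sub>F s in at_right 0. poly2 S s (f s - c) = 0" using less.prems(2) by (simp add: S2)
    ultimately have pu: "puiseux (\<lambda>s. f s - c)"
      using puiseux_root_mult[OF rm] LIM_zero[OF c] by (simp add: Suc_le_eq)
    show ?thesis unfolding puiseux_def
    proof
      fix L
      obtain k q where k: "k \<ge> 1" "\<forall>\<^sub>F s in at_right 0. \<bar>f (s ^ k) - c - poly q s\<bar> \<le> s ^ (k * L)"
        using pu unfolding puiseux_def by blast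
      have "\<forall>\<^sub>F s in at_right 0. \<bar>f (s ^ k) - poly ([:c:] + q) s\<bar> \<le> s ^ (k * L)"
        using k(2) by eventually_elim (simp add: diff_diff_eq)
      then show "\<exists>k\<ge>1. \<exists>q. \<forall>\<^sub>F s in at_right 0. \<bar>f (s ^ k) - poly q s\<bar> \<le> s ^ (k * L)" using k(1) by blast
    qed
  qed
qed

text \<open>A Lojasiewicz inequality. If the constant term \<open>a\<close> in \<open>y\<close> is
  zero, divide by \<open>y\<close>. Otherwise the equation bounds |a(s)| by a constant times
  \<open>r s\<close>, while |a(s)| is of the order of a power of \<open>s\<close>; one more power
  absorbs the constants.\<close>

lemma algebraic_lower_bound:
  assumes G: "G \<noteq> 0" "\<forall>\<^sub>F s in at_right 0. poly2 G s (r s) = 0"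
    and r: "\<forall>\<^sub>F s in at_right 0. 0 < r s \<and> r s \<le> 1"
  shows "\<exists>L. \<forall>\<^sub>F s in at_right 0. s ^ L \<le> r s"
  using G
proof (induction G rule: pCons_induct)
  case (pCons a G)
  have p2: "poly2 (pCons a G) s y = poly a s + y * poly2 G s y" for s y
    by (simp add: poly2_def)
  show ?case
  proof (cases "a = 0")
    case True
    have "\<forall>\<^sub>F s in at_right 0. poly2 G s (r s) = 0"
      using pCons.prems(2)[unfolded p2] r by eventually_elim (simp add: True)
    then show ?thesis using pCons True by auto
  next
    case False
    define v where "v = Polynomial.order 0 a"
    obtain u where u: "a = [:-0, 1:] ^ v * u" "\<not> [:-0, 1:] dvd u"
      using order_decomp[OF False, of 0] unfolding v_def by blast
    have u': "a = monom 1 v * u" using u(1) by (simp add: monom_altdef)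
    have u0: "poly u 0 \<noteq> 0" using u(2) by (simp add: poly_eq_0_iff_dvd)
    define C where "C = 1 + (\<Sum>j\<le>degree G. \<bar>poly (coeff G j) 0\<bar>)"
    have "((\<lambda>s. \<Sum>j\<le>degree G. \<bar>poly (coeff G j) s\<bar>) \<longlongrightarrow> (\<Sum>j\<le>degree G. \<bar>poly (coeff G j) 0\<bar>)) (at_right 0)"
      by (intro tendsto_intros poly_tendsto_at_right_0)
    then have ev1: "\<forall>\<^sub>F s in at_right 0. (\<Sum>j\<le>degree G. \<bar>poly (coeff G j) s\<bar>) < C"
      by (rule order_tendstoD) (simp add: C_def)
    have C: "C > 0" by (auto simp: C_def intro!: add_pos_nonneg sum_nonneg)
    have "((\<lambda>s. \<bar>poly u s\<bar> - s * C) \<longlongrightarrow> \<bar>poly u 0\<bar> - 0 * C) (at_right 0)"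
      by (intro tendsto_intros poly_tendsto_at_right_0)
    then have ev2: "\<forall>\<^sub>F s in at_right 0. 0 < \<bar>poly u s\<bar> - s * C"
      by (rule order_tendstoD) (use u0 in simp)
    have "\<forall>\<^sub>F s in at_right 0. s ^ (Suc v) \<le> r s"
      using pCons.prems(2) r ev1 ev2 eventually_at_right_0_pos
    proof eventually_elim
      case (elim s)
      have "\<bar>poly2 G s (r s)\<bar> \<le> (\<Sum>j\<le>degree G. \<bar>poly (coeff G j) s\<bar>)"
        unfolding poly2_altdef
      proof (rule order_trans[OF sum_abs], rule sum_mono)
        fix j
        have "\<bar>r s\<bar> ^ j \<le> 1" using elim by (intro power_le_one) auto
        then show "\<bar>poly (coeff G j) s * r s ^ j\<bar> \<le> \<bar>poly (coeff G j) s\<bar>"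
          by (simp add: abs_mult power_abs mult_left_le)
      qed
      then have b: "\<bar>poly2 G s (r s)\<bar> \<le> C" using elim by simp
      have "poly a s = - (r s * poly2 G s (r s))" using elim(1) by (simp add: p2)
      then have "\<bar>poly a s\<bar> = r s * \<bar>poly2 G s (r s)\<bar>" using elim by (simp add: abs_mult)
      also have "\<dots> \<le> r s * C" using elim b by (intro mult_left_mono) auto
      finally have "s ^ v * \<bar>poly u s\<bar> \<le> r s * C" using elim by (simp add: u' poly_monom abs_mult)
      moreover have "s ^ v * (s * C) \<le> s ^ v * \<bar>poly u s\<bar>" using elim by (intro mult_left_mono) auto
      ultimately have "s ^ Suc v * C \<le> r s * C" by (simp add: mult_ac)
      then show ?case using C by simp
    qed
    then show ?thesis by blast
  qed
qed simp

section \<open>Curve selection for bricks\<close>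

lemma eventually_ball_finiteI:
  "finite I \<Longrightarrow> (\<And>i. i \<in> I \<Longrightarrow> \<forall>\<^sub>F s in F. P i s) \<Longrightarrow> \<forall>\<^sub>F s in F. \<forall>i\<in>I. P i s"
  by (simp add: eventually_ball_finite_distrib)

text \<open>Substituting a further power multiplies exponent and precision alike, so ramifications
  can be multiplied together.\<close>

lemma puiseux_common:
  fixes f :: "'i \<Rightarrow> real \<Rightarrow> real"
  assumes "finite I" "\<And>i. i \<in> I \<Longrightarrow> puiseux (f i)"
  shows "\<exists>k\<ge>1. \<exists>q. \<forall>i\<in>I. \<forall>\<^sub>F s in at_right 0. \<bar>f i (s ^ k) - poly (q i) s\<bar> \<le> s ^ (k * L)"
  using assms
proof (induction I rule: finite_induct)
  case empty
  then show ?case by auto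
next
  case (insert a I)
  then obtain k q where k: "k \<ge> 1"
    "\<And>i. i \<in> I \<Longrightarrow> \<forall>\<^sub>F s in at_right 0. \<bar>f i (s ^ k) - poly (q i) s\<bar> \<le> s ^ (k * L)" by blast
  have "puiseux (f a)" using insert.prems by simp
  then obtain k' q' where k': "k' \<ge> 1"
    "\<forall>\<^sub>F s in at_right 0. \<bar>f a (s ^ k') - poly q' s\<bar> \<le> s ^ (k' * L)"
    unfolding puiseux_def by blast
  define r where "r i = (if i = a then pcompose q' (monom 1 k) else pcompose (q i) (monom 1 k'))" for i
  have "\<forall>\<^sub>F s in at_right 0. \<bar>f i (s ^ (k * k')) - poly (r i) s\<bar> \<le> s ^ (k * k' * L)"
    if "i \<in> insert a I" for i
  proof (cases "i = a")
    case True
    show ?thesis using eventually_power_at_right_0[OF k(1) k'(2)]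
      by eventually_elim (simp add: r_def True poly_pcompose poly_monom power_mult)
  next
    case False
    then have "i \<in> I" using that by simp
    have e: "k * k' = k' * k" by simp
    show ?thesis using eventually_power_at_right_0[OF k'(1) k(2)[OF \<open>i \<in> I\<close>]] unfolding e
      by eventually_elim (simp add: r_def False poly_pcompose poly_monom power_mult)
  qed
  moreover have "k * k' \<ge> 1" using k(1) k'(1) by simp
  ultimately show ?case by blast
qed

lemma pfun_poly: "pfun p \<Longrightarrow> pfun (\<lambda>e. poly c (p e))"
  unfolding poly_altdef by (intro pfun_intros)

text \<open>A definable choice over the time gives coordinate functions that are tame and algebraic,
  hence have Puiseux expansions. The exponent \<open>L\<close> bounding the radius from below is
  found first, and the expansions are then taken to the next order, so that the truncation error is
  small against the radius.\<close>

theorem curve_selection: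
  fixes W :: "('v \<Rightarrow> real) \<Rightarrow> bool"
  assumes W: "sa W" and I: "finite I" and v: "T \<notin> I" "Z \<notin> I" "T \<noteq> Z" "R \<in> I"
    and Z: "\<And>e x. W (e(Z := x)) = W e"
    and B: "\<And>e i. W e \<Longrightarrow> i \<in> I \<Longrightarrow> \<bar>e i\<bar> \<le> B"
    and Rpos: "\<And>e. W e \<Longrightarrow> 0 < e R \<and> e R \<le> 1"
    and ne: "\<forall>\<^sub>F t in at_right 0. \<exists>e. W e \<and> (\<forall>j. j \<notin> I \<longrightarrow> e j = ((\<lambda>_. 0)(T := t)) j)"
  shows "\<exists>k\<ge>1. \<exists>L q. \<forall>\<^sub>F s in at_right 0. \<exists>e. W e \<and> e T = s ^ k \<and> s ^ (k * L) \<le> e R \<and>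
      (\<forall>i\<in>I. \<bar>e i - poly (q i) s\<bar> \<le> s ^ (k * Suc L))"
proof -
  obtain \<sigma> where \<sigma>: "sa_map \<sigma>" "\<And>e j. j \<notin> I \<Longrightarrow> \<sigma> e j = e j"
    "\<And>e e'. (\<forall>j. j \<notin> I \<longrightarrow> e' j = e j) \<Longrightarrow> W e' \<Longrightarrow> W (\<sigma> e)"
    "\<And>z e x. z \<notin> I \<Longrightarrow> (\<And>e x. W (e(z := x)) = W e) \<Longrightarrow> \<sigma> (e(z := x)) = (\<sigma> e)(z := x)"
    by (rule exE[OF sa_choice[OF I W]], erule (1) B, blast)
  define env where "env t = (\<lambda>_. 0 :: real)(T := t)" for t
  define f where "f i t = \<sigma> (env t) i" for i t
  have fZ: "\<sigma> ((env t)(Z := x)) i = f i t" if "i \<in> I" for i t x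
  proof -
    have "\<sigma> ((env t)(Z := x)) = (\<sigma> (env t))(Z := x)" using \<sigma>(4)[OF v(2)] Z by blast
    then show ?thesis using that v(2) by (auto simp: f_def)
  qed
  have Wf: "\<forall>\<^sub>F t in at_right 0. W (\<sigma> (env t))"
    using ne by eventually_elim (use \<sigma>(3) in \<open>auto simp: env_def\<close>)
  have tame: "tame (f i)" if i: "i \<in> I" for i
    unfolding tame_def
  proof (intro allI impI)
    fix k r :: nat and b assume "k \<ge> 1"
    \<comment> \<open>The spare variable \<open>Z\<close> holds s while the time holds s^k. The
      comparison of s^r f(s^k) with b(s) thus becomes a definable condition in one variable.\<close>
    define \<tau> where "\<tau> e = (env (e Z ^ k))(Z := e Z)" for e :: "'v \<Rightarrow> real"
    have "pfun (\<lambda>e. \<tau> e j)" for j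
      unfolding \<tau>_def env_def fun_upd_def by (intro pfun_if_const pfun_intros)
    then have "sa_map \<tau>" by (rule sa_map_pfun)
    moreover have "sa (\<lambda>e. poly b (e Z) < e Z ^ r * e i)" by (intro sa_less pfun_intros pfun_poly)
    ultimately have "sa (\<lambda>e. poly b (\<sigma> (\<tau> e) Z) < \<sigma> (\<tau> e) Z ^ r * \<sigma> (\<tau> e) i)"
      using sa_mapD[OF _ sa_mapD[OF \<sigma>(1)]] by blast
    moreover have "\<sigma> (\<tau> e) Z = e Z" "\<sigma> (\<tau> e) i = f i (e Z ^ k)" for e
      using \<sigma>(2)[OF v(2)] fZ[OF i] by (simp_all add: \<tau>_def)
    ultimately have "sa (\<lambda>e. poly b (e Z) < e Z ^ r * f i (e Z ^ k))" by simp
    from sa_decided_at_right[OF this, of "\<lambda>_. 0" Z 0]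
    show "(\<forall>\<^sub>F s in at_right 0. poly b s < s ^ r * f i (s ^ k)) \<or>
      (\<forall>\<^sub>F s in at_right 0. \<not> poly b s < s ^ r * f i (s ^ k))" by simp
  qed
  have alg: "\<exists>G. G \<noteq> 0 \<and> (\<forall>\<^sub>F t in at_right 0. poly2 G t (f i t) = 0)" if i: "i \<in> I" for i
  proof -
    \<comment> \<open>Composed with \<sigma> this describes the graph of \<open>f i\<close>, the
      value being held by the spare variable.\<close>
    have "sa (\<lambda>e. e Z = e i)" by (intro sa_eq pfun_intros)
    from sa_mapD[OF \<sigma>(1) this] have "sa (\<lambda>e. \<sigma> e Z = \<sigma> e i)" .
    from sa_graph_algebraic[OF this v(3), of "\<lambda>_. 0"]
    obtain G where G: "G \<noteq> 0" "\<And>t y. (\<forall>z. (\<sigma> ((env t)(Z := z)) Z = \<sigma> ((env t)(Z := z)) i) = (z = y)) \<Longrightarrow> poly2 G t y = 0"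
      unfolding env_def by blast
    have "poly2 G t (f i t) = 0" for t
      by (rule G(2)) (use \<sigma>(2)[OF v(2)] fZ[OF i] in auto)
    then show ?thesis using G(1) by auto
  qed
  have bd: "\<forall>\<^sub>F t in at_right 0. \<bar>f i t\<bar> \<le> B" if i: "i \<in> I" for i
    using Wf by eventually_elim (use B i in \<open>auto simp: f_def\<close>)
  have pu: "puiseux (f i)" if "i \<in> I" for i
    using puiseux_algebraic[OF tame bd] alg that by blast
  have "\<exists>L. \<forall>\<^sub>F s in at_right 0. s ^ L \<le> f R s"
  proof -
    obtain G where "G \<noteq> 0" "\<forall>\<^sub>F t in at_right 0. poly2 G t (f R t) = 0" using alg[OF v(4)] by blast
    moreover have "\<forall>\<^sub>F t in at_right 0. 0 < f R t \<and> f R t \<le> 1"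
      using Wf by eventually_elim (use Rpos in \<open>auto simp: f_def\<close>)
    ultimately show ?thesis by (rule algebraic_lower_bound)
  qed
  then obtain L where L: "\<forall>\<^sub>F s in at_right 0. s ^ L \<le> f R s" by blast
  obtain k q where k: "k \<ge> 1" and q: "\<forall>i\<in>I. \<forall>\<^sub>F s in at_right 0. \<bar>f i (s ^ k) - poly (q i) s\<bar> \<le> s ^ (k * Suc L)"
    using puiseux_common[OF I, of f "Suc L"] pu by blast
  have q': "\<forall>\<^sub>F s in at_right 0. \<forall>i\<in>I. \<bar>f i (s ^ k) - poly (q i) s\<bar> \<le> s ^ (k * Suc L)"
    using q I by (intro eventually_ball_finiteI) auto
  have "\<forall>\<^sub>F s in at_right 0. \<exists>e. W e \<and> e T = s ^ k \<and> s ^ (k * L) \<le> e R \<and>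
      (\<forall>i\<in>I. \<bar>e i - poly (q i) s\<bar> \<le> s ^ (k * Suc L))"
    using q' eventually_power_at_right_0[OF k L] eventually_power_at_right_0[OF k Wf]
  proof eventually_elim
    case (elim s)
    show ?case
      by (rule exI[of _ "\<sigma> (env (s ^ k))"])
        (use elim \<sigma>(2)[OF v(1)] in \<open>auto simp: f_def env_def power_mult\<close>)
  qed
  then show ?thesis using k by blast
qed

section \<open>Polynomial maps given by their coefficients\<close>

definition monomial :: "('m::finite \<Rightarrow> nat) \<Rightarrow> real^'m \<Rightarrow> real" where
  "monomial \<alpha> x = (\<Prod>j\<in>UNIV. (x $ j) ^ \<alpha> j)"

definition coeff_map :: "('m::finite \<Rightarrow> nat) set \<Rightarrow> (('m \<Rightarrow> nat) \<Rightarrow> 'n \<Rightarrow> real) \<Rightarrow> real^'m \<Rightarrow> real^'n" where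
  "coeff_map A a x = (\<chi> i. \<Sum>\<alpha>\<in>A. a \<alpha> i * monomial \<alpha> x)"

lemma abs_monomial_le_1: "x \<in> cball 0 1 \<Longrightarrow> \<bar>monomial \<alpha> x\<bar> \<le> 1"
  unfolding monomial_def abs_prod power_abs
  using component_le_norm_cart[of x] by (intro prod_le_1) (auto intro!: power_le_one intro: order_trans)

lemma continuous_on_coeff_map: "continuous_on X (coeff_map A a)"
  unfolding coeff_map_def monomial_def by (intro continuous_intros)

lemma dist_coeff_map_le:
  fixes a b :: "('m::finite \<Rightarrow> nat) \<Rightarrow> 'n::finite \<Rightarrow> real" and d :: real
  assumes "x \<in> cball 0 1" "\<And>\<alpha> i. \<alpha> \<in> A \<Longrightarrow> \<bar>a \<alpha> i - b \<alpha> i\<bar> \<le> d"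
  shows "dist (coeff_map A a x) (coeff_map A b x) \<le> real CARD('n) * real (card A) * d"
proof -
  have "dist (coeff_map A a x) (coeff_map A b x) \<le> (\<Sum>i\<in>UNIV. \<bar>(coeff_map A a x - coeff_map A b x) $ i\<bar>)"
    unfolding dist_norm by (rule norm_le_l1_cart)
  also have "\<dots> \<le> (\<Sum>i\<in>(UNIV::'n set). real (card A) * d)"
  proof (rule sum_mono)
    fix i
    have "\<bar>(coeff_map A a x - coeff_map A b x) $ i\<bar> = \<bar>\<Sum>\<alpha>\<in>A. (a \<alpha> i - b \<alpha> i) * monomial \<alpha> x\<bar>"
      by (simp add: coeff_map_def sum_subtractf left_diff_distrib)
    also have "\<dots> \<le> (\<Sum>\<alpha>\<in>A. d)"
    proof (rule order_trans[OF sum_abs], rule sum_mono)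
      fix \<alpha> assume "\<alpha> \<in> A"
      then have "\<bar>a \<alpha> i - b \<alpha> i\<bar> * \<bar>monomial \<alpha> x\<bar> \<le> d * 1"
        using assms(2)[of \<alpha> i] abs_monomial_le_1[OF assms(1)] by (intro mult_mono) auto
      then show "\<bar>(a \<alpha> i - b \<alpha> i) * monomial \<alpha> x\<bar> \<le> d" by (simp add: abs_mult)
    qed
    finally show "\<bar>(coeff_map A a x - coeff_map A b x) $ i\<bar> \<le> real (card A) * d" by simp
  qed
  finally show ?thesis by simp
qed

lemma pfun_real_polynomial_function:
  fixes p :: "real^'n \<Rightarrow> real"
  assumes "real_polynomial_function p" "\<And>i. pfun (\<lambda>e. v e $ i)"
  shows "pfun (\<lambda>e. p (v e))"
  using assms(1)
proof (induction rule: real_polynomial_function.induct)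
  case (linear f)
  have "f (v e) = (\<Sum>i\<in>UNIV. v e $ i * f (axis i 1))" for e
  proof -
    have "f (v e) = f (\<Sum>i\<in>UNIV. v e $ i *\<^sub>R axis i 1)"
      by (metis (no_types, lifting) basis_expansion scalar_mult_eq_scaleR sum.cong)
    then show ?thesis using linear by (simp add: bounded_linear.linear linear_sum linear_scale)
  qed
  then show ?case by (simp add: pfun_sum pfun_mult pfun_const assms(2))
qed (auto intro: pfun_intros)

lemma sa_semialgebraic:
  fixes T :: "(real^'n) set"
  assumes "semialgebraic T" "\<And>i. pfun (\<lambda>e. v e $ i)"
  shows "sa (\<lambda>e. v e \<in> T)"
  using assms(1)
proof (induction rule: semialgebraic.induct)
  case (eq p)
  then show ?case using sa_eq[OF pfun_real_polynomial_function[of p v] pfun_const] assms(2) by simp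
next
  case (pos p)
  then show ?case using sa_pos[OF pfun_real_polynomial_function[of p v]] assms(2) by simp
next
  case (compl A)
  then show ?case using sa_not by simp
next
  case (union A B)
  then show ?case using sa_disj by simp
qed

text \<open>\<open>VAux\<close> is a spare variable, needed to compare the selected functions with arbitrary reals.\<close>

datatype ('m, 'n) brick_var = VTime | VAux | VRadius | VCoeff "'m \<Rightarrow> nat" 'n | VDom 'm | VCod 'n

text \<open>The components of the homotopy come with separate sets of exponents; padding with zero
  coefficients merges them, so that the map at each time is one family of coefficients.\<close>

lemma brick_homotopy:
  fixes T :: "(real^'n) set"
  assumes "brick TYPE('m::finite) T"
  obtains A :: "('m::finite \<Rightarrow> nat) set" and c :: "real \<Rightarrow> ('m \<Rightarrow> nat) \<Rightarrow> 'n \<Rightarrow> real" where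
    "finite A" "\<And>\<alpha> i. continuous_on {0..1} (\<lambda>t. c t \<alpha> i)"
    "coeff_map A (c 0) ` cball 0 1 = T"
    "\<And>t. t \<in> {0<..<1} \<Longrightarrow> coeff_map A (c t) ` cball 0 1 \<subseteq> interior T"
proof -
  obtain H :: "real \<times> (real^'m) \<Rightarrow> real^'n" where H:
    "\<And>i. restricts_C0_polynomial (\<lambda>z. H z $ i)" "H ` ({0} \<times> cball 0 1) = T"
    "\<And>t. t \<in> {0<..<1} \<Longrightarrow> H ` ({t} \<times> cball 0 1) \<subseteq> interior T"
    using assms unfolding brick_def by (elim conjE exE) (rule that; (assumption | erule spec | erule (1) bspec))
  have "\<forall>i. \<exists>A c. finite A \<and> (\<forall>\<alpha>\<in>A. continuous_on {0..1} (c \<alpha>)) \<and>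
        (\<forall>t\<in>{0..1}. \<forall>x\<in>cball 0 1. H (t, x) $ i = (\<Sum>\<alpha>\<in>A. c \<alpha> t * monomial \<alpha> x))"
  proof
    fix i
    show "\<exists>A c. finite A \<and> (\<forall>\<alpha>\<in>A. continuous_on {0..1} (c \<alpha>)) \<and>
        (\<forall>t\<in>{0..1}. \<forall>x\<in>cball 0 1. H (t, x) $ i = (\<Sum>\<alpha>\<in>A. c \<alpha> t * monomial \<alpha> x))"
      using H(1)[of i] unfolding restricts_C0_polynomial_def monomial_def .
  qed
  from choice[OF this] obtain A where "\<forall>i. \<exists>c. finite (A i) \<and> (\<forall>\<alpha>\<in>A i. continuous_on {0..1} (c \<alpha>)) \<and>
        (\<forall>t\<in>{0..1}. \<forall>x\<in>cball 0 1. H (t, x) $ i = (\<Sum>\<alpha>\<in>A i. c \<alpha> t * monomial \<alpha> x))" ..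
  from choice[OF this] obtain c where *: "\<forall>i. finite (A i) \<and> (\<forall>\<alpha>\<in>A i. continuous_on {0..1} (c i \<alpha>)) \<and>
        (\<forall>t\<in>{0..1}. \<forall>x\<in>cball 0 1. H (t, x) $ i = (\<Sum>\<alpha>\<in>A i. c i \<alpha> t * monomial \<alpha> x))" ..
  have A: "finite (A i)" "\<alpha> \<in> A i \<Longrightarrow> continuous_on {0..1} (c i \<alpha>)"
    "t \<in> {0..1} \<Longrightarrow> x \<in> cball 0 1 \<Longrightarrow> H (t, x) $ i = (\<Sum>\<alpha>\<in>A i. c i \<alpha> t * monomial \<alpha> x)" for i \<alpha> t x
    using spec[OF *, of i] by blast+
  define c' where "c' t \<alpha> i = (if \<alpha> \<in> A i then c i \<alpha> t else 0)" for t \<alpha> i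
  have fin: "finite (\<Union>i. A i)" using A(1) by simp
  have "continuous_on {0..1} (\<lambda>t. c' t \<alpha> i)" for \<alpha> i
    using A(2)[of \<alpha> i] by (cases "\<alpha> \<in> A i") (auto simp: c'_def)
  moreover have eq: "coeff_map (\<Union>i. A i) (c' t) x = H (t, x)" if "t \<in> {0..1}" "x \<in> cball 0 1" for t x
  proof -
    have "(\<Sum>\<alpha>\<in>(\<Union>i. A i). c' t \<alpha> i * monomial \<alpha> x) = (\<Sum>\<alpha>\<in>A i. c i \<alpha> t * monomial \<alpha> x)" for i
      using fin by (intro sum.mono_neutral_cong_right) (auto simp: c'_def)
    then show ?thesis using A(3)[OF that] by (simp add: coeff_map_def vec_eq_iff)
  qed
  have "coeff_map (\<Union>i. A i) (c' t) ` cball 0 1 = H ` ({t} \<times> cball 0 1)" if "t \<in> {0..1}" for t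
    using eq[OF that] by (auto simp: image_iff)
  ultimately show thesis using that[of "\<Union>i. A i" c'] fin H(2,3) by simp
qed

text \<open>The margin is itself a coordinate (\<open>VRadius\<close>) of the definable set of
  coefficient families. Curve selection bounds it below by a power of the parameter and approximates
  the coefficients more closely than that, so the approximating maps keep a margin of half that
  power.\<close>

theorem brick_polynomial_curve:
  fixes T :: "(real^'n) set"
  assumes "brick TYPE('m::finite) T"
  obtains A :: "('m::finite \<Rightarrow> nat) set" and q :: "('m \<Rightarrow> nat) \<Rightarrow> 'n \<Rightarrow> real poly" and L \<epsilon> C where
    "finite A" "\<epsilon> > 0" "C > 0" "coeff_map A (\<lambda>\<alpha> i. poly (q \<alpha> i) 0) ` cball 0 1 = T"
    "\<And>s x. 0 < s \<Longrightarrow> s < \<epsilon> \<Longrightarrow> x \<in> cball 0 1 \<Longrightarrow> ball (coeff_map A (\<lambda>\<alpha> i. poly (q \<alpha> i) s) x) (C * s ^ L) \<subseteq> T"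
proof (rule brick_homotopy[OF assms])
  fix A :: "('m \<Rightarrow> nat) set" and c :: "real \<Rightarrow> ('m \<Rightarrow> nat) \<Rightarrow> 'n \<Rightarrow> real"
  assume A: "finite A" "\<And>\<alpha> i. continuous_on {0..1} (\<lambda>t. c t \<alpha> i)"
    "coeff_map A (c 0) ` cball 0 1 = T" "\<And>t. t \<in> {0<..<1} \<Longrightarrow> coeff_map A (c t) ` cball 0 1 \<subseteq> interior T"
  have sT: "semialgebraic T" using assms by (simp add: brick_def)
  define J :: "(('m, 'n) brick_var) set" where "J = range VDom \<union> range VCod"
  define co :: "(('m, 'n) brick_var \<Rightarrow> real) \<Rightarrow> _" where "co e = (\<lambda>\<alpha> i. e (VCoeff \<alpha> i))" for e
  define dom :: "(('m, 'n) brick_var \<Rightarrow> real) \<Rightarrow> real^'m" where "dom e = (\<chi> j. e (VDom j))" for e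
  define cod :: "(('m, 'n) brick_var \<Rightarrow> real) \<Rightarrow> real^'n" where "cod e = (\<chi> i. e (VCod i))" for e
  \<comment> \<open>The margin condition as a first-order formula: norms enter through their
    squares, which are polynomial.\<close>
  define N where "N e \<longleftrightarrow> (\<forall>e'. (\<forall>j. j \<notin> J \<longrightarrow> e' j = e j) \<longrightarrow>
      (\<Sum>j\<in>UNIV. (e' (VDom j))\<^sup>2) \<le> 1 \<and> (\<Sum>i\<in>UNIV. (coeff_map A (co e') (dom e') $ i - e' (VCod i))\<^sup>2) < (e' VRadius)\<^sup>2 \<longrightarrow> cod e' \<in> T)"
    for e :: "('m, 'n) brick_var \<Rightarrow> real"
  \<comment> \<open>\<open>W e\<close>: the polynomial map with the coefficients \<open>co e\<close> is within \<open>e VTime\<close> of the initial one and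
    sends the unit ball into \<open>T\<close> with margin \<open>e VRadius\<close>.\<close>
  define W where "W e \<longleftrightarrow> 0 < e VRadius \<and> e VRadius \<le> 1 \<and> e VTime \<le> 1 \<and>
     (\<forall>(\<alpha>, i)\<in>A \<times> UNIV. \<bar>e (VCoeff \<alpha> i) - c 0 \<alpha> i\<bar> \<le> e VTime) \<and> N e" for e
  have N: "N e \<longleftrightarrow> (\<forall>x\<in>cball 0 1. ball (coeff_map A (co e) x) (e VRadius) \<subseteq> T)" if "0 < e VRadius" for e
  proof -
    have sq: "(\<Sum>i\<in>UNIV. (y $ i - z $ i)\<^sup>2) < r\<^sup>2 \<longleftrightarrow> dist y z < r" if "r > 0" for y z :: "real^'n" and r
    proof -
      have "(\<Sum>i\<in>UNIV. (y $ i - z $ i)\<^sup>2) = (dist y z)\<^sup>2"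
        by (simp add: dist_norm norm_vec_def L2_set_def sum_nonneg)
      then show ?thesis using that by (simp flip: not_le)
    qed
    have sq1: "(\<Sum>j\<in>UNIV. (x $ j)\<^sup>2) \<le> 1 \<longleftrightarrow> x \<in> cball 0 1" for x :: "real^'m"
      by (simp add: norm_vec_def L2_set_def)
    show ?thesis
    proof
      assume n: "N e"
      show "\<forall>x\<in>cball 0 1. ball (coeff_map A (co e) x) (e VRadius) \<subseteq> T"
      proof (intro ballI subsetI)
        fix x y assume x: "x \<in> cball 0 1" and y: "y \<in> ball (coeff_map A (co e) x) (e VRadius)"
        define e' where "e' v = (case v of VDom j \<Rightarrow> x $ j | VCod i \<Rightarrow> y $ i | _ \<Rightarrow> e v)" for v
        have 0: "\<And>j. j \<notin> J \<Longrightarrow> e' j = e j" by (auto simp: e'_def J_def split: brick_var.splits)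
        have 1: "dom e' = x" "cod e' = y" "co e' = co e" "e' VRadius = e VRadius"
          by (auto simp: dom_def cod_def co_def e'_def vec_eq_iff)
        have 2: "(\<Sum>j\<in>UNIV. (e' (VDom j))\<^sup>2) \<le> 1" using x sq1[of x] by (simp add: e'_def)
        have 3: "(\<Sum>i\<in>UNIV. (coeff_map A (co e) x $ i - e' (VCod i))\<^sup>2) < (e VRadius)\<^sup>2"
          using y sq[OF that, of "coeff_map A (co e) x" y] by (simp add: e'_def)
        have "cod e' \<in> T" using n[unfolded N_def, rule_format, of e', OF 0] 2 3 unfolding 1 by blast
        then show "y \<in> T" by (simp add: 1)
      qed
    next
      assume *: "\<forall>x\<in>cball 0 1. ball (coeff_map A (co e) x) (e VRadius) \<subseteq> T"
      show "N e" unfolding N_def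
      proof (intro allI impI; elim conjE)
        fix e' assume e: "\<forall>j. j \<notin> J \<longrightarrow> e' j = e j" and 1: "(\<Sum>j\<in>UNIV. (e' (VDom j))\<^sup>2) \<le> 1"
          and 2: "(\<Sum>i\<in>UNIV. (coeff_map A (co e') (dom e') $ i - e' (VCod i))\<^sup>2) < (e' VRadius)\<^sup>2"
        have "co e' = co e" "e' VRadius = e VRadius" using e by (auto simp: co_def J_def)
        moreover have "dom e' \<in> cball 0 1" using 1 sq1[of "dom e'"] by (simp add: dom_def)
        moreover have "dist (coeff_map A (co e') (dom e')) (cod e') < e' VRadius"
          using 2 sq[of "e' VRadius" "coeff_map A (co e') (dom e')" "cod e'"] that calculation by (simp add: cod_def)
        ultimately have "cod e' \<in> ball (coeff_map A (co e) (dom e')) (e VRadius)" by simp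
        then show "cod e' \<in> T" using * \<open>dom e' \<in> cball 0 1\<close> by blast
      qed
    qed
  qed
  have pc: "pfun (\<lambda>e. coeff_map A (co e) (dom e) $ i)" for i
    by (simp add: coeff_map_def co_def dom_def monomial_def) (intro pfun_intros)
  have "finite J" by (simp add: J_def)
  then have saN: "sa N" unfolding N_def
    by (intro sa_all_finite sa_imp sa_conj sa_le sa_less pfun_intros pc sa_semialgebraic[OF sT])
      (auto simp: cod_def intro: pfun_intros)
  have sa_abs: "sa (\<lambda>e. \<bar>p e\<bar> \<le> u e)" if "pfun p" "pfun u" for p u :: "(('m, 'n) brick_var \<Rightarrow> real) \<Rightarrow> real"
    unfolding abs_le_iff using that by (intro sa_conj sa_le pfun_intros)
  have saW: "sa W" unfolding W_def case_prod_unfold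
    by (intro sa_conj sa_less sa_le pfun_intros sa_ball saN sa_abs) (use A(1) in auto)
  define I where "I = insert VRadius ((\<lambda>(\<alpha>, i). VCoeff \<alpha> i) ` (A \<times> (UNIV :: 'n set)))"
  have I: "finite I" "VTime \<notin> I" "VAux \<notin> I" "VRadius \<in> I" using A(1) by (auto simp: I_def)
  have WZ: "W (e(VAux := x)) = W e" for e x
  proof -
    have "co (e(VAux := x)) = co e" by (simp add: co_def)
    then show ?thesis using N[of e] N[of "e(VAux := x)"] by (auto simp: W_def)
  qed
  define B where "B = 2 + (\<Sum>(\<alpha>, i)\<in>A \<times> UNIV. \<bar>c 0 \<alpha> i\<bar>)"
  have B0: "\<bar>c 0 \<alpha> i\<bar> \<le> B - 2" if "\<alpha> \<in> A" for \<alpha> i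
    unfolding B_def using member_le_sum[of "(\<alpha>, i)" "A \<times> UNIV" "\<lambda>(\<alpha>, i). \<bar>c 0 \<alpha> i\<bar>"] that A(1) by auto
  have B: "\<bar>e v\<bar> \<le> B" if "W e" "v \<in> I" for e v
  proof (cases "v = VRadius")
    case True
    have "0 \<le> (\<Sum>(\<alpha>, i)\<in>A \<times> UNIV. \<bar>c 0 \<alpha> i\<bar>)" by (intro sum_nonneg) auto
    then show ?thesis using that True by (auto simp: W_def B_def)
  next
    case False
    then obtain \<alpha> i where v: "v = VCoeff \<alpha> i" "\<alpha> \<in> A" using \<open>v \<in> I\<close> by (auto simp: I_def)
    have "\<bar>e (VCoeff \<alpha> i) - c 0 \<alpha> i\<bar> \<le> e VTime" "e VTime \<le> 1"
      using \<open>W e\<close> v(2) unfolding W_def by auto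
    then have "\<bar>e v - c 0 \<alpha> i\<bar> \<le> 1" using v(1) by simp
    then show ?thesis using B0[OF v(2), of i] by linarith
  qed
  \<comment> \<open>Coefficient families near the initial one come from the homotopy at a small time
    \<open>u\<close>; compactness of the image in the interior supplies the margin.\<close>
  have ne: "\<exists>e. W e \<and> (\<forall>j. j \<notin> I \<longrightarrow> e j = ((\<lambda>_. 0)(VTime := t)) j)" if t: "0 < t" "t < 1" for t
  proof -
    have "\<forall>\<^sub>F u in at_right 0. \<bar>c u \<alpha> i - c 0 \<alpha> i\<bar> < t" for \<alpha> i
    proof -
      have "((\<lambda>u. c u \<alpha> i) \<longlongrightarrow> c 0 \<alpha> i) (at 0 within {0..1})" using A(2)[of \<alpha> i] by (simp add: continuous_on_def)
      then have "((\<lambda>u. c u \<alpha> i) \<longlongrightarrow> c 0 \<alpha> i) (at_right 0)"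
        using at_within_Icc_at_right[of "0::real" 1] by simp
      from tendstoD[OF this t(1)] show ?thesis by (simp add: dist_real_def)
    qed
    then have "\<forall>\<^sub>F u in at_right 0. \<forall>p\<in>A \<times> UNIV. \<bar>c u (fst p) (snd p) - c 0 (fst p) (snd p)\<bar> < t"
      using A(1) by (intro eventually_ball_finiteI) auto
    then have "\<forall>\<^sub>F u in at_right 0. (\<forall>p\<in>A \<times> UNIV. \<bar>c u (fst p) (snd p) - c 0 (fst p) (snd p)\<bar> < t) \<and> 0 < u \<and> u < 1"
      using eventually_at_right_0_pos eventually_at_right_0_less[of 1, simplified] by eventually_elim auto
    then obtain u where u: "\<And>\<alpha> i. \<alpha> \<in> A \<Longrightarrow> \<bar>c u \<alpha> i - c 0 \<alpha> i\<bar> < t" "0 < u" "u < 1"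
      using eventually_happens'[of "at_right (0::real)"] by fastforce
    have K: "compact (coeff_map A (c u) ` cball 0 1)"
      by (intro compact_continuous_image continuous_on_coeff_map compact_cball)
    have "coeff_map A (c u) ` cball 0 1 \<subseteq> interior T" using A(4)[of u] u by auto
    from compact_subset_open_imp_ball_epsilon_subset[OF K open_interior this]
    obtain r where r: "r > 0" "(\<Union>y\<in>coeff_map A (c u) ` cball 0 1. ball y r) \<subseteq> interior T" .
    define e where "e v = (case v of VTime \<Rightarrow> t | VRadius \<Rightarrow> min r 1 | VCoeff \<alpha> i \<Rightarrow> if \<alpha> \<in> A then c u \<alpha> i else 0 | _ \<Rightarrow> 0)" for v
    have ce: "coeff_map A (co e) = coeff_map A (c u)"
      by (auto simp: coeff_map_def co_def e_def vec_eq_iff fun_eq_iff intro!: sum.cong)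
    have "N e"
    proof -
      have "ball (coeff_map A (c u) x) (min r 1) \<subseteq> T" if "x \<in> cball 0 1" for x
      proof -
        have "ball (coeff_map A (c u) x) (min r 1) \<subseteq> ball (coeff_map A (c u) x) r" by (intro subset_ball) simp
        also have "\<dots> \<subseteq> interior T" using r(2) that by blast
        finally show ?thesis using interior_subset by blast
      qed
      then show ?thesis using N[of e] r(1) ce by (simp add: e_def)
    qed
    moreover have "\<bar>e (VCoeff \<alpha> i) - c 0 \<alpha> i\<bar> \<le> e VTime" if "\<alpha> \<in> A" for \<alpha> i
      using u(1)[OF that, of i] that by (simp add: e_def)
    ultimately have "W e" using r(1) t by (auto simp: W_def e_def)
    moreover have "\<forall>j. j \<notin> I \<longrightarrow> e j = ((\<lambda>_. 0)(VTime := t)) j"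
      by (auto simp: e_def I_def split: brick_var.splits)
    ultimately show ?thesis by blast
  qed
  have "\<forall>\<^sub>F t in at_right 0. \<exists>e. W e \<and> (\<forall>j. j \<notin> I \<longrightarrow> e j = ((\<lambda>_. 0)(VTime := t)) j)"
    using eventually_at_right_0_pos eventually_at_right_0_less[of 1, simplified] by eventually_elim (rule ne)
  then have "\<exists>k\<ge>1. \<exists>L q. \<forall>\<^sub>F s in at_right 0. \<exists>e. W e \<and> e VTime = s ^ k \<and> s ^ (k * L) \<le> e VRadius \<and>
      (\<forall>i\<in>I. \<bar>e i - poly (q i) s\<bar> \<le> s ^ (k * Suc L))"
  proof (rule curve_selection[of W I VTime VAux VRadius B, rotated 9])
    show "sa W" "finite I" "VTime \<notin> I" "VAux \<notin> I" "VRadius \<in> I" using saW I by simp_all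
    show "W (e(VAux := x)) = W e" for e x by (rule WZ)
    show "\<bar>e i\<bar> \<le> B" if "W e" "i \<in> I" for e i using B that .
    show "0 < e VRadius \<and> e VRadius \<le> 1" if "W e" for e using that by (simp add: W_def)
  qed simp
  then obtain k L and q :: "('m, 'n) brick_var \<Rightarrow> real poly" where k: "k \<ge> 1" and
    ev: "\<forall>\<^sub>F s in at_right 0. \<exists>e. W e \<and> e VTime = s ^ k \<and> s ^ (k * L) \<le> e VRadius \<and>
      (\<forall>i\<in>I. \<bar>e i - poly (q i) s\<bar> \<le> s ^ (k * Suc L))" by blast
  define M where "M = real CARD('n) * real (card A)"
  \<comment> \<open>A coefficient error s^(k (L + 1)) moves values by at most \<open>M\<close> times
    as much, which is less than half of s^(k L) as soon as M s^k < 1/2.\<close>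
  have "((\<lambda>s. M * s ^ k) \<longlongrightarrow> M * 0 ^ k) (at_right 0)" by (intro tendsto_intros)
  then have evM: "\<forall>\<^sub>F s in at_right 0. M * s ^ k < 1 / 2"
    by (rule order_tendstoD) (use k in \<open>simp add: power_0_left\<close>)
  define Q where "Q \<alpha> i = q (VCoeff \<alpha> i)" for \<alpha> i
  have main: "\<forall>\<^sub>F s in at_right 0. \<forall>x\<in>cball 0 1. ball (coeff_map A (\<lambda>\<alpha> i. poly (Q \<alpha> i) s) x) (1 / 2 * s ^ (k * L)) \<subseteq> T"
    using ev evM eventually_at_right_0_pos
  proof eventually_elim
    case (elim s)
    then obtain e where e: "W e" "e VTime = s ^ k" "s ^ (k * L) \<le> e VRadius"
      "\<And>i. i \<in> I \<Longrightarrow> \<bar>e i - poly (q i) s\<bar> \<le> s ^ (k * Suc L)" by blast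
    show ?case
    proof
      fix x :: "real^'m" assume x: "x \<in> cball 0 1"
      have "dist (coeff_map A (co e) x) (coeff_map A (\<lambda>\<alpha> i. poly (Q \<alpha> i) s) x) \<le> M * s ^ (k * Suc L)"
        unfolding M_def
      proof (rule dist_coeff_map_le[OF x])
        fix \<alpha> i assume "\<alpha> \<in> A"
        then have "VCoeff \<alpha> i \<in> I" unfolding I_def by (intro insertI2 image_eqI[of _ _ "(\<alpha>, i)"]) auto
        from e(4)[OF this] show "\<bar>co e \<alpha> i - poly (Q \<alpha> i) s\<bar> \<le> s ^ (k * Suc L)" by (simp add: co_def Q_def)
      qed
      also have "\<dots> = (M * s ^ k) * s ^ (k * L)" by (simp add: power_add)
      also have "\<dots> \<le> 1 / 2 * s ^ (k * L)" using elim by (intro mult_right_mono) auto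
      finally have d: "dist (coeff_map A (co e) x) (coeff_map A (\<lambda>\<alpha> i. poly (Q \<alpha> i) s) x) \<le> 1 / 2 * s ^ (k * L)" .
      have "ball (coeff_map A (\<lambda>\<alpha> i. poly (Q \<alpha> i) s) x) (1 / 2 * s ^ (k * L)) \<subseteq> ball (coeff_map A (co e) x) (e VRadius)"
      proof
        fix y assume "y \<in> ball (coeff_map A (\<lambda>\<alpha> i. poly (Q \<alpha> i) s) x) (1 / 2 * s ^ (k * L))"
        then show "y \<in> ball (coeff_map A (co e) x) (e VRadius)"
          using d e(3) dist_triangle[of "coeff_map A (co e) x" y "coeff_map A (\<lambda>\<alpha> i. poly (Q \<alpha> i) s) x"] by simp
      qed
      also have "\<dots> \<subseteq> T" using e(1) N[of e] x by (auto simp: W_def)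
      finally show "ball (coeff_map A (\<lambda>\<alpha> i. poly (Q \<alpha> i) s) x) (1 / 2 * s ^ (k * L)) \<subseteq> T" .
    qed
  qed
  \<comment> \<open>The time coordinate bounds the distance to the initial coefficients and tends to
    0 along the curve.\<close>
  have q0: "poly (Q \<alpha> i) 0 = c 0 \<alpha> i" if "\<alpha> \<in> A" for \<alpha> i
  proof -
    have "\<forall>\<^sub>F s in at_right 0. \<bar>poly (Q \<alpha> i) s - c 0 \<alpha> i\<bar> \<le> s ^ (k * Suc L) + s ^ k"
      using ev
    proof eventually_elim
      case (elim s)
      then obtain e where e: "W e" "e VTime = s ^ k" "\<And>i. i \<in> I \<Longrightarrow> \<bar>e i - poly (q i) s\<bar> \<le> s ^ (k * Suc L)" by blast
      have "\<bar>e (VCoeff \<alpha> i) - poly (Q \<alpha> i) s\<bar> \<le> s ^ (k * Suc L)" using e(3)[of "VCoeff \<alpha> i"] that by (force simp: I_def Q_def)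
      moreover have "\<bar>e (VCoeff \<alpha> i) - c 0 \<alpha> i\<bar> \<le> s ^ k" using e(1,2) that by (force simp: W_def)
      ultimately show ?case by linarith
    qed
    moreover have "((\<lambda>s. s ^ (k * Suc L) + s ^ k) \<longlongrightarrow> 0 ^ (k * Suc L) + 0 ^ k) (at_right (0::real))" by (intro tendsto_intros)
    moreover have "((\<lambda>s. \<bar>poly (Q \<alpha> i) s - c 0 \<alpha> i\<bar>) \<longlongrightarrow> \<bar>poly (Q \<alpha> i) 0 - c 0 \<alpha> i\<bar>) (at_right 0)"
      by (intro tendsto_intros poly_tendsto_at_right_0)
    ultimately have "\<bar>poly (Q \<alpha> i) 0 - c 0 \<alpha> i\<bar> \<le> 0 ^ (k * Suc L) + 0 ^ k"
      using tendsto_le[OF trivial_limit_at_right_real] by blast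
    then show ?thesis using k by (simp add: power_0_left)
  qed
  have "coeff_map A (\<lambda>\<alpha> i. poly (Q \<alpha> i) 0) = coeff_map A (c 0)"
    using q0 by (auto simp: coeff_map_def fun_eq_iff vec_eq_iff intro!: sum.cong)
  then have "coeff_map A (\<lambda>\<alpha> i. poly (Q \<alpha> i) 0) ` cball 0 1 = T" using A(3) by simp
  moreover obtain \<epsilon> where "\<epsilon> > 0" "\<And>s. 0 < s \<Longrightarrow> s < \<epsilon> \<Longrightarrow> \<forall>x\<in>cball 0 1. ball (coeff_map A (\<lambda>\<alpha> i. poly (Q \<alpha> i) s) x) (1 / 2 * s ^ (k * L)) \<subseteq> T"
    using main unfolding eventually_at_right_field by blast
  ultimately show thesis using that[of A \<epsilon> "1 / 2" Q "k * L"] A(1) by auto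
qed

section \<open>Frontiers and analytic paths\<close>

lemma real_polynomial_function_as_poly:
  fixes f :: "real \<Rightarrow> real"
  assumes "real_polynomial_function f" obtains p where "f = poly p"
proof -
  obtain a n where f: "f = (\<lambda>x. \<Sum>i\<le>n. a i * x ^ i)"
    using assms real_polynomial_function_iff_sum by blast
  then have "f = poly (\<Sum>i\<le>n. monom (a i) i)" by (simp add: fun_eq_iff poly_sum poly_monom)
  then show thesis using that by blast
qed

lemma real_polynomial_function_line:
  fixes g :: "'a::real_normed_vector \<Rightarrow> real"
  assumes "real_polynomial_function g" obtains p where "\<And>t. g (x + t *\<^sub>R v) = poly p t"
proof -
  have 1: "polynomial_function (\<lambda>t::real. x + t *\<^sub>R v)"
    by (intro polynomial_function_add polynomial_function_const)
      (simp add: polynomial_function_bounded_linear bounded_linear_scaleR_left)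
  have "real_polynomial_function (g \<circ> (\<lambda>t::real. x + t *\<^sub>R v))"
    by (rule real_polynomial_function_compose[OF 1 assms])
  then obtain p where "g \<circ> (\<lambda>t::real. x + t *\<^sub>R v) = poly p" by (rule real_polynomial_function_as_poly)
  then show thesis using that[of p] by (auto simp: fun_eq_iff)
qed

text \<open>On the line from \<open>x\<close> to \<open>z\<close> the function is a nonzero
  polynomial in one variable, so it has finitely many roots there.\<close>

lemma real_polynomial_function_nonzero_dense:
  fixes g :: "'a::real_normed_vector \<Rightarrow> real"
  assumes "real_polynomial_function g" "g z \<noteq> 0" "e > 0"
  shows "\<exists>y. dist x y < e \<and> g y \<noteq> 0"
proof -
  obtain p where p: "\<And>t. g (x + t *\<^sub>R (z - x)) = poly p t"
    using real_polynomial_function_line[OF assms(1)] by blast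
  have "poly p 1 \<noteq> 0" using p[of 1] assms(2) by simp
  then have "p \<noteq> 0" by auto
  then have "finite {t. poly p t = 0}" by (rule poly_roots_finite)
  moreover have "infinite {0<..<e / (norm (z - x) + 1)}"
    using assms(3) by (intro infinite_Ioo) (simp add: add_nonneg_pos)
  ultimately obtain t where t: "0 < t" "t < e / (norm (z - x) + 1)" "poly p t \<noteq> 0"
    by (metis (mono_tags, lifting) finite_subset greaterThanLessThan_iff mem_Collect_eq subsetI)
  have "dist x (x + t *\<^sub>R (z - x)) = t * norm (z - x)" using t by (simp add: dist_norm)
  also have "\<dots> \<le> t * (norm (z - x) + 1)" using t by simp
  also have "\<dots> < e" using t by (simp add: pos_less_divide_eq add_nonneg_pos)
  finally show ?thesis using t p by auto
qed

text \<open>Frontiers of complements and unions are controlled by those of the parts. A product of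
  nonzero polynomials is nonzero because nonvanishing is an open and dense condition. An identically
  vanishing \<open>p\<close> defines a set with empty frontier, for which the constant 1
  serves.\<close>

lemma semialgebraic_frontier:
  fixes T :: "(real^'n) set"
  assumes "semialgebraic T"
  shows "\<exists>g. real_polynomial_function g \<and> (\<exists>z. g z \<noteq> 0) \<and> frontier T \<subseteq> {x. g x = 0}"
  using assms
proof (induction rule: semialgebraic.induct)
  case (eq p)
  show ?case
  proof (cases "\<forall>x. p x = 0")
    case True
    then have "{x. p x = 0} = UNIV" by auto
    then show ?thesis by (intro exI[of _ "\<lambda>_. 1"]) (auto simp: real_polynomial_function.intros(2))
  next
    case False
    have "closed {x. p x = 0}"
      using eq by (intro closed_Collect_eq continuous_on_const continuous_on_polymonial_function)
        (simp add: real_polynomial_function_eq)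
    then have "frontier {x. p x = 0} \<subseteq> {x. p x = 0}" by (rule frontier_subset_closed)
    then show ?thesis using eq False by blast
  qed
next
  case (pos p)
  have cp: "continuous_on UNIV p"
    using pos by (intro continuous_on_polymonial_function) (simp add: real_polynomial_function_eq)
  show ?case
  proof (cases "\<forall>x. p x = 0")
    case True
    then show ?thesis by (intro exI[of _ "\<lambda>_. 1"]) (auto simp: real_polynomial_function.intros(2))
  next
    case False
    have "open {x. p x > 0}" by (intro open_Collect_less cp continuous_on_const)
    moreover have "closure {x. p x > 0} \<subseteq> {x. p x \<ge> 0}"
      by (intro closure_minimal closed_Collect_le cp continuous_on_const) auto
    ultimately have "frontier {x. p x > 0} \<subseteq> {x. p x = 0}"
      by (auto simp: frontier_def interior_open)
    then show ?thesis using pos False by blast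
  qed
next
  case (compl A)
  then show ?case by (simp add: frontier_complement)
next
  case (union A B)
  then obtain g h y z where g: "real_polynomial_function g" "g z \<noteq> 0" "frontier A \<subseteq> {x. g x = 0}"
    and h: "real_polynomial_function h" "h y \<noteq> 0" "frontier B \<subseteq> {x. h x = 0}" by blast
  have "continuous_on UNIV g"
    using g by (intro continuous_on_polymonial_function) (simp add: real_polynomial_function_eq)
  then have "open {x. g x \<noteq> 0}" by (intro open_Collect_neq continuous_on_const)
  then obtain e where e: "e > 0" "ball z e \<subseteq> {x. g x \<noteq> 0}" using g(2) by (auto simp: open_contains_ball)
  obtain w where "dist z w < e" "h w \<noteq> 0" using real_polynomial_function_nonzero_dense[OF h(1,2) e(1)] by blast
  then have "g w * h w \<noteq> 0" using e by auto
  moreover have "frontier (A \<union> B) \<subseteq> {x. g x * h x = 0}"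
    using frontier_Un_subset[of A B] g(3) h(3) by auto
  ultimately show ?case using real_polynomial_function.intros(4)[OF g(1) h(1)] by blast
qed

lemma semialgebraic_Union:
  assumes "finite \<T>" "\<And>T. T \<in> \<T> \<Longrightarrow> semialgebraic T" shows "semialgebraic (\<Union>\<T>)"
  using assms
proof (induction \<T> rule: finite_induct)
  case empty
  have "semialgebraic {x::real^'a. (\<lambda>_. 0) x > (0::real)}" by (rule semialgebraic.pos) (rule real_polynomial_function.intros(2))
  then show ?case by simp
qed (auto intro: semialgebraic.union)

section \<open>Orders of vanishing and jets of analytic functions\<close>

lemma has_fps_expansion_lower_bound:
  fixes u :: "real \<Rightarrow> real"
  assumes "u has_fps_expansion G" "G \<noteq> 0"
  shows "\<exists>k c. c > 0 \<and> (\<forall>\<^sub>F h in at 0. c * \<bar>h\<bar> ^ k \<le> \<bar>u h\<bar>)"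
proof -
  define k where "k = subdegree G"
  define v where "v h = (if h = 0 then fps_nth G k else u h / h ^ k)" for h
  have "v has_fps_expansion fps_shift k G"
    unfolding v_def by (rule has_fps_expansion_shift[OF assms(1)]) (simp_all add: k_def)
  then have "continuous (at 0) v" using has_fps_expansion_imp_continuous[of v _ UNIV] by simp
  then have "(v \<longlongrightarrow> v 0) (at 0)" by (simp add: isCont_def)
  then have lim: "((\<lambda>h. \<bar>v h\<bar>) \<longlongrightarrow> \<bar>v 0\<bar>) (at 0)" by (rule tendsto_rabs)
  have v0: "v 0 \<noteq> 0" using assms(2) by (simp add: v_def k_def)
  then have "\<forall>\<^sub>F h in at 0. \<bar>v h\<bar> > \<bar>v 0\<bar> / 2" by (intro order_tendstoD[OF lim]) simp
  moreover have "\<forall>\<^sub>F h in at (0::real). h \<noteq> 0" by (simp add: eventually_at_filter)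
  ultimately have "\<forall>\<^sub>F h in at 0. \<bar>v 0\<bar> / 2 * \<bar>h\<bar> ^ k \<le> \<bar>u h\<bar>"
  proof eventually_elim
    case (elim h)
    then have "\<bar>u h\<bar> = \<bar>v h\<bar> * \<bar>h\<bar> ^ k" by (simp add: v_def abs_mult power_abs flip: abs_mult)
    then show ?case using elim by (simp add: mult_right_mono)
  qed
  then show ?thesis using v0 by (intro exI[of _ k] exI[of _ "\<bar>v 0\<bar> / 2"]) simp
qed

text \<open>Truncation after the term of degree \<open>M\<close>: the remainder is h^(M + 1) times a
  bounded function, and the surplus factor h absorbs the bound.\<close>

lemma has_fps_expansion_jet:
  fixes u :: "real \<Rightarrow> real"
  assumes "u has_fps_expansion G"
  shows "\<exists>q. \<forall>\<^sub>F h in at 0. \<bar>u h - poly q h\<bar> \<le> \<bar>h\<bar> ^ M"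
proof -
  define q where "q = (\<Sum>k\<le>M. monom (fps_nth G k) k)"
  define J where "J = (\<Sum>k\<le>M. fps_const (fps_nth G k) * fps_X ^ k)"
  have pq: "poly q h = (\<Sum>k\<le>M. fps_nth G k * h ^ k)" for h by (simp add: q_def poly_sum poly_monom)
  have "(\<lambda>h. u h - poly q h) has_fps_expansion (G - J)"
    unfolding pq J_def by (intro fps_expansion_intros assms)
  note e = this
  have J: "fps_nth J i = (if i \<le> M then fps_nth G i else 0)" for i
    unfolding J_def by (simp add: fps_sum_nth fps_X_power_iff if_distrib cong: if_cong)
  show ?thesis
  proof (cases "G - J = 0")
    case True
    have "\<forall>\<^sub>F h in nhds 0. u h - poly q h = 0"
      using e unfolding True has_fps_expansion_def by (auto elim: eventually_mono)
    then have "\<forall>\<^sub>F h in at 0. u h - poly q h = 0" by (simp add: eventually_nhds_conv_at)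
    then have "\<forall>\<^sub>F h in at 0. \<bar>u h - poly q h\<bar> \<le> \<bar>h\<bar> ^ M" by eventually_elim simp
    then show ?thesis by blast
  next
    case False
    have sub: "Suc M \<le> subdegree (G - J)" using False by (intro subdegree_geI) (auto simp: J)
    define v where "v h = (if h = 0 then fps_nth (G - J) (Suc M) else (u h - poly q h) / h ^ Suc M)" for h
    have "v has_fps_expansion fps_shift (Suc M) (G - J)"
      unfolding v_def by (rule has_fps_expansion_shift[OF e sub refl])
    then have "continuous (at 0) v" using has_fps_expansion_imp_continuous[of v _ UNIV] by simp
    then have "(v \<longlongrightarrow> v 0) (at 0)" by (simp add: isCont_def)
    then have "((\<lambda>h. \<bar>v h\<bar> * \<bar>h\<bar>) \<longlongrightarrow> \<bar>v 0\<bar> * \<bar>0\<bar>) (at 0)" by (intro tendsto_intros)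
    then have "\<forall>\<^sub>F h in at 0. \<bar>v h\<bar> * \<bar>h\<bar> < 1" by (rule order_tendstoD) simp
    moreover have "\<forall>\<^sub>F h in at (0::real). h \<noteq> 0" by (simp add: eventually_at_filter)
    ultimately have "\<forall>\<^sub>F h in at 0. \<bar>u h - poly q h\<bar> \<le> \<bar>h\<bar> ^ M"
    proof eventually_elim
      case (elim h)
      then have "u h - poly q h = (v h * h) * h ^ M" by (simp add: v_def)
      then have "\<bar>u h - poly q h\<bar> = (\<bar>v h\<bar> * \<bar>h\<bar>) * \<bar>h\<bar> ^ M" by (simp add: abs_mult power_abs)
      also have "\<dots> \<le> 1 * \<bar>h\<bar> ^ M" using elim by (intro mult_right_mono) auto
      finally show ?case by simp
    qed
    then show ?thesis by blast
  qed
qed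

lemma real_analytic_on_expansion:
  assumes "real_analytic_on \<beta> U" "t \<in> U"
  shows "\<exists>F. (\<lambda>h. \<beta> (t + h) $ i) has_fps_expansion F"
proof -
  obtain r a where r: "r > 0" "\<And>s. \<bar>s - t\<bar> < r \<Longrightarrow> (\<lambda>k. (s - t) ^ k *\<^sub>R a k) sums \<beta> s"
    using assms unfolding real_analytic_on_def by blast
  have "(\<lambda>k. fps_nth (Abs_fps (\<lambda>k. a k $ i)) k * h ^ k) sums (\<beta> (t + h) $ i)" if "\<bar>h\<bar> < r" for h
    using bounded_linear.sums[OF bounded_linear_vec_nth[of i] r(2)[of "t + h"]] that
    by (simp add: mult.commute)
  moreover have "\<forall>\<^sub>F h in nhds (0::real). \<bar>h\<bar> < r"
    using eventually_nhds_in_open[of "ball 0 r" "0::real"] r(1) by (simp add: dist_real_def)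
  ultimately have "(\<lambda>h. \<beta> (t + h) $ i) has_fps_expansion Abs_fps (\<lambda>k. a k $ i)"
    by (intro has_fps_expansionI) (auto elim: eventually_mono)
  then show ?thesis by blast
qed

lemma real_polynomial_function_expansion:
  fixes g :: "real^'n \<Rightarrow> real"
  assumes "real_polynomial_function g" and b: "\<And>i. \<exists>F. (\<lambda>h. \<beta> h $ i) has_fps_expansion F"
  shows "\<exists>F. (\<lambda>h. g (\<beta> h)) has_fps_expansion F"
  using assms(1)
proof (induction rule: real_polynomial_function.induct)
  case (linear f)
  obtain F where F: "\<And>i. (\<lambda>h. \<beta> h $ i) has_fps_expansion F i" using b by metis
  have "f (\<beta> h) = (\<Sum>i\<in>UNIV. f (axis i 1) * \<beta> h $ i)" for h
  proof -
    have "f (\<beta> h) = f (\<Sum>i\<in>UNIV. \<beta> h $ i *\<^sub>R axis i 1)"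
      by (metis (no_types, lifting) basis_expansion scalar_mult_eq_scaleR sum.cong)
    then show ?thesis using linear by (simp add: bounded_linear.linear linear_sum linear_scale mult.commute)
  qed
  moreover have "(\<lambda>h. \<Sum>i\<in>UNIV. f (axis i 1) * \<beta> h $ i) has_fps_expansion (\<Sum>i\<in>UNIV. fps_const (f (axis i 1)) * F i)"
    by (intro fps_expansion_intros F)
  ultimately show ?case by auto
next
  case (const c)
  then show ?case using has_fps_expansion_const by blast
next
  case (add f g)
  then show ?case using has_fps_expansion_add by blast
next
  case (mult f g)
  then show ?case using has_fps_expansion_mult by blast
qed

lemma eventually_at_shift: "(\<forall>\<^sub>F s in at (t::real). P s) \<longleftrightarrow> (\<forall>\<^sub>F h in at 0. P (t + h))"
  by (subst at_to_0) (simp add: eventually_filtermap add.commute)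

text \<open>Identity theorem on the connected interval. The points near which the composition
  vanishes identically form an open set \<open>Z\<close>; at every other point the order of
  vanishing is finite, so nearby points are not in \<open>Z\<close> either. As 0 is not in
  \<open>Z\<close>, no time of the interval is.\<close>

lemma analytic_lower_bound:
  fixes \<beta> :: "real \<Rightarrow> real^'n"
  assumes \<beta>: "real_analytic_on \<beta> U" "open U" "{0..1} \<subseteq> U"
    and g: "real_polynomial_function g" "g (\<beta> 0) \<noteq> 0" and t: "t \<in> {0..1}"
  shows "\<exists>k c. c > 0 \<and> (\<forall>\<^sub>F s in at t. c * \<bar>s - t\<bar> ^ k \<le> \<bar>g (\<beta> s)\<bar>)"
proof -
  have ex: "\<exists>F. (\<lambda>h. g (\<beta> (s + h))) has_fps_expansion F" if "s \<in> U" for s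
    by (rule real_polynomial_function_expansion[OF g(1)]) (rule real_analytic_on_expansion[OF \<beta>(1) that])
  then obtain G where G: "\<And>s. s \<in> U \<Longrightarrow> (\<lambda>h. g (\<beta> (s + h))) has_fps_expansion G s" by metis
  define Z where "Z = {s. \<forall>\<^sub>F x in nhds s. g (\<beta> x) = 0}"
  have oZ: "open Z" 
  proof -
    have "\<exists>W. open W \<and> s \<in> W \<and> W \<subseteq> Z" if "s \<in> Z" for s
    proof -
      have "\<forall>\<^sub>F y in nhds s. \<forall>\<^sub>F x in nhds y. g (\<beta> x) = 0"
        using that unfolding eventually_eventually by (simp add: Z_def)
      then obtain W where "open W" "s \<in> W" "\<forall>y\<in>W. \<forall>\<^sub>F x in nhds y. g (\<beta> x) = 0"
        unfolding eventually_nhds[of _ s] by blast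
      then show ?thesis unfolding Z_def by blast
    qed
    then show ?thesis by (subst open_subopen) blast
  qed
  define V where "V = {s\<in>U. \<exists>k c. c > 0 \<and> (\<forall>\<^sub>F x in at s. c * \<bar>x - s\<bar> ^ k \<le> \<bar>g (\<beta> x)\<bar>)}"
  have UV: "s \<in> Z \<or> s \<in> V" if s: "s \<in> U" for s
  proof (cases "G s = 0")
    case True
    have z: "\<forall>\<^sub>F h in nhds 0. g (\<beta> (s + h)) = 0"
      using G[OF s] unfolding True has_fps_expansion_def by (auto elim: eventually_mono)
    then have "\<forall>\<^sub>F x in nhds s. g (\<beta> x) = 0"
      using eventually_nhds_x_imp_x[OF z] by (simp add: eventually_nhds_conv_at eventually_at_shift[of _ s])
    then show ?thesis by (simp add: Z_def)
  next
    case False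
    then show ?thesis using has_fps_expansion_lower_bound[OF G[OF s] False] s
      unfolding V_def by (auto simp: eventually_at_shift[of _ s])
  qed
  have disj: "Z \<inter> V = {}"
  proof (rule ccontr)
    assume "Z \<inter> V \<noteq> {}"
    then obtain s k c where "\<forall>\<^sub>F x in nhds s. g (\<beta> x) = 0" and c: "c > 0" "\<forall>\<^sub>F x in at s. c * \<bar>x - s\<bar> ^ k \<le> \<bar>g (\<beta> x)\<bar>"
      by (auto simp: Z_def V_def)
    then have "\<forall>\<^sub>F x in at s. g (\<beta> x) = 0" by (simp add: eventually_nhds_conv_at)
    moreover have "\<forall>\<^sub>F x in at s. x \<noteq> s" by (simp add: eventually_at_filter)
    ultimately have "\<forall>\<^sub>F x in at s. False"
      using c(2)
    proof eventually_elim
      case (elim x)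
      then have "0 < c * \<bar>x - s\<bar> ^ k" using c(1) by simp
      then show ?case using elim by simp
    qed
    then show False by simp
  qed
  have oV: "\<exists>W. open W \<and> s \<in> W \<and> W \<inter> Z = {}" if s: "s \<in> V" for s
  proof -
    obtain k c where c: "c > 0" "\<forall>\<^sub>F x in at s. c * \<bar>x - s\<bar> ^ k \<le> \<bar>g (\<beta> x)\<bar>" using s by (auto simp: V_def)
    have "\<forall>\<^sub>F x in at s. x \<noteq> s" by (simp add: eventually_at_filter)
    with c(2) have "\<forall>\<^sub>F x in at s. g (\<beta> x) \<noteq> 0"
    proof eventually_elim
      case (elim x)
      then have "0 < c * \<bar>x - s\<bar> ^ k" using c(1) by simp
      then show ?case using elim by auto
    qed
    then obtain W where W: "open W" "s \<in> W" "\<And>x. x \<in> W \<Longrightarrow> x \<noteq> s \<Longrightarrow> g (\<beta> x) \<noteq> 0"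
      unfolding eventually_at_topological by blast
    have "x \<notin> Z" if "x \<in> W" for x
    proof (cases "x = s")
      case False
      then have "g (\<beta> x) \<noteq> 0" using W that by blast
      then show ?thesis by (auto simp: Z_def dest: eventually_nhds_x_imp_x)
    qed (use s disj in auto)
    then show ?thesis using W by blast
  qed
  \<comment> \<open>The largest open set disjoint from \<open>Z\<close>; by \<open>oV\<close> it
    contains \<open>V\<close>.\<close>
  define V' where "V' = \<Union>{W. open W \<and> W \<inter> Z = {}}"
  have "connected {0..1::real}" by simp
  moreover have "open V'" by (auto simp: V'_def)
  moreover have "{0..1} \<subseteq> Z \<union> V'" using UV oV \<beta>(3) unfolding V'_def by blast
  moreover have "Z \<inter> V' \<inter> {0..1} = {}" by (auto simp: V'_def)
  moreover have "0 \<notin> Z" using g(2) by (auto simp: Z_def dest: eventually_nhds_x_imp_x)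
  then have "0 \<in> V'" using calculation(3) by (metis UnE atLeastAtMost_iff order_refl subsetD zero_le_one)
  then have "V' \<inter> {0..1} \<noteq> {}" by (metis IntI atLeastAtMost_iff empty_iff order_refl zero_le_one)
  ultimately have "Z \<inter> {0..1} = {}" using oZ by (metis connectedD)
  then have "t \<in> V" using UV \<beta>(3) t by blast
  then show ?thesis by (simp add: V_def)
qed

lemma polynomial_analytic_path:
  fixes f :: "real \<Rightarrow> real^'n"
  assumes "polynomial_function f" shows "analytic_path f"
  unfolding analytic_path_def
proof (intro exI[of _ UNIV] exI[of _ f] conjI ballI refl)
  show "real_analytic_on f UNIV" unfolding real_analytic_on_def
  proof
    fix t :: real
    have "\<exists>p. \<forall>s. f s $ i = poly p (s - t)" for i
    proof -
      have "real_polynomial_function (\<lambda>s. f s $ i)" 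
        using assms bounded_linear_vec_nth[of i] by (auto simp: polynomial_function_def o_def)
      then obtain p where p: "(\<lambda>s. f s $ i) = poly p" by (rule real_polynomial_function_as_poly)
      have "f s $ i = poly (pcompose p [:t, 1:]) (s - t)" for s
        using fun_cong[OF p, of s] by (simp add: poly_pcompose)
      then show ?thesis by blast
    qed
    then obtain p where p: "\<And>i s. f s $ i = poly (p i) (s - t)" by metis
    define a where "a k = (\<chi> i. coeff (p i) k)" for k
    have "(\<lambda>k. (s - t) ^ k *\<^sub>R a k) sums f s" for s
    proof -
      define N where "N = (\<Sum>i\<in>UNIV. degree (p i))"
      have dN: "degree (p i) \<le> N" for i unfolding N_def by (rule member_le_sum) auto
      have "(\<lambda>k. (s - t) ^ k *\<^sub>R a k) sums (\<Sum>k\<le>N. (s - t) ^ k *\<^sub>R a k)"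
      proof (rule sums_finite)
        fix k assume "k \<notin> {..N}"
        then have "coeff (p i) k = 0" for i using dN[of i] by (intro coeff_eq_0) simp
        then show "(s - t) ^ k *\<^sub>R a k = 0" by (simp add: a_def vec_eq_iff)
      qed simp
      moreover have "(\<Sum>k\<le>N. (s - t) ^ k *\<^sub>R a k) = f s"
      proof -
        have "(\<Sum>k\<le>N. (s - t) ^ k * coeff (p i) k) = poly (p i) (s - t)" for i
          unfolding poly_altdef using dN[of i]
          by (intro sum.mono_neutral_cong_right) (auto simp: coeff_eq_0 mult.commute)
        then show ?thesis by (simp add: vec_eq_iff a_def p)
      qed
      ultimately show ?thesis by simp
    qed
    then show "\<exists>r>0. \<exists>a. \<forall>s. \<bar>s - t\<bar> < r \<longrightarrow> (\<lambda>k. (s - t) ^ k *\<^sub>R a k) sums f s"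
      by (intro exI[of _ 1]) auto
  qed
qed auto

lemma polynomial_image_connected_by_analytic_paths:
  fixes f :: "real^'k \<Rightarrow> real^'n"
  assumes "polynomial_function f" "convex B"
  shows "connected_by_analytic_paths (f ` B)"
  unfolding connected_by_analytic_paths_def
proof (intro ballI)
  fix p q assume "p \<in> f ` B" "q \<in> f ` B"
  then obtain x y where xy: "x \<in> B" "y \<in> B" "p = f x" "q = f y" by blast
  define l where "l t = x + t *\<^sub>R (y - x)" for t :: real
  have "polynomial_function l" unfolding l_def
    by (intro polynomial_function_add polynomial_function_const)
      (simp add: polynomial_function_bounded_linear bounded_linear_scaleR_left)
  then have "polynomial_function (f \<circ> l)" using assms(1) by (rule polynomial_function_compose)
  then have "analytic_path (f \<circ> l)" by (rule polynomial_analytic_path)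
  moreover have "l t \<in> B" if "t \<in> {0..1}" for t
  proof -
    have "l t = (1 - t) *\<^sub>R x + t *\<^sub>R y" by (simp add: l_def algebra_simps)
    then show ?thesis using assms(2) xy that by (simp add: convexD_alt)
  qed
  moreover have "l 0 = x" "l 1 = y" by (simp_all add: l_def)
  ultimately show "\<exists>\<alpha>. analytic_path \<alpha> \<and> \<alpha> ` {0..1} \<subseteq> f ` B \<and> \<alpha> 0 = p \<and> \<alpha> 1 = q"
    using xy by (intro exI[of _ "f \<circ> l"]) auto
qed

section \<open>Curves of polynomial maps\<close>

definition safe :: "(real^'n) set \<Rightarrow> ('m::finite \<Rightarrow> nat) set \<Rightarrow> (('m \<Rightarrow> nat) \<Rightarrow> 'n \<Rightarrow> real) \<Rightarrow> real \<Rightarrow> bool" where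
  "safe S A a r \<longleftrightarrow> (\<forall>x\<in>cball 0 1. ball (coeff_map A a x) r \<subseteq> S)"

lemma safe_mono: "safe S A a r \<Longrightarrow> r' \<le> r \<Longrightarrow> safe S A a r'"
  unfolding safe_def using subset_ball by blast

lemma coeff_map_cong: "(\<And>\<alpha>. \<alpha> \<in> A \<Longrightarrow> a \<alpha> = b \<alpha>) \<Longrightarrow> coeff_map A a = coeff_map A b"
  by (auto simp: coeff_map_def fun_eq_iff vec_eq_iff intro!: sum.cong)

lemma safe_if_interior:
  assumes "coeff_map A a ` cball 0 1 \<subseteq> interior S" shows "\<exists>r>0. safe S A a r"
proof -
  have "compact (coeff_map A a ` cball 0 1)"
    by (intro compact_continuous_image continuous_on_coeff_map compact_cball)
  from compact_subset_open_imp_ball_epsilon_subset[OF this open_interior assms]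
  obtain r where "r > 0" "(\<Union>y\<in>coeff_map A a ` cball 0 1. ball y r) \<subseteq> interior S" .
  then have "safe S A a r" unfolding safe_def using interior_subset by blast
  then show ?thesis using \<open>r > 0\<close> by blast
qed

text \<open>\<open>F\<close> is the set of times at which the curve may leave the interior of \<open>S\<close>. The conditions at these
  times are what is needed for a polynomial approximation that stays in \<open>S\<close> and keeps the values on \<open>F\<close>.\<close>

definition tame_at ::
  "(real^'n) set \<Rightarrow> ('m::finite \<Rightarrow> nat) set \<Rightarrow> (real \<Rightarrow> ('m \<Rightarrow> nat) \<Rightarrow> 'n \<Rightarrow> real) \<Rightarrow> real \<Rightarrow> bool"
where
  "tame_at S A \<Gamma> \<tau> \<longleftrightarrow> coeff_map A (\<Gamma> \<tau>) ` cball 0 1 \<subseteq> S \<and>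
     (\<exists>L c. c > 0 \<and> (\<forall>\<^sub>F t in at \<tau>. safe S A (\<Gamma> t) (c * \<bar>t - \<tau>\<bar> ^ L))) \<and>
     (\<forall>M. \<exists>q. \<forall>\<alpha>\<in>A. \<forall>i. \<forall>\<^sub>F t in at \<tau>. \<bar>\<Gamma> t \<alpha> i - poly (q \<alpha> i) t\<bar> \<le> \<bar>t - \<tau>\<bar> ^ M)"

definition tame_curve ::
  "(real^'n) set \<Rightarrow> ('m::finite \<Rightarrow> nat) set \<Rightarrow> (real \<Rightarrow> ('m \<Rightarrow> nat) \<Rightarrow> 'n \<Rightarrow> real) \<Rightarrow> real \<Rightarrow> real \<Rightarrow> real set \<Rightarrow> bool"
where
  "tame_curve S A \<Gamma> a b F \<longleftrightarrow> finite F \<and> F \<subseteq> {a<..<b} \<and>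
     (\<forall>\<alpha>\<in>A. \<forall>i. continuous_on {a..b} (\<lambda>t. \<Gamma> t \<alpha> i)) \<and>
     (\<forall>t\<in>{a..b} - F. \<exists>r>0. safe S A (\<Gamma> t) r) \<and> (\<forall>\<tau>\<in>F. tame_at S A \<Gamma> \<tau>)"

lemma tame_curve_interior:
  assumes "\<And>\<alpha> i. \<alpha> \<in> A \<Longrightarrow> continuous_on {a..b} (\<lambda>t. \<Gamma> t \<alpha> i)"
    "\<And>t. t \<in> {a..b} \<Longrightarrow> coeff_map A (\<Gamma> t) ` cball 0 1 \<subseteq> interior S"
  shows "tame_curve S A \<Gamma> a b {}"
proof -
  have "\<exists>r>0. safe S A (\<Gamma> t) r" if "t \<in> {a..b}" for t by (rule safe_if_interior[OF assms(2)[OF that]])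
  then show ?thesis unfolding tame_curve_def using assms(1) by auto
qed

lemma tame_curve_safe:
  "tame_curve S A \<Gamma> a b F \<Longrightarrow> \<tau> \<in> F \<Longrightarrow>
    \<exists>L c. c > 0 \<and> (\<forall>\<^sub>F t in at \<tau>. safe S A (\<Gamma> t) (c * \<bar>t - \<tau>\<bar> ^ L))"
  by (simp add: tame_curve_def tame_at_def)

lemma tame_curve_image: "tame_curve S A \<Gamma> a b F \<Longrightarrow> \<tau> \<in> F \<Longrightarrow> coeff_map A (\<Gamma> \<tau>) ` cball 0 1 \<subseteq> S"
  by (simp add: tame_curve_def tame_at_def)

lemma tame_curve_jet:
  "tame_curve S A \<Gamma> a b F \<Longrightarrow> \<tau> \<in> F \<Longrightarrow>
    \<exists>q. \<forall>\<alpha>\<in>A. \<forall>i. \<forall>\<^sub>F t in at \<tau>. \<bar>\<Gamma> t \<alpha> i - poly (q \<alpha> i) t\<bar> \<le> \<bar>t - \<tau>\<bar> ^ M"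
  by (simp add: tame_curve_def tame_at_def)

text \<open>The exceptional sets lie in open intervals, so both curves have positive margin at the
  junction \<open>b\<close>. Only continuity is required there, and corners are harmless.\<close>

lemma tame_curve_concat:
  assumes 1: "tame_curve S A \<Gamma>1 a b F1" and 2: "tame_curve S A \<Gamma>2 b c F2" and abc: "a < b" "b < c"
    and eq: "\<And>\<alpha>. \<alpha> \<in> A \<Longrightarrow> \<Gamma>1 b \<alpha> = \<Gamma>2 b \<alpha>"
  shows "tame_curve S A (\<lambda>t. if t \<le> b then \<Gamma>1 t else \<Gamma>2 t) a c (F1 \<union> F2)"
proof -
  let ?\<Gamma> = "\<lambda>t. if t \<le> b then \<Gamma>1 t else \<Gamma>2 t"
  have F: "finite F1" "finite F2" "F1 \<subseteq> {a<..<b}" "F2 \<subseteq> {b<..<c}"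
    using 1 2 by (auto simp: tame_curve_def)
  have cont: "continuous_on {a..c} (\<lambda>t. ?\<Gamma> t \<alpha> i)" if \<alpha>: "\<alpha> \<in> A" for \<alpha> i
  proof -
    have "{t \<in> {a..c}. t \<le> b} = {a..b}" "{t \<in> {a..c}. b \<le> t} = {b..c}" using abc by auto
    then have "continuous_on {a..c} (\<lambda>t. if t \<le> b then \<Gamma>1 t \<alpha> i else \<Gamma>2 t \<alpha> i)"
      using 1 2 \<alpha> eq[OF \<alpha>] by (intro continuous_on_cases_le) (auto simp: tame_curve_def)
    then show ?thesis by (rule continuous_on_eq) simp
  qed
  have near1: "\<forall>\<^sub>F t in at \<tau>. ?\<Gamma> t = \<Gamma>1 t" if "\<tau> \<in> F1" for \<tau>
  proof -
    have "\<tau> < b" using that F by auto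
    then have "\<forall>\<^sub>F t in at \<tau>. t < b" by (rule order_tendstoD(2)[OF tendsto_ident_at])
    then show ?thesis by eventually_elim simp
  qed
  have near2: "\<forall>\<^sub>F t in at \<tau>. ?\<Gamma> t = \<Gamma>2 t" if "\<tau> \<in> F2" for \<tau>
  proof -
    have "b < \<tau>" using that F by auto
    then have "\<forall>\<^sub>F t in at \<tau>. b < t" by (rule order_tendstoD(1)[OF tendsto_ident_at])
    then show ?thesis by eventually_elim simp
  qed
  have tr: "tame_at S A ?\<Gamma> \<tau>"
    if \<Delta>: "tame_curve S A \<Delta> a' b' F" "\<tau> \<in> F" and near: "\<forall>\<^sub>F t in at \<tau>. ?\<Gamma> t = \<Delta> t" "?\<Gamma> \<tau> = \<Delta> \<tau>" for \<Delta> a' b' F \<tau>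
    unfolding tame_at_def
  proof (intro conjI allI)
    show "coeff_map A (?\<Gamma> \<tau>) ` cball 0 1 \<subseteq> S" unfolding near(2) by (rule tame_curve_image[OF \<Delta>])
    obtain L c where c: "c > 0" "\<forall>\<^sub>F t in at \<tau>. safe S A (\<Delta> t) (c * \<bar>t - \<tau>\<bar> ^ L)"
      using tame_curve_safe[OF \<Delta>] by blast
    have "\<forall>\<^sub>F t in at \<tau>. safe S A (?\<Gamma> t) (c * \<bar>t - \<tau>\<bar> ^ L)" using c(2) near(1) by eventually_elim metis
    then show "\<exists>L c. c > 0 \<and> (\<forall>\<^sub>F t in at \<tau>. safe S A (?\<Gamma> t) (c * \<bar>t - \<tau>\<bar> ^ L))" using c(1) by blast
    fix M
    obtain q where q: "\<And>\<alpha> i. \<alpha> \<in> A \<Longrightarrow> \<forall>\<^sub>F t in at \<tau>. \<bar>\<Delta> t \<alpha> i - poly (q \<alpha> i) t\<bar> \<le> \<bar>t - \<tau>\<bar> ^ M"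
      using tame_curve_jet[OF \<Delta>, of M] by blast
    have "\<forall>\<^sub>F t in at \<tau>. \<bar>?\<Gamma> t \<alpha> i - poly (q \<alpha> i) t\<bar> \<le> \<bar>t - \<tau>\<bar> ^ M" if "\<alpha> \<in> A" for \<alpha> i
      using q[OF that, of i] near(1) by eventually_elim metis
    then show "\<exists>q. \<forall>\<alpha>\<in>A. \<forall>i. \<forall>\<^sub>F t in at \<tau>. \<bar>?\<Gamma> t \<alpha> i - poly (q \<alpha> i) t\<bar> \<le> \<bar>t - \<tau>\<bar> ^ M" by blast
  qed
  have "F1 \<union> F2 \<subseteq> {a<..<c}" using F abc by auto
  moreover have "\<exists>r>0. safe S A (?\<Gamma> t) r" if "t \<in> {a..c} - (F1 \<union> F2)" for t
    using 1 2 that by (cases "t \<le> b") (auto simp: tame_curve_def)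
  moreover have "?\<Gamma> \<tau> = \<Gamma>1 \<tau>" if "\<tau> \<in> F1" for \<tau> using that F by auto
  moreover have "?\<Gamma> \<tau> = \<Gamma>2 \<tau>" if "\<tau> \<in> F2" for \<tau> using that F by auto
  ultimately show ?thesis
    unfolding tame_curve_def[of S A ?\<Gamma>] using F abc cont tr[OF 1 _ near1] tr[OF 2 _ near2] by blast
qed

lemma tame_curve_affine:
  assumes \<Gamma>: "tame_curve S A \<Gamma> 0 1 F" and ab: "a < b"
  shows "tame_curve S A (\<lambda>t. \<Gamma> ((t - a) / (b - a))) a b ((\<lambda>s. a + (b - a) * s) ` F)"
proof -
  define k where "k = b - a"
  have k: "k > 0" using ab by (simp add: k_def)
  define l where "l t = (t - a) / k" for t
  have F: "finite F" "F \<subseteq> {0<..<1}" using \<Gamma> by (auto simp: tame_curve_def)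
  have l01: "l ` {a..b} \<subseteq> {0..1}" using ab by (auto simp: l_def k_def divide_simps)
  have ev: "\<forall>\<^sub>F t in at (a + k * \<tau>). P (l t)" if "\<forall>\<^sub>F u in at \<tau>. P u" for P \<tau>
  proof -
    have "(l \<longlongrightarrow> l (a + k * \<tau>)) (at (a + k * \<tau>))" unfolding l_def using k by (intro tendsto_intros) auto
    moreover have "l (a + k * \<tau>) = \<tau>" using k by (simp add: l_def)
    moreover have "\<forall>\<^sub>F t in at (a + k * \<tau>). l t \<noteq> \<tau>"
      unfolding eventually_at_filter using k by (intro always_eventually) (auto simp: l_def field_simps)
    ultimately have "filterlim l (at \<tau>) (at (a + k * \<tau>))" by (simp add: filterlim_at)
    then show ?thesis using that by (simp add: filterlim_iff)
  qed
  have d: "l t - \<tau> = (t - (a + k * \<tau>)) / k" for t \<tau> using k by (simp add: l_def field_simps)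
  have "continuous_on {a..b} (\<lambda>t. \<Gamma> (l t) \<alpha> i)" if "\<alpha> \<in> A" for \<alpha> i
  proof (rule continuous_on_compose2[of "{0..1}" "\<lambda>t. \<Gamma> t \<alpha> i" _ l])
    show "continuous_on {0..1} (\<lambda>t. \<Gamma> t \<alpha> i)" using \<Gamma> that by (simp add: tame_curve_def)
    show "continuous_on {a..b} l" unfolding l_def using k by (intro continuous_intros) auto
  qed (rule l01)
  moreover have "\<exists>r>0. safe S A (\<Gamma> (l t)) r" if "t \<in> {a..b} - (\<lambda>s. a + k * s) ` F" for t
  proof -
    have "t = a + k * l t" using k by (simp add: l_def)
    moreover have "l t \<in> {0..1}" using that l01 by blast
    ultimately have "l t \<in> {0..1} - F" using that by auto
    then show ?thesis using \<Gamma> by (simp add: tame_curve_def)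
  qed
  moreover have "tame_at S A (\<lambda>t. \<Gamma> (l t)) (a + k * \<tau>)"
    if \<tau>: "\<tau> \<in> F" for \<tau>
    unfolding tame_at_def
  proof (intro conjI allI)
    show "coeff_map A (\<Gamma> (l (a + k * \<tau>))) ` cball 0 1 \<subseteq> S" using tame_curve_image[OF \<Gamma> \<tau>] k by (simp add: l_def)
    obtain L c where c: "c > 0" "\<forall>\<^sub>F t in at \<tau>. safe S A (\<Gamma> t) (c * \<bar>t - \<tau>\<bar> ^ L)"
      using tame_curve_safe[OF \<Gamma> \<tau>] by blast
    have "\<forall>\<^sub>F t in at (a + k * \<tau>). safe S A (\<Gamma> (l t)) (c / k ^ L * \<bar>t - (a + k * \<tau>)\<bar> ^ L)"
      using ev[OF c(2)] by eventually_elim (use k in \<open>simp add: d power_divide\<close>)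
    then show "\<exists>L c. c > 0 \<and> (\<forall>\<^sub>F t in at (a + k * \<tau>). safe S A (\<Gamma> (l t)) (c * \<bar>t - (a + k * \<tau>)\<bar> ^ L))"
      using c(1) k by (intro exI[of _ L] exI[of _ "c / k ^ L"]) simp
    fix M
    \<comment> \<open>One order more than required, to absorb the factor from the change of
      scale.\<close>
    obtain q where q: "\<And>\<alpha> i. \<alpha> \<in> A \<Longrightarrow> \<forall>\<^sub>F t in at \<tau>. \<bar>\<Gamma> t \<alpha> i - poly (q \<alpha> i) t\<bar> \<le> \<bar>t - \<tau>\<bar> ^ Suc M"
      using tame_curve_jet[OF \<Gamma> \<tau>, of "Suc M"] by blast
    have "((\<lambda>t. \<bar>t - (a + k * \<tau>)\<bar>) \<longlongrightarrow> \<bar>(a + k * \<tau>) - (a + k * \<tau>)\<bar>) (at (a + k * \<tau>))" by (intro tendsto_intros)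
    then have small: "\<forall>\<^sub>F t in at (a + k * \<tau>). \<bar>t - (a + k * \<tau>)\<bar> < k ^ Suc M"
      by (rule order_tendstoD) (use k in simp)
    have "\<forall>\<^sub>F t in at (a + k * \<tau>). \<bar>\<Gamma> (l t) \<alpha> i - poly (pcompose (q \<alpha> i) [:- a / k, 1 / k:]) t\<bar> \<le> \<bar>t - (a + k * \<tau>)\<bar> ^ M"
      if "\<alpha> \<in> A" for \<alpha> i
      using ev[OF q[OF that, of i]] small
    proof eventually_elim
      case (elim t)
      have "poly (pcompose (q \<alpha> i) [:- a / k, 1 / k:]) t = poly (q \<alpha> i) (l t)"
        by (simp add: poly_pcompose l_def diff_divide_distrib)
      then have "\<bar>\<Gamma> (l t) \<alpha> i - poly (pcompose (q \<alpha> i) [:- a / k, 1 / k:]) t\<bar> \<le> \<bar>t - (a + k * \<tau>)\<bar> ^ Suc M / k ^ Suc M"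
        using elim(1) k by (simp add: d power_divide)
      also have "\<dots> = \<bar>t - (a + k * \<tau>)\<bar> ^ M * (\<bar>t - (a + k * \<tau>)\<bar> / k ^ Suc M)" by simp
      also have "\<dots> \<le> \<bar>t - (a + k * \<tau>)\<bar> ^ M * 1"
        using elim(2) k by (intro mult_left_mono) (auto simp: divide_le_eq)
      finally show ?case by simp
    qed
    then show "\<exists>q. \<forall>\<alpha>\<in>A. \<forall>i. \<forall>\<^sub>F t in at (a + k * \<tau>). \<bar>\<Gamma> (l t) \<alpha> i - poly (q \<alpha> i) t\<bar> \<le> \<bar>t - (a + k * \<tau>)\<bar> ^ M"
      by (intro exI[of _ "\<lambda>\<alpha> i. pcompose (q \<alpha> i) [:- a / k, 1 / k:]"]) blast
  qed
  moreover have "(\<lambda>s. a + k * s) ` F \<subseteq> {a<..<b}"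
  proof safe
    fix s assume "s \<in> F"
    then have "0 < k * s" "k * s < k * 1" using F(2) k by (auto intro: mult_strict_left_mono)
    then show "a + k * s \<in> {a<..<b}" by (simp add: k_def)
  qed
  ultimately show ?thesis unfolding tame_curve_def l_def[symmetric] k_def[symmetric] using F(1)
    by (intro conjI ballI) auto
qed

section \<open>Joining polynomial maps by curves of maps into \<open>S\<close>\<close>

definition const_coeff :: "real^'n \<Rightarrow> ('m::finite \<Rightarrow> nat) \<Rightarrow> 'n \<Rightarrow> real" where
  "const_coeff y \<alpha> i = (if \<alpha> = (\<lambda>_. 0) then y $ i else 0)"

lemma coeff_map_const:
  assumes "finite A" "(\<lambda>_. 0) \<in> A" shows "coeff_map A (const_coeff y) x = y"
proof -
  have "(\<Sum>\<alpha>\<in>A. const_coeff y \<alpha> i * monomial \<alpha> x) = (\<Sum>\<alpha>\<in>A. if \<alpha> = (\<lambda>_. 0) then y $ i else 0)" for i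
    by (intro sum.cong) (auto simp: const_coeff_def monomial_def)
  then show ?thesis using assms by (simp add: coeff_map_def vec_eq_iff)
qed

definition joined where
  "joined S A P Q \<longleftrightarrow> (\<exists>\<Gamma> F. tame_curve S A \<Gamma> 0 1 F \<and> (\<forall>\<alpha>\<in>A. \<Gamma> 0 \<alpha> = P \<alpha>) \<and> (\<forall>\<alpha>\<in>A. \<Gamma> 1 \<alpha> = Q \<alpha>))"

lemma joined_on:
  assumes "joined S A P Q" "a < b"
  obtains \<Gamma> F where "tame_curve S A \<Gamma> a b F" "\<And>\<alpha>. \<alpha> \<in> A \<Longrightarrow> \<Gamma> a \<alpha> = P \<alpha>" "\<And>\<alpha>. \<alpha> \<in> A \<Longrightarrow> \<Gamma> b \<alpha> = Q \<alpha>"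
proof -
  obtain \<Gamma> F where "tame_curve S A \<Gamma> 0 1 F" "\<forall>\<alpha>\<in>A. \<Gamma> 0 \<alpha> = P \<alpha>" "\<forall>\<alpha>\<in>A. \<Gamma> 1 \<alpha> = Q \<alpha>"
    using assms by (auto simp: joined_def)
  then show thesis using that[OF tame_curve_affine[of S A \<Gamma> F a b]] assms(2) by simp
qed

lemma joined_trans:
  assumes "joined S A P Q" "joined S A Q R" shows "joined S A P R"
proof -
  obtain \<Gamma>1 F1 where 1: "tame_curve S A \<Gamma>1 0 (1/2) F1" "\<And>\<alpha>. \<alpha> \<in> A \<Longrightarrow> \<Gamma>1 0 \<alpha> = P \<alpha>" "\<And>\<alpha>. \<alpha> \<in> A \<Longrightarrow> \<Gamma>1 (1/2) \<alpha> = Q \<alpha>"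
    using joined_on[OF assms(1), of 0 "1/2"] by auto
  obtain \<Gamma>2 F2 where 2: "tame_curve S A \<Gamma>2 (1/2) 1 F2" "\<And>\<alpha>. \<alpha> \<in> A \<Longrightarrow> \<Gamma>2 (1/2) \<alpha> = Q \<alpha>" "\<And>\<alpha>. \<alpha> \<in> A \<Longrightarrow> \<Gamma>2 1 \<alpha> = R \<alpha>"
    using joined_on[OF assms(2), of "1/2" 1] by auto
  have "tame_curve S A (\<lambda>t. if t \<le> 1/2 then \<Gamma>1 t else \<Gamma>2 t) 0 1 (F1 \<union> F2)"
    by (rule tame_curve_concat[OF 1(1) 2(1)]) (use 1(3) 2(2) in auto)
  then show ?thesis unfolding joined_def using 1(2) 2(3)
    by (intro exI[of _ "\<lambda>t. if t \<le> 1/2 then \<Gamma>1 t else \<Gamma>2 t"] exI[of _ "F1 \<union> F2"]) auto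
qed

lemma joined_segment:
  fixes S :: "(real^'n) set" and A :: "('m::finite \<Rightarrow> nat) set"
  assumes A: "finite A" "(\<lambda>_. 0) \<in> A" and "closed_segment y z \<subseteq> interior S"
  shows "joined S A (const_coeff y) (const_coeff z)"
proof -
  define \<Gamma> :: "real \<Rightarrow> ('m \<Rightarrow> nat) \<Rightarrow> 'n \<Rightarrow> real" where "\<Gamma> t = const_coeff ((1 - t) *\<^sub>R y + t *\<^sub>R z)" for t
  have "tame_curve S A \<Gamma> 0 1 {}"
  proof (rule tame_curve_interior)
    show "continuous_on {0..1} (\<lambda>t. \<Gamma> t \<alpha> i)" for \<alpha> i
      by (cases "\<alpha> = (\<lambda>_. 0)") (auto simp: \<Gamma>_def const_coeff_def intro!: continuous_intros)
    show "coeff_map A (\<Gamma> t) ` cball 0 1 \<subseteq> interior S" if "t \<in> {0..1}" for t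
      using that assms(3) by (auto simp: \<Gamma>_def coeff_map_const[OF A] closed_segment_def)
  qed
  then show ?thesis unfolding joined_def by (intro exI[of _ \<Gamma>] exI[of _ "{}"]) (simp add: \<Gamma>_def)
qed

lemma joined_contract:
  fixes S :: "(real^'n) set" and A :: "('m::finite \<Rightarrow> nat) set"
  assumes A: "finite A" "(\<lambda>_. 0) \<in> A" and P: "coeff_map A P ` cball 0 1 \<subseteq> interior S"
  shows "joined S A (const_coeff (coeff_map A P 0)) P" "joined S A P (const_coeff (coeff_map A P 0))"
proof -
  \<comment> \<open>Composition with scaling by \<open>t\<close> multiplies a monomial by t to its
    total degree; at t = 0 only the constant term survives.\<close>
  define \<Gamma> where "\<Gamma> t \<alpha> i = P \<alpha> i * t ^ (\<Sum>j\<in>UNIV. \<alpha> j)" for t :: real and \<alpha> :: "'m \<Rightarrow> nat" and i :: 'n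
  have \<Gamma>: "coeff_map A (\<Gamma> t) x = coeff_map A P (t *\<^sub>R x)" for t x
    by (simp add: coeff_map_def \<Gamma>_def monomial_def power_mult_distrib prod.distrib power_sum mult.assoc)
  have im: "coeff_map A (\<Gamma> t) ` cball 0 1 \<subseteq> interior S" if "t \<in> {0..1}" for t
  proof safe
    fix x :: "real^'m" assume "x \<in> cball 0 1"
    then have "t *\<^sub>R x \<in> cball 0 1" using that by (simp add: mult_le_one)
    then show "coeff_map A (\<Gamma> t) x \<in> interior S" using P unfolding \<Gamma> by blast
  qed
  have m0: "monomial \<alpha> (0 :: real^'m) = (if \<alpha> = (\<lambda>_. 0) then 1 else 0)" for \<alpha> :: "'m \<Rightarrow> nat"
  proof (cases "\<alpha> = (\<lambda>_. 0)")
    case False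
    then obtain j where "\<alpha> j \<noteq> 0" by auto
    then show ?thesis using False by (auto simp: monomial_def prod_zero_iff power_0_left intro!: exI[of _ j])
  qed (simp add: monomial_def)
  have \<Gamma>0: "\<Gamma> 0 = const_coeff (coeff_map A P 0)"
  proof (intro ext)
    fix \<alpha> i
    have "coeff_map A P 0 $ i = (\<Sum>\<alpha>\<in>A. if \<alpha> = (\<lambda>_. 0) then P \<alpha> i else 0)"
      by (simp add: coeff_map_def m0 if_distrib cong: if_cong)
    also have "\<dots> = P (\<lambda>_. 0) i" using A by simp
    finally have e: "coeff_map A P 0 $ i = P (\<lambda>_. 0) i" .
    show "\<Gamma> 0 \<alpha> i = const_coeff (coeff_map A P 0) \<alpha> i"
    proof (cases "\<alpha> = (\<lambda>_. 0)")
      case False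
      then obtain j where "\<alpha> j \<noteq> 0" by auto
      then have "(\<Sum>j\<in>UNIV. \<alpha> j) \<noteq> 0" by auto
      then show ?thesis using False
        by (simp only: \<Gamma>_def const_coeff_def power_0_left if_False mult_zero_right)
    qed (simp add: \<Gamma>_def const_coeff_def e)
  qed
  have "tame_curve S A \<Gamma> 0 1 {}"
    by (rule tame_curve_interior) (auto simp: \<Gamma>_def intro!: continuous_intros im[unfolded \<Gamma>_def[abs_def]] im[THEN subsetD])
  then show "joined S A (const_coeff (coeff_map A P 0)) P" unfolding joined_def
    by (intro exI[of _ \<Gamma>] exI[of _ "{}"]) (simp add: \<Gamma>0 \<Gamma>_def[of 1, abs_def])
  have "tame_curve S A (\<lambda>t. \<Gamma> (1 - t)) 0 1 {}"
  proof (rule tame_curve_interior)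
    show "continuous_on {0..1} (\<lambda>t. \<Gamma> (1 - t) \<alpha> i)" for \<alpha> i unfolding \<Gamma>_def by (intro continuous_intros)
  qed (rule im, simp)
  then show "joined S A P (const_coeff (coeff_map A P 0))" unfolding joined_def
    by (intro exI[of _ "\<lambda>t. \<Gamma> (1 - t)"] exI[of _ "{}"]) (simp add: \<Gamma>0 \<Gamma>_def[of 1, abs_def])
qed

text \<open>The bound on the values is carried along because the estimate for products needs
  it.\<close>

lemma real_polynomial_function_Lipschitz:
  fixes g :: "'a::real_normed_vector \<Rightarrow> real"
  assumes "real_polynomial_function g"
  shows "\<exists>K\<ge>0. (\<forall>y\<in>cball z R. \<bar>g y\<bar> \<le> K) \<and> (\<forall>x\<in>cball z R. \<forall>y\<in>cball z R. \<bar>g x - g y\<bar> \<le> K * dist x y)"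
  using assms
proof (induction rule: real_polynomial_function.induct)
  case (linear f)
  obtain K where K: "K \<ge> 0" "\<And>x. norm (f x) \<le> norm x * K" using bounded_linear.nonneg_bounded[OF linear] by blast
  have n: "norm y \<le> norm z + \<bar>R\<bar>" if "y \<in> cball z R" for y
    using that norm_triangle_ineq2[of y z] by (simp add: dist_norm norm_minus_commute)
  have "\<bar>f y\<bar> \<le> K * (norm z + \<bar>R\<bar> + 1)" if "y \<in> cball z R" for y
  proof -
    have "\<bar>f y\<bar> \<le> norm y * K" using K(2)[of y] by simp
    also have "\<dots> \<le> (norm z + \<bar>R\<bar> + 1) * K" using n[OF that] K(1) by (intro mult_right_mono) auto
    finally show ?thesis by (simp add: mult.commute)
  qed
  moreover have "\<bar>f x - f y\<bar> \<le> K * (norm z + \<bar>R\<bar> + 1) * dist x y" for x y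
  proof -
    have "\<bar>f x - f y\<bar> \<le> K * dist x y"
      using K(2)[of "x - y"] linear by (simp add: bounded_linear.linear linear_diff dist_norm mult.commute)
    also have "\<dots> \<le> K * (norm z + \<bar>R\<bar> + 1) * dist x y"
      using K(1) by (intro mult_right_mono mult_le_cancel_left1[THEN iffD2]) (auto simp: not_less)
    finally show ?thesis .
  qed
  ultimately show ?case using K(1) by (intro exI[of _ "K * (norm z + \<bar>R\<bar> + 1)"]) auto
next
  case (const c)
  show ?case by (rule exI[of _ "\<bar>c\<bar>"]) simp
next
  case (add f g)
  then obtain K L where K: "K \<ge> 0" "\<forall>y\<in>cball z R. \<bar>f y\<bar> \<le> K" "\<forall>x\<in>cball z R. \<forall>y\<in>cball z R. \<bar>f x - f y\<bar> \<le> K * dist x y"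
    and L: "L \<ge> 0" "\<forall>y\<in>cball z R. \<bar>g y\<bar> \<le> L" "\<forall>x\<in>cball z R. \<forall>y\<in>cball z R. \<bar>g x - g y\<bar> \<le> L * dist x y" by blast
  have "\<bar>f x + g x - (f y + g y)\<bar> \<le> (K + L) * dist x y" if "x \<in> cball z R" "y \<in> cball z R" for x y
    using bspec[OF bspec[OF K(3) that(1)] that(2)] bspec[OF bspec[OF L(3) that(1)] that(2)] unfolding distrib_right by linarith
  moreover have "\<bar>f y + g y\<bar> \<le> K + L" if "y \<in> cball z R" for y
    using bspec[OF K(2) that] bspec[OF L(2) that] by linarith
  ultimately show ?case using K(1) L(1) by (intro exI[of _ "K + L"]) auto
next
  case (mult f g)
  then obtain K L where K: "K \<ge> 0" "\<forall>y\<in>cball z R. \<bar>f y\<bar> \<le> K" "\<forall>x\<in>cball z R. \<forall>y\<in>cball z R. \<bar>f x - f y\<bar> \<le> K * dist x y"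
    and L: "L \<ge> 0" "\<forall>y\<in>cball z R. \<bar>g y\<bar> \<le> L" "\<forall>x\<in>cball z R. \<forall>y\<in>cball z R. \<bar>g x - g y\<bar> \<le> L * dist x y" by blast
  have "\<bar>f x * g x - f y * g y\<bar> \<le> (2 * (K * L)) * dist x y" if "x \<in> cball z R" "y \<in> cball z R" for x y
  proof -
    have "f x * g x - f y * g y = f x * (g x - g y) + (f x - f y) * g y" by (simp add: algebra_simps)
    then have "\<bar>f x * g x - f y * g y\<bar> \<le> \<bar>f x\<bar> * \<bar>g x - g y\<bar> + \<bar>f x - f y\<bar> * \<bar>g y\<bar>"
      by (metis abs_mult abs_triangle_ineq)
    also have "\<dots> \<le> K * (L * dist x y) + (K * dist x y) * L"
      using K L that by (intro add_mono mult_mono) auto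
    finally show ?thesis by (simp add: algebra_simps)
  qed
  moreover have "\<bar>f y * g y\<bar> \<le> 2 * (K * L)" if "y \<in> cball z R" for y
  proof -
    have "\<bar>f y\<bar> * \<bar>g y\<bar> \<le> K * L" using K L that by (intro mult_mono) auto
    moreover have "0 \<le> K * L" using K(1) L(1) by simp
    ultimately show ?thesis by (simp add: abs_mult)
  qed
  ultimately show ?case using K(1) L(1) by (intro exI[of _ "2 * (K * L)"]) auto
qed

text \<open>A zero of \<open>g\<close> too close to \<beta> s would, by the Lipschitz estimate,
  contradict the lower bound for \<open>g\<close> along the path. So a ball of radius c' |s -
  \<tau>|^k around \<beta> s misses the frontier of \<open>S\<close>; being connected and meeting
  \<open>S\<close>, it lies in \<open>S\<close>.\<close>

lemma analytic_tame_curve: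
  fixes S :: "(real^'n) set" and A :: "('m::finite \<Rightarrow> nat) set"
  assumes A: "finite A" "(\<lambda>_. 0) \<in> A"
    and g: "real_polynomial_function g" "frontier S \<subseteq> {x. g x = 0}"
    and \<alpha>: "analytic_path \<alpha>" "\<alpha> ` {0..1} \<subseteq> S" "g (\<alpha> 0) \<noteq> 0" "g (\<alpha> 1) \<noteq> 0"
  shows "joined S A (const_coeff (\<alpha> 0)) (const_coeff (\<alpha> 1))"
proof -
  obtain U \<beta> where U: "open U" "{0..1} \<subseteq> U" "real_analytic_on \<beta> U" and eq: "\<And>t. t \<in> {0..1} \<Longrightarrow> \<alpha> t = \<beta> t"
    using \<alpha>(1) unfolding analytic_path_def by blast
  have \<beta>S: "\<beta> t \<in> S" if "t \<in> {0..1}" for t using \<alpha>(2) eq[OF that] that by force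
  have g0: "g (\<beta> 0) \<noteq> 0" "g (\<beta> 1) \<noteq> 0" using \<alpha>(3,4) eq[of 0] eq[of 1] by auto
  note lb = analytic_lower_bound[OF U(3,1,2) g(1) g0(1)]
  have ev_ne: "\<forall>\<^sub>F s in at t. s \<noteq> t" for t :: real by (simp add: eventually_at_filter)
  have isC: "isCont \<beta> t" if t: "t \<in> {0..1}" for t
  proof -
    have "isCont (\<lambda>s. \<beta> s $ i) t" for i
    proof -
      obtain F where "(\<lambda>h. \<beta> (t + h) $ i) has_fps_expansion F"
        using real_analytic_on_expansion[OF U(3), of t i] t U(2) by blast
      then have "isCont (\<lambda>h. \<beta> (t + h) $ i) 0" using has_fps_expansion_imp_continuous[of _ F UNIV] by simp
      then show ?thesis using isCont_o2[of t "\<lambda>s. s - t" "\<lambda>h. \<beta> (t + h) $ i"] by simp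
    qed
    then show ?thesis unfolding isCont_def by (intro vec_tendstoI)
  qed
  define F where "F = {t\<in>{0..1}. g (\<beta> t) = 0}"
  \<comment> \<open>Zeros of finite order are isolated, and the interval is compact.\<close>
  have finF: "finite F"
  proof (rule ccontr)
    assume "infinite F"
    then obtain x where x: "x \<in> {0..1}" "x islimpt F"
      using compact_eq_Bolzano_Weierstrass[of "{0..1::real}"] unfolding F_def by (metis (no_types, lifting) compact_Icc mem_Collect_eq subsetI)
    obtain k c where c: "c > 0" "\<forall>\<^sub>F s in at x. c * \<bar>s - x\<bar> ^ k \<le> \<bar>g (\<beta> s)\<bar>" using lb[OF x(1)] by blast
    have "\<forall>\<^sub>F s in at x. s \<notin> F" using c(2) ev_ne[of x]
    proof eventually_elim
      case (elim s)
      then have "0 < c * \<bar>s - x\<bar> ^ k" using c(1) by simp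
      then show ?case using elim by (auto simp: F_def)
    qed
    then show False using x(2) by (simp add: islimpt_iff_eventually)
  qed
  have F01: "F \<subseteq> {0<..<1}" using g0 by (auto simp: F_def order_le_less)
  have "tame_curve S A (\<lambda>t. const_coeff (\<beta> t)) 0 1 F"
    unfolding tame_curve_def tame_at_def coeff_map_const[OF A]
  proof (intro conjI ballI allI finF F01)
    show "continuous_on {0..1} (\<lambda>t. const_coeff (\<beta> t) \<alpha> i)" for \<alpha> :: "'m \<Rightarrow> nat" and i
    proof -
      have "continuous_on {0..1} \<beta>" using isC by (simp add: continuous_at_imp_continuous_on)
      then show ?thesis by (cases "\<alpha> = (\<lambda>_. 0)") (auto simp: const_coeff_def intro!: continuous_intros)
    qed
    fix t assume t: "t \<in> {0..1} - F"
    then have "\<beta> t \<notin> frontier S" using g(2) by (auto simp: F_def)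
    then have "\<beta> t \<in> interior S" using \<beta>S[of t] t closure_subset[of S] by (auto simp: frontier_def)
    then show "\<exists>r>0. safe S A (const_coeff (\<beta> t)) r"
      by (intro safe_if_interior) (auto simp: coeff_map_const[OF A])
  next
    fix \<tau> assume \<tau>: "\<tau> \<in> F"
    then have \<tau>1: "\<tau> \<in> {0..1}" "\<tau> \<in> U" using U(2) by (auto simp: F_def)
    show "(\<lambda>x. \<beta> \<tau>) ` cball 0 1 \<subseteq> S" using \<beta>S[OF \<tau>1(1)] by auto
    obtain k c where c: "c > 0" "\<forall>\<^sub>F s in at \<tau>. c * \<bar>s - \<tau>\<bar> ^ k \<le> \<bar>g (\<beta> s)\<bar>" using lb[OF \<tau>1(1)] by blast
    obtain K where K: "K \<ge> 0" "\<And>x y. x \<in> cball (\<beta> \<tau>) 1 \<Longrightarrow> y \<in> cball (\<beta> \<tau>) 1 \<Longrightarrow> \<bar>g x - g y\<bar> \<le> K * dist x y"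
      using real_polynomial_function_Lipschitz[OF g(1), of "\<beta> \<tau>" 1] by blast
    \<comment> \<open>The first bound makes (K + 1) c' at most \<open>c\<close>; the second keeps
      the ball inside the unit ball around \<beta> \<tau>, where \<open>K\<close> is valid.\<close>
    define c' where "c' = min (c / (K + 1)) (1/2)"
    have c': "c' > 0" using c(1) K(1) by (simp add: c'_def)
    have c'2: "c' \<le> 1/2" unfolding c'_def by (rule min.cobounded2)
    have "(K + 1) * c' \<le> (K + 1) * (c / (K + 1))" using K(1) by (intro mult_left_mono) (auto simp: c'_def)
    then have c'K: "(K + 1) * c' \<le> c" using K(1) by simp
    have e1: "\<forall>\<^sub>F s in at \<tau>. dist (\<beta> s) (\<beta> \<tau>) < 1/2"
      using isC[OF \<tau>1(1)] tendstoD[of \<beta> "\<beta> \<tau>" "at \<tau>" "1/2"] by (simp add: isCont_def)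
    have "0 < \<tau>" "\<tau> < 1" using \<tau> F01 by auto
    then have e2: "\<forall>\<^sub>F s in at \<tau>. 0 < s" "\<forall>\<^sub>F s in at \<tau>. s < 1"
      by (auto intro: order_tendstoD[OF tendsto_ident_at])
    have "\<forall>\<^sub>F s in at \<tau>. safe S A (const_coeff (\<beta> s)) (c' * \<bar>s - \<tau>\<bar> ^ k)"
      using c(2) e1 e2 ev_ne[of \<tau>]
    proof eventually_elim
      case (elim s)
      have "\<bar>s - \<tau>\<bar> \<le> 1" using elim \<open>0 < \<tau>\<close> \<open>\<tau> < 1\<close> by auto
      then have "c' * \<bar>s - \<tau>\<bar> ^ k \<le> 1/2 * 1" using c' c'2 by (intro mult_mono) (auto intro: power_le_one)
      then have r: "c' * \<bar>s - \<tau>\<bar> ^ k \<le> 1/2" by simp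
      have pos: "0 < \<bar>s - \<tau>\<bar> ^ k" using elim by simp
      have nz: "g y \<noteq> 0" if y: "y \<in> ball (\<beta> s) (c' * \<bar>s - \<tau>\<bar> ^ k)" for y
      proof
        assume "g y = 0"
        have "y \<in> cball (\<beta> \<tau>) 1" using y r elim(2) dist_triangle[of "\<beta> \<tau>" y "\<beta> s"] by (simp add: dist_commute)
        moreover have "\<beta> s \<in> cball (\<beta> \<tau>) 1" using elim(2) by (simp add: dist_commute)
        ultimately have "\<bar>g (\<beta> s)\<bar> \<le> K * dist (\<beta> s) y" using K(2)[of "\<beta> s" y] \<open>g y = 0\<close> by simp
        also have "\<dots> \<le> K * (c' * \<bar>s - \<tau>\<bar> ^ k)" using y K(1) by (intro mult_left_mono) auto
        also have "\<dots> < ((K + 1) * c') * \<bar>s - \<tau>\<bar> ^ k" using c' pos by (simp add: algebra_simps)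
        also have "\<dots> \<le> c * \<bar>s - \<tau>\<bar> ^ k" using c'K pos by (intro mult_right_mono) auto
        finally show False using elim(1) by simp
      qed
      have "ball (\<beta> s) (c' * \<bar>s - \<tau>\<bar> ^ k) \<subseteq> S"
      proof (rule ccontr)
        assume "\<not> ?thesis"
        then have 1: "ball (\<beta> s) (c' * \<bar>s - \<tau>\<bar> ^ k) - S \<noteq> {}" by blast
        have "\<beta> s \<in> ball (\<beta> s) (c' * \<bar>s - \<tau>\<bar> ^ k) \<inter> S" using \<beta>S[of s] elim c' pos by simp
        then have "ball (\<beta> s) (c' * \<bar>s - \<tau>\<bar> ^ k) \<inter> S \<noteq> {}" by blast
        from connected_Int_frontier[OF connected_ball this 1]
        have "ball (\<beta> s) (c' * \<bar>s - \<tau>\<bar> ^ k) \<inter> frontier S \<noteq> {}" .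
        then show False using nz g(2) by blast
      qed
      then show ?case by (simp add: safe_def coeff_map_const[OF A])
    qed
    then show "\<exists>L c. c > 0 \<and> (\<forall>\<^sub>F t in at \<tau>. safe S A (const_coeff (\<beta> t)) (c * \<bar>t - \<tau>\<bar> ^ L))" using c' by blast
    fix M
    have "\<exists>q. \<forall>\<^sub>F h in at 0. \<bar>\<beta> (\<tau> + h) $ i - poly q h\<bar> \<le> \<bar>h\<bar> ^ M" for i
      using real_analytic_on_expansion[OF U(3) \<tau>1(2), of i] has_fps_expansion_jet by blast
    then obtain q where q: "\<And>i. \<forall>\<^sub>F h in at 0. \<bar>\<beta> (\<tau> + h) $ i - poly (q i) h\<bar> \<le> \<bar>h\<bar> ^ M" by metis
    define q' where "q' \<alpha> i = (if \<alpha> = (\<lambda>_. 0) then pcompose (q i) [:- \<tau>, 1:] else 0)" for \<alpha> :: "'m \<Rightarrow> nat" and i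
    have "\<forall>\<^sub>F t in at \<tau>. \<bar>const_coeff (\<beta> t) \<alpha> i - poly (q' \<alpha> i) t\<bar> \<le> \<bar>t - \<tau>\<bar> ^ M" for \<alpha> i
      using q[of i] unfolding eventually_at_shift[of _ \<tau>]
      by eventually_elim (simp add: q'_def const_coeff_def poly_pcompose)
    then show "\<exists>q. \<forall>\<alpha>\<in>A. \<forall>i. \<forall>\<^sub>F t in at \<tau>. \<bar>const_coeff (\<beta> t) \<alpha> i - poly (q \<alpha> i) t\<bar> \<le> \<bar>t - \<tau>\<bar> ^ M" by blast
  qed
  then show ?thesis unfolding joined_def using eq[of 0] eq[of 1]
    by (intro exI[of _ "\<lambda>t. const_coeff (\<beta> t)"] exI[of _ F]) simp
qed

text \<open>The analytic path has to start and end off the zero set of \<open>g\<close>, on which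
  the given points may lie; short segments inside the interior lead away from it.\<close>

lemma joined_interior_points:
  fixes S :: "(real^'n) set" and A :: "('m::finite \<Rightarrow> nat) set"
  assumes A: "finite A" "(\<lambda>_. 0) \<in> A"
    and g: "real_polynomial_function g" "g w \<noteq> 0" "frontier S \<subseteq> {x. g x = 0}"
    and S: "connected_by_analytic_paths S" and yz: "y \<in> interior S" "z \<in> interior S"
  shows "joined S A (const_coeff y) (const_coeff z)"
proof -
  have near: "\<exists>y'. closed_segment y y' \<subseteq> interior S \<and> g y' \<noteq> 0" if y: "y \<in> interior S" for y
  proof -
    obtain e where e: "e > 0" "ball y e \<subseteq> interior S" using y open_interior open_contains_ball by blast
    obtain y' where "dist y y' < e" "g y' \<noteq> 0" using real_polynomial_function_nonzero_dense[OF g(1,2) e(1)] by blast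
    then have "closed_segment y y' \<subseteq> ball y e" using e(1) by (intro closed_segment_subset) auto
    then show ?thesis using e(2) \<open>g y' \<noteq> 0\<close> by blast
  qed
  obtain y' z' where y': "closed_segment y y' \<subseteq> interior S" "g y' \<noteq> 0"
    and z': "closed_segment z z' \<subseteq> interior S" "g z' \<noteq> 0" using near yz by blast
  have "y' \<in> S" "z' \<in> S" using y'(1) z'(1) interior_subset by auto
  then obtain \<alpha> where \<alpha>: "analytic_path \<alpha>" "\<alpha> ` {0..1} \<subseteq> S" "\<alpha> 0 = y'" "\<alpha> 1 = z'"
    using S unfolding connected_by_analytic_paths_def by blast
  have "joined S A (const_coeff y') (const_coeff z')"
    using analytic_tame_curve[OF A g(1,3) \<alpha>(1,2)] \<alpha>(3,4) y'(2) z'(2) by simp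
  moreover have "joined S A (const_coeff y) (const_coeff y')" by (rule joined_segment[OF A y'(1)])
  moreover have "joined S A (const_coeff z') (const_coeff z)"
    by (rule joined_segment[OF A]) (use z'(1) in \<open>simp add: closed_segment_commute\<close>)
  ultimately show ?thesis using joined_trans by blast
qed

text \<open>The coefficient curve has its margin only for positive parameters, so it is run down to
  0 and back the same way. Before and after, the map is contracted to a constant, so that the loop
  starts and ends at an interior point.\<close>

lemma brick_loop:
  fixes q :: "('m::finite \<Rightarrow> nat) \<Rightarrow> 'n::finite \<Rightarrow> real poly"
  assumes A: "finite A" "(\<lambda>_. 0) \<in> A" and \<epsilon>: "\<epsilon> > 0" and C: "C > 0"
    and im: "coeff_map A (\<lambda>\<alpha> i. poly (q \<alpha> i) 0) ` cball 0 1 \<subseteq> S"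
    and margin: "\<And>s. 0 < s \<Longrightarrow> s < \<epsilon> \<Longrightarrow> safe S A (\<lambda>\<alpha> i. poly (q \<alpha> i) s) (C * s ^ L)"
  shows "\<exists>y\<in>interior S. \<exists>\<Gamma> F. tame_curve S A \<Gamma> 0 1 F \<and> 1/2 \<in> F \<and> (\<forall>\<alpha>\<in>A. \<Gamma> 0 \<alpha> = const_coeff y \<alpha>) \<and>
    (\<forall>\<alpha>\<in>A. \<Gamma> 1 \<alpha> = const_coeff y \<alpha>) \<and> (\<forall>\<alpha>\<in>A. \<Gamma> (1/2) \<alpha> = (\<lambda>i. poly (q \<alpha> i) 0))"
proof -
  \<comment> \<open>Chosen with e^2 <= e < \<epsilon>, so that the parameter \<open>s t\<close>
    below stays in the admissible range.\<close>
  define e where "e = min 1 \<epsilon> / 2"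
  have e: "0 < e" "e \<le> 1/2" "e < \<epsilon>" using \<epsilon> by (auto simp: e_def min_def)
  have e2: "0 < e\<^sup>2" "e\<^sup>2 < \<epsilon>"
  proof -
    have "e * e \<le> e * 1" using e by (intro mult_left_mono) auto
    then show "e\<^sup>2 < \<epsilon>" using e(3) by (simp add: power2_eq_square)
  qed (use e in simp)
  define P where "P \<alpha> i = poly (q \<alpha> i) (e\<^sup>2)" for \<alpha> i
  have P: "coeff_map A P ` cball 0 1 \<subseteq> interior S"
  proof safe
    fix x :: "real^'m" assume "x \<in> cball 0 1"
    then have "ball (coeff_map A P x) (C * (e\<^sup>2) ^ L) \<subseteq> S" using margin[OF e2] by (auto simp: safe_def P_def[abs_def])
    then show "coeff_map A P x \<in> interior S" using C e2(1) by (auto simp: mem_interior intro!: exI[of _ "C * (e\<^sup>2) ^ L"])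
  qed
  define y where "y = coeff_map A P 0"
  have y: "y \<in> interior S" using P by (auto simp: y_def)
  \<comment> \<open>Nonnegative, zero exactly at 1/2, and polynomial in \<open>t\<close>, so that
    \<open>M\<close> is its own jet; the price is a doubled order of contact.\<close>
  define s where "s t = (e * (2 * t - 1))\<^sup>2" for t :: real
  define M where "M t \<alpha> i = poly (q \<alpha> i) (s t)" for t \<alpha> i
  have s_pos: "0 < s t" if "t \<noteq> 1/2" for t using that e(1) by (simp add: s_def)
  have s_less: "s t < \<epsilon>" if "t \<in> {0..1}" for t
  proof -
    have "\<bar>2 * t - 1\<bar> \<le> 1" using that by auto
    then have "(2 * t - 1)\<^sup>2 \<le> 1" by (simp add: abs_square_le_1)
    then have "e\<^sup>2 * (2 * t - 1)\<^sup>2 \<le> e\<^sup>2 * 1" by (intro mult_left_mono) auto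
    then show ?thesis using e2(2) by (simp add: s_def power_mult_distrib)
  qed
  have tM: "tame_curve S A M 0 1 {1/2}"
    unfolding tame_curve_def
  proof (intro conjI ballI allI)
    show "continuous_on {0..1} (\<lambda>t. M t \<alpha> i)" for \<alpha> i
      unfolding M_def s_def by (intro continuous_intros)
    show "\<exists>r>0. safe S A (M t) r" if "t \<in> {0..1} - {1/2}" for t
      using margin[OF s_pos s_less, of t] that C s_pos[of t]
      by (intro exI[of _ "C * s t ^ L"]) (simp add: M_def[abs_def])
    fix \<tau> :: real assume "\<tau> \<in> {1/2}"
    then have \<tau>: "\<tau> = 1/2" by simp
    show "tame_at S A M \<tau>" unfolding tame_at_def
    proof (intro conjI allI)
      show "coeff_map A (M \<tau>) ` cball 0 1 \<subseteq> S" using im by (simp add: M_def[abs_def] \<tau> s_def)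
      have ev: "\<forall>\<^sub>F t in at \<tau>. 0 < t" "\<forall>\<^sub>F t in at \<tau>. t < 1" "\<forall>\<^sub>F t in at \<tau>. t \<noteq> \<tau>"
      proof -
        show "\<forall>\<^sub>F t in at \<tau>. 0 < t" by (rule order_tendstoD(1)[OF tendsto_ident_at]) (simp add: \<tau>)
        show "\<forall>\<^sub>F t in at \<tau>. t < 1" by (rule order_tendstoD(2)[OF tendsto_ident_at]) (simp add: \<tau>)
        show "\<forall>\<^sub>F t in at \<tau>. t \<noteq> \<tau>" by (simp add: eventually_at_filter)
      qed
      have "\<forall>\<^sub>F t in at \<tau>. safe S A (M t) ((C * (2 * e) ^ (2 * L)) * \<bar>t - \<tau>\<bar> ^ (2 * L))"
        using ev
      proof eventually_elim
        case (elim t)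
        have st: "s t = ((2 * e) * \<bar>t - \<tau>\<bar>)\<^sup>2" by (simp add: s_def \<tau> power_mult_distrib) (simp add: power2_eq_square algebra_simps)
        then have m: "C * s t ^ L = (C * (2 * e) ^ (2 * L)) * \<bar>t - \<tau>\<bar> ^ (2 * L)"
          by (simp only: st power_mult[symmetric] power_mult_distrib mult.assoc)
        have "safe S A (M t) (C * s t ^ L)"
          using margin[OF s_pos s_less, of t] elim \<tau> by (simp add: M_def[abs_def])
        then show ?case unfolding m .
      qed
      then show "\<exists>L c. c > 0 \<and> (\<forall>\<^sub>F t in at \<tau>. safe S A (M t) (c * \<bar>t - \<tau>\<bar> ^ L))"
        using C e(1) by (intro exI[of _ "2 * L"] exI[of _ "C * (2 * e) ^ (2 * L)"]) simp
      fix m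
      have "poly (pcompose (q \<alpha> i) ([:- e, 2 * e:]\<^sup>2)) t = M t \<alpha> i" for \<alpha> i t
        by (simp add: poly_pcompose M_def s_def algebra_simps)
      then show "\<exists>q. \<forall>\<alpha>\<in>A. \<forall>i. \<forall>\<^sub>F t in at \<tau>. \<bar>M t \<alpha> i - poly (q \<alpha> i) t\<bar> \<le> \<bar>t - \<tau>\<bar> ^ m"
        by (intro exI[of _ "\<lambda>\<alpha> i. pcompose (q \<alpha> i) ([:- e, 2 * e:]\<^sup>2)"]) simp
    qed
  qed auto
  have M01: "M 0 = P" "M 1 = P" by (auto simp: M_def P_def s_def fun_eq_iff)
  define M' where "M' t = M ((t - 1/4) / (3/4 - 1/4))" for t
  have "tame_curve S A M' (1/4) (3/4) ((\<lambda>s. 1/4 + (3/4 - 1/4) * s) ` {1/2})"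
    unfolding M'_def[abs_def] by (rule tame_curve_affine[OF tM]) simp
  then have tM': "tame_curve S A M' (1/4) (3/4) {1/2}" by simp
  have M': "M' (1/4) = P" "M' (3/4) = P" "M' (1/2) = (\<lambda>\<alpha> i. poly (q \<alpha> i) 0)"
    using M01 by (auto simp: M'_def M_def s_def fun_eq_iff)
  obtain G1 F1 where G1: "tame_curve S A G1 0 (1/4) F1" "\<And>\<alpha>. \<alpha> \<in> A \<Longrightarrow> G1 0 \<alpha> = const_coeff y \<alpha>" "\<And>\<alpha>. \<alpha> \<in> A \<Longrightarrow> G1 (1/4) \<alpha> = P \<alpha>"
    using joined_on[OF joined_contract(1)[OF A P], of 0 "1/4"] unfolding y_def by auto
  obtain G2 F2 where G2: "tame_curve S A G2 (3/4) 1 F2" "\<And>\<alpha>. \<alpha> \<in> A \<Longrightarrow> G2 (3/4) \<alpha> = P \<alpha>" "\<And>\<alpha>. \<alpha> \<in> A \<Longrightarrow> G2 1 \<alpha> = const_coeff y \<alpha>"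
    using joined_on[OF joined_contract(2)[OF A P], of "3/4" 1] unfolding y_def by auto
  define H where "H t = (if t \<le> 1/4 then G1 t else M' t)" for t
  have tH: "tame_curve S A H 0 (3/4) (F1 \<union> {1/2})"
    unfolding H_def by (rule tame_curve_concat[OF G1(1) tM']) (use G1(3) M'(1) in auto)
  have "tame_curve S A (\<lambda>t. if t \<le> 3/4 then H t else G2 t) 0 1 (F1 \<union> {1/2} \<union> F2)"
    by (rule tame_curve_concat[OF tH G2(1)]) (use G2(2) M'(2) in \<open>auto simp: H_def\<close>)
  then show ?thesis using y G1(2) G2(3) M'(3)
    by (intro bexI[of _ y] exI[of _ "\<lambda>t. if t \<le> 3/4 then H t else G2 t"] exI[of _ "F1 \<union> {1/2} \<union> F2"]) (auto simp: H_def)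
qed

text \<open>Induction over the nodes in increasing order. The right end is arbitrary and the last
  map a constant with value in the interior, so that the next loop can be attached. The nodes are
  made exceptional times because the later approximation keeps the values at those.\<close>

lemma tame_curve_through:
  fixes S :: "(real^'n) set" and A :: "('m::finite \<Rightarrow> nat) set"
  assumes A: "finite A" "(\<lambda>_. 0) \<in> A" and y0: "y0 \<in> interior S"
    and link: "\<And>y z. y \<in> interior S \<Longrightarrow> z \<in> interior S \<Longrightarrow> joined S A (const_coeff y) (const_coeff z)"
    and loop: "\<And>\<tau>. \<tau> \<in> N \<Longrightarrow> \<exists>y\<in>interior S. \<exists>\<Gamma> F. tame_curve S A \<Gamma> 0 1 F \<and> 1/2 \<in> F \<and> (\<forall>\<alpha>\<in>A. \<Gamma> 0 \<alpha> = const_coeff y \<alpha>) \<and>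
       (\<forall>\<alpha>\<in>A. \<Gamma> 1 \<alpha> = const_coeff y \<alpha>) \<and> (\<forall>\<alpha>\<in>A. \<Gamma> (1/2) \<alpha> = P \<tau> \<alpha>)"
    and N: "finite N" "N \<subseteq> {a<..<b}" and ab: "a < b"
  shows "\<exists>\<Gamma> F. \<exists>y\<in>interior S. tame_curve S A \<Gamma> a b F \<and> N \<subseteq> F \<and> (\<forall>\<alpha>\<in>A. \<Gamma> b \<alpha> = const_coeff y \<alpha>) \<and>
    (\<forall>\<tau>\<in>N. \<forall>\<alpha>\<in>A. \<Gamma> \<tau> \<alpha> = P \<tau> \<alpha>)"
  using N(1) loop N(2) ab
proof (induction N arbitrary: b rule: finite_linorder_max_induct)
  case empty
  have "tame_curve S A (\<lambda>_. const_coeff y0) a b {}"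
    by (rule tame_curve_interior) (use y0 in \<open>auto simp: coeff_map_const[OF A]\<close>)
  then show ?case using y0 by (intro exI[of _ "\<lambda>_. const_coeff y0"] exI[of _ "{}"] bexI[of _ y0]) auto
next
  case (insert \<tau> N)
  have \<tau>: "a < \<tau>" "\<tau> < b" using insert.prems by auto
  define m where "m = (Max (insert a N) + \<tau>) / 2"
  have mx: "Max (insert a N) < \<tau>" "a \<le> Max (insert a N)" "\<And>x. x \<in> N \<Longrightarrow> x \<le> Max (insert a N)"
    using insert.hyps \<tau> by auto
  have m: "a < m" "m < \<tau>" "\<And>x. x \<in> N \<Longrightarrow> x < m" using mx by (auto simp: m_def dest!: mx(3))
  have "N \<subseteq> {a<..<m}" using insert.prems(2) m(3) by auto
  from insert.IH[OF insert.prems(1) this m(1)]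
  obtain \<Gamma>1 F1 y1 where 1: "y1 \<in> interior S" "tame_curve S A \<Gamma>1 a m F1" "N \<subseteq> F1"
    "\<And>\<alpha>. \<alpha> \<in> A \<Longrightarrow> \<Gamma>1 m \<alpha> = const_coeff y1 \<alpha>" "\<And>\<tau> \<alpha>. \<tau> \<in> N \<Longrightarrow> \<alpha> \<in> A \<Longrightarrow> \<Gamma>1 \<tau> \<alpha> = P \<tau> \<alpha>" by auto
  obtain y \<Delta> F where l: "y \<in> interior S" "tame_curve S A \<Delta> 0 1 F" "1/2 \<in> F" "\<forall>\<alpha>\<in>A. \<Delta> 0 \<alpha> = const_coeff y \<alpha>"
       "\<forall>\<alpha>\<in>A. \<Delta> 1 \<alpha> = const_coeff y \<alpha>" "\<forall>\<alpha>\<in>A. \<Delta> (1/2) \<alpha> = P \<tau> \<alpha>"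
    using insert.prems(1)[of \<tau>] by auto
  define h where "h = min (\<tau> - m) (b - \<tau>) / 2"
  have h: "h > 0" "m < \<tau> - h" "\<tau> + h < b" using m(2) \<tau>(2) by (auto simp: h_def min_def field_simps)
  obtain \<Gamma>2 F2 where 2: "tame_curve S A \<Gamma>2 m (\<tau> - h) F2" "\<And>\<alpha>. \<alpha> \<in> A \<Longrightarrow> \<Gamma>2 m \<alpha> = const_coeff y1 \<alpha>"
    "\<And>\<alpha>. \<alpha> \<in> A \<Longrightarrow> \<Gamma>2 (\<tau> - h) \<alpha> = const_coeff y \<alpha>"
    using joined_on[OF link[OF 1(1) l(1)] h(2)] by auto
  define \<Gamma>3 where "\<Gamma>3 t = \<Delta> ((t - (\<tau> - h)) / (\<tau> + h - (\<tau> - h)))" for t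
  define F3 where "F3 = (\<lambda>s. \<tau> - h + (\<tau> + h - (\<tau> - h)) * s) ` F"
  have 3: "tame_curve S A \<Gamma>3 (\<tau> - h) (\<tau> + h) F3"
    unfolding \<Gamma>3_def F3_def by (rule tame_curve_affine[OF l(2)]) (use h in simp)
  have arg: "(\<tau> - (\<tau> - h)) / (\<tau> + h - (\<tau> - h)) = 1/2" "(\<tau> + h - (\<tau> - h)) / (\<tau> + h - (\<tau> - h)) = 1"
    using h(1) by (auto simp: field_simps)
  have \<Gamma>3: "\<And>\<alpha>. \<alpha> \<in> A \<Longrightarrow> \<Gamma>3 (\<tau> - h) \<alpha> = const_coeff y \<alpha>" "\<And>\<alpha>. \<alpha> \<in> A \<Longrightarrow> \<Gamma>3 (\<tau> + h) \<alpha> = const_coeff y \<alpha>"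
    "\<And>\<alpha>. \<alpha> \<in> A \<Longrightarrow> \<Gamma>3 \<tau> \<alpha> = P \<tau> \<alpha>"
    using l(4,5,6) unfolding \<Gamma>3_def arg by auto
  have \<tau>F3: "\<tau> \<in> F3" unfolding F3_def using l(3) by (intro image_eqI[of _ _ "1/2"]) auto
  have 4: "tame_curve S A (\<lambda>_. const_coeff y) (\<tau> + h) b {}"
    by (rule tame_curve_interior) (use l(1) in \<open>auto simp: coeff_map_const[OF A]\<close>)
  define G where "G t = (if t \<le> m then \<Gamma>1 t else \<Gamma>2 t)" for t
  have tG: "tame_curve S A G a (\<tau> - h) (F1 \<union> F2)"
    unfolding G_def by (rule tame_curve_concat[OF 1(2) 2(1) m(1) h(2)]) (simp add: 1(4) 2(2))
  define G' where "G' t = (if t \<le> \<tau> - h then G t else \<Gamma>3 t)" for t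
  have tG': "tame_curve S A G' a (\<tau> + h) (F1 \<union> F2 \<union> F3)"
    unfolding G'_def
  proof (rule tame_curve_concat[OF tG 3])
    show "G (\<tau> - h) \<alpha> = \<Gamma>3 (\<tau> - h) \<alpha>" if "\<alpha> \<in> A" for \<alpha>
      using that h(2) by (simp add: G_def 2(3) \<Gamma>3(1))
  qed (use m h in auto)
  define G'' where "G'' t = (if t \<le> \<tau> + h then G' t else const_coeff y)" for t
  have tG'': "tame_curve S A G'' a b (F1 \<union> F2 \<union> F3 \<union> {})"
    unfolding G''_def
  proof (rule tame_curve_concat[OF tG' 4])
    show "G' (\<tau> + h) \<alpha> = const_coeff y \<alpha>" if "\<alpha> \<in> A" for \<alpha>
      using that h by (simp add: G'_def \<Gamma>3(2))
  qed (use m h in auto)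
  have "G'' \<tau> \<alpha> = P \<tau> \<alpha>" if "\<alpha> \<in> A" for \<alpha> using that h(1) by (simp add: G''_def G'_def \<Gamma>3(3))
  moreover have "G'' \<sigma> \<alpha> = P \<sigma> \<alpha>" if "\<sigma> \<in> N" "\<alpha> \<in> A" for \<sigma> \<alpha>
    using m(3)[OF that(1)] h 1(5)[OF that] by (simp add: G''_def G'_def G_def)
  moreover have "G'' b \<alpha> = const_coeff y \<alpha>" for \<alpha> using h by (simp add: G''_def)
  moreover have "insert \<tau> N \<subseteq> F1 \<union> F2 \<union> F3 \<union> {}" using \<tau>F3 1(3) by auto
  ultimately show ?case using tG'' l(1)
    by (intro exI[of _ G''] exI[of _ "F1 \<union> F2 \<union> F3 \<union> {}"] bexI[of _ y]) auto
qed

section \<open>Uniform margins and interpolation of jets\<close>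

lemma compact_uniform_constant:
  fixes K :: "'a::metric_space set" and P :: "real \<Rightarrow> 'a \<Rightarrow> bool"
  assumes K: "compact K" and mono: "\<And>c c' t. P c t \<Longrightarrow> c' \<le> c \<Longrightarrow> P c' t"
    and loc: "\<And>x. x \<in> K \<Longrightarrow> \<exists>c>0. P c x \<and> (\<forall>\<^sub>F t in at x within K. P c t)"
  shows "\<exists>c>0. \<forall>t\<in>K. P c t"
proof -
  have "\<forall>x\<in>K. \<exists>c U. c > 0 \<and> open U \<and> x \<in> U \<and> (\<forall>t\<in>U \<inter> K. P c t)"
  proof
    fix x assume "x \<in> K"
    then obtain c where c: "c > 0" "P c x" "\<forall>\<^sub>F t in at x within K. P c t" using loc by blast
    then obtain U where "open U" "x \<in> U" "\<forall>t\<in>U. t \<noteq> x \<longrightarrow> t \<in> K \<longrightarrow> P c t" unfolding eventually_at_topological by blast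
    then show "\<exists>c U. c > 0 \<and> open U \<and> x \<in> U \<and> (\<forall>t\<in>U \<inter> K. P c t)" using c by (intro exI[of _ c] exI[of _ U]) auto
  qed
  from bchoice[OF this] obtain c where "\<forall>x\<in>K. \<exists>U. c x > 0 \<and> open U \<and> x \<in> U \<and> (\<forall>t\<in>U \<inter> K. P (c x) t)" ..
  from bchoice[OF this] obtain U where U: "\<forall>x\<in>K. c x > 0 \<and> open (U x) \<and> x \<in> U x \<and> (\<forall>t\<in>U x \<inter> K. P (c x) t)" ..
  obtain D where D: "D \<subseteq> K" "finite D" "K \<subseteq> (\<Union>x\<in>D. U x)"
    by (rule compactE_image[OF K, of K U]) (use U in auto)
  define d where "d = Min (insert 1 (c ` D))"
  have "d > 0" unfolding d_def using D(1,2) U by (subst Min_gr_iff) auto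
  moreover have "P d t" if t: "t \<in> K" for t
  proof -
    obtain x where x: "x \<in> D" "t \<in> U x" using D(3) t by auto
    then have "P (c x) t" using U D(1) t by blast
    moreover have "d \<le> c x" unfolding d_def using D(2) x(1) by (intro Min_le) auto
    ultimately show ?thesis by (rule mono)
  qed
  ultimately show ?thesis by blast
qed

text \<open>\<open>D\<close> is invertible modulo powers of t - \<tau>; the congruence is solved one
  power at a time.\<close>

lemma poly_dvd_adjust:
  fixes D r :: "real poly"
  assumes "poly D \<tau> \<noteq> 0" shows "\<exists>u. [:- \<tau>, 1:] ^ n dvd D * u - r"
proof (induction n)
  case (Suc n)
  then obtain u s where us: "D * u - r = [:- \<tau>, 1:] ^ n * s" by (auto elim: dvdE)
  define c where "c = poly s \<tau> / poly D \<tau>"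
  have "poly (s - smult c D) \<tau> = 0" using assms by (simp add: c_def)
  then have "[:- \<tau>, 1:] dvd s - smult c D" by (simp only: poly_eq_0_iff_dvd)
  then obtain v where v: "s - smult c D = [:- \<tau>, 1:] * v" by (rule dvdE)
  have "D * (u - smult c ([:- \<tau>, 1:] ^ n)) - r = [:- \<tau>, 1:] ^ n * (s - smult c D)"
    using us by (simp add: algebra_simps)
  also have "\<dots> = [:- \<tau>, 1:] ^ Suc n * v" unfolding v by (simp only: power_Suc mult_ac)
  finally show ?case by (metis dvd_triv_left)
qed simp

text \<open>Chinese remainders: \<open>D\<close> vanishes to order \<open>n\<close> at the earlier
  points, so adding a multiple of it adjusts the jet at the new point alone.\<close>

lemma hermite_interpolation:
  fixes q :: "real \<Rightarrow> real poly"
  assumes "finite F" shows "\<exists>h. \<forall>\<tau>\<in>F. [:- \<tau>, 1:] ^ n dvd h - q \<tau>"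
  using assms
proof (induction F rule: finite_induct)
  case (insert \<tau> F)
  then obtain h where h: "\<And>\<sigma>. \<sigma> \<in> F \<Longrightarrow> [:- \<sigma>, 1:] ^ n dvd h - q \<sigma>" by blast
  define D where "D = (\<Prod>\<sigma>\<in>F. [:- \<sigma>, 1:] ^ n)"
  have "poly D \<tau> \<noteq> 0" using insert.hyps by (auto simp: D_def poly_prod poly_power prod_zero_iff)
  then obtain u where u: "[:- \<tau>, 1:] ^ n dvd D * u - (q \<tau> - h)" using poly_dvd_adjust by blast
  have "[:- \<sigma>, 1:] ^ n dvd (h + D * u) - q \<sigma>" if "\<sigma> \<in> F" for \<sigma>
  proof -
    have "[:- \<sigma>, 1:] ^ n dvd D" unfolding D_def using insert.hyps(1) that by (rule dvd_prodI)
    then have "[:- \<sigma>, 1:] ^ n dvd (h - q \<sigma>) + D * u" using h[OF that] by (intro dvd_add dvd_mult2)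
    then show ?thesis by (simp add: algebra_simps)
  qed
  moreover have "[:- \<tau>, 1:] ^ n dvd (h + D * u) - q \<tau>" using u by (simp add: algebra_simps)
  ultimately show ?case by blast
qed simp

section \<open>Polynomial approximation\<close>

lemma eventually_at_poly_bounded:
  fixes p :: "real poly" shows "\<forall>\<^sub>F t in at \<tau> within K. \<bar>poly p t\<bar> < \<bar>poly p \<tau>\<bar> + 1"
proof -
  have "((\<lambda>t. \<bar>poly p t\<bar>) \<longlongrightarrow> \<bar>poly p \<tau>\<bar>) (at \<tau> within K)" by (intro tendsto_intros)
  then show ?thesis by (rule order_tendstoD) simp
qed

text \<open>The approximation is h + W R. Here \<open>W\<close> vanishes exactly on
  \<open>F\<close>, to at least the contact orders, and the margin is at least c |W| throughout. As
  \<open>h\<close> interpolates the jets beyond the order of \<open>W\<close>, the difference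
  divided by \<open>W\<close> is continuous and R comes from the Weierstrass theorem; the error is a
  small multiple of |W|.\<close>

theorem tame_curve_polynomial:
  fixes S :: "(real^'n) set" and A :: "('m::finite \<Rightarrow> nat) set"
  assumes \<Gamma>: "tame_curve S A \<Gamma> a b F" and A: "finite A"
  obtains p where "\<And>t. t \<in> {a..b} \<Longrightarrow> coeff_map A (\<lambda>\<alpha> i. poly (p \<alpha> i) t) ` cball 0 1 \<subseteq> S"
    "\<And>\<tau> \<alpha> i. \<tau> \<in> F \<Longrightarrow> \<alpha> \<in> A \<Longrightarrow> poly (p \<alpha> i) \<tau> = \<Gamma> \<tau> \<alpha> i"
proof -
  have F: "finite F" "F \<subseteq> {a<..<b}" and cont: "\<And>\<alpha> i. \<alpha> \<in> A \<Longrightarrow> continuous_on {a..b} (\<lambda>t. \<Gamma> t \<alpha> i)"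
    and safe: "\<And>t. t \<in> {a..b} - F \<Longrightarrow> \<exists>r>0. safe S A (\<Gamma> t) r"
    using \<Gamma> by (auto simp: tame_curve_def)
  have ev_ne: "\<forall>\<^sub>F t in at \<tau>. t \<noteq> \<tau>" for \<tau> :: real by (simp add: eventually_at_filter)
  have ev_near: "\<forall>\<^sub>F t in at \<tau>. \<bar>t - \<tau>\<bar> < 1" for \<tau> :: real
  proof -
    have "((\<lambda>t. \<bar>t - \<tau>\<bar>) \<longlongrightarrow> \<bar>\<tau> - \<tau>\<bar>) (at \<tau>)" by (intro tendsto_intros)
    then show ?thesis by (rule order_tendstoD) simp
  qed
  have "\<forall>\<tau>\<in>F. \<exists>L. \<exists>c>0. \<forall>\<^sub>F t in at \<tau>. safe S A (\<Gamma> t) (c * \<bar>t - \<tau>\<bar> ^ L)"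
    using tame_curve_safe[OF \<Gamma>] by blast
  from bchoice[OF this] obtain l where l: "\<forall>\<tau>\<in>F. \<exists>c>0. \<forall>\<^sub>F t in at \<tau>. safe S A (\<Gamma> t) (c * \<bar>t - \<tau>\<bar> ^ l \<tau>)" ..
  \<comment> \<open>A common exponent for all exceptional times. It is positive, so that
    \<open>W\<close> vanishes on \<open>F\<close> and the values there are kept.\<close>
  define L where "L = Suc (\<Sum>\<tau>\<in>F. l \<tau>)"
  have lL: "l \<tau> \<le> L" if "\<tau> \<in> F" for \<tau>
    using member_le_sum[of \<tau> F l] that F(1) by (simp add: L_def)
  define W where "W = (\<Prod>\<tau>\<in>F. [:- \<tau>, 1:] ^ L)"
  define V where "V \<tau> = (\<Prod>\<sigma>\<in>F - {\<tau>}. [:- \<sigma>, 1:] ^ L)" for \<tau>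
  have WV: "poly W t = (t - \<tau>) ^ L * poly (V \<tau>) t" if "\<tau> \<in> F" for \<tau> t
    unfolding W_def V_def by (subst prod.remove[OF F(1) that]) (simp add: poly_power)
  have V0: "poly (V \<tau>) \<tau> \<noteq> 0" for \<tau> using F(1) by (auto simp: V_def poly_prod poly_power prod_zero_iff)
  have W0: "poly W t = 0 \<longleftrightarrow> t \<in> F" for t
    using F(1) by (auto simp: W_def poly_prod poly_power prod_zero_iff L_def)
  define n where "n = real CARD('n) * real (card A)"
  have n0: "n \<ge> 0" by (simp add: n_def)
  \<comment> \<open>Near a point x of \<open>F\<close> the quotient |W| / |t - x|^L is bounded;
    elsewhere the margin persists by continuity of the coefficients. Compactness yields one
    constant.\<close>
  have "\<exists>c>0. \<forall>t\<in>{a..b}. safe S A (\<Gamma> t) (c * \<bar>poly W t\<bar>)"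
  proof (rule compact_uniform_constant)
    show "compact {a..b}" by simp
    show "safe S A (\<Gamma> t) (c' * \<bar>poly W t\<bar>)" if "safe S A (\<Gamma> t) (c * \<bar>poly W t\<bar>)" "c' \<le> c" for c c' t
      by (rule safe_mono[OF that(1)]) (use that(2) in \<open>simp add: mult_right_mono\<close>)
    fix x assume x: "x \<in> {a..b}"
    show "\<exists>c>0. safe S A (\<Gamma> x) (c * \<bar>poly W x\<bar>) \<and> (\<forall>\<^sub>F t in at x within {a..b}. safe S A (\<Gamma> t) (c * \<bar>poly W t\<bar>))"
    proof (cases "x \<in> F")
      case True
      obtain c where c: "c > 0" "\<forall>\<^sub>F t in at x. safe S A (\<Gamma> t) (c * \<bar>t - x\<bar> ^ l x)" using bspec[OF l True] by blast
      define B where "B = \<bar>poly (V x) x\<bar> + 1"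
      have B: "B > 0" by (simp add: B_def add_nonneg_pos)
      have "\<forall>\<^sub>F t in at x. safe S A (\<Gamma> t) (c / B * \<bar>poly W t\<bar>)"
        using c(2) ev_near[of x] eventually_at_poly_bounded[of "V x" x UNIV]
      proof eventually_elim
        case (elim t)
        have "c / B * \<bar>poly W t\<bar> = c * \<bar>t - x\<bar> ^ L * (\<bar>poly (V x) t\<bar> / B)"
          by (simp add: WV[OF True] abs_mult power_abs)
        also have "\<dots> \<le> c * \<bar>t - x\<bar> ^ L * 1"
          using elim(3) B c(1) by (intro mult_left_mono) (auto simp: B_def)
        also have "\<dots> \<le> c * \<bar>t - x\<bar> ^ l x"
          using elim(2) c(1) lL[OF True] by (auto intro!: power_decreasing)
        finally show ?case using safe_mono[OF elim(1)] by simp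
      qed
      then have "\<forall>\<^sub>F t in at x within {a..b}. safe S A (\<Gamma> t) (c / B * \<bar>poly W t\<bar>)"
        by (simp add: eventually_at_filter) (auto elim: eventually_mono)
      moreover have "safe S A (\<Gamma> x) (c / B * \<bar>poly W x\<bar>)" using W0[of x] True by (simp add: safe_def)
      moreover have "c / B > 0" using c(1) B by simp
      ultimately show ?thesis by blast
    next
      case False
      obtain r where r: "r > 0" "safe S A (\<Gamma> x) r" using safe[of x] x False by blast
      define d where "d = r / (2 * (n + 1))"
      have d: "d > 0" using r(1) n0 by (simp add: d_def)
      have nd: "n * d \<le> r / 2"
      proof -
        have "n * d \<le> (n + 1) * d" using d by simp
        also have "\<dots> = r / 2"
        proof -
          have "d * (2 * (n + 1)) = r" unfolding d_def using n0 by (subst nonzero_eq_divide_eq[symmetric]) auto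
          then show ?thesis by (simp add: algebra_simps)
        qed
        finally show ?thesis .
      qed
      define B where "B = \<bar>poly W x\<bar> + 1"
      have B: "B > 0" by (simp add: B_def add_nonneg_pos)
      have "\<forall>\<^sub>F t in at x within {a..b}. \<bar>\<Gamma> t \<alpha> i - \<Gamma> x \<alpha> i\<bar> < d" if "\<alpha> \<in> A" for \<alpha> i
      proof -
        have "((\<lambda>t. \<Gamma> t \<alpha> i) \<longlongrightarrow> \<Gamma> x \<alpha> i) (at x within {a..b})" using cont[OF that] x by (simp add: continuous_on_def)
        from tendstoD[OF this d] show ?thesis by (simp add: dist_real_def)
      qed
      then have "\<forall>\<^sub>F t in at x within {a..b}. \<forall>u\<in>A \<times> UNIV. \<bar>\<Gamma> t (fst u) (snd u) - \<Gamma> x (fst u) (snd u)\<bar> < d"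
        using A by (intro eventually_ball_finiteI) auto
      then have "\<forall>\<^sub>F t in at x within {a..b}. safe S A (\<Gamma> t) (r / (2 * B) * \<bar>poly W t\<bar>)"
        using eventually_at_poly_bounded[of W x "{a..b}"]
      proof eventually_elim
        case (elim t)
        have "r / (2 * B) * \<bar>poly W t\<bar> = r / 2 * (\<bar>poly W t\<bar> / B)" by simp
        also have "\<dots> \<le> r / 2 * 1" using elim(2) B r(1) by (intro mult_left_mono) (auto simp: B_def)
        finally have le: "r / (2 * B) * \<bar>poly W t\<bar> \<le> r / 2" by simp
        have "safe S A (\<Gamma> t) (r / 2)" unfolding safe_def
        proof (intro ballI subsetI)
          fix u y assume u: "u \<in> cball (0 :: real^'m) 1" and y: "y \<in> ball (coeff_map A (\<Gamma> t) u) (r / 2)"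
          have "dist (coeff_map A (\<Gamma> x) u) (coeff_map A (\<Gamma> t) u) \<le> n * d"
            unfolding n_def
          proof (rule dist_coeff_map_le[OF u])
            show "\<bar>\<Gamma> x \<alpha> i - \<Gamma> t \<alpha> i\<bar> \<le> d" if "\<alpha> \<in> A" for \<alpha> i
              using bspec[OF elim(1), of "(\<alpha>, i)"] that by (simp add: abs_minus_commute)
          qed
          then have "y \<in> ball (coeff_map A (\<Gamma> x) u) r"
            using y nd dist_triangle[of "coeff_map A (\<Gamma> x) u" y "coeff_map A (\<Gamma> t) u"] by simp
          then show "y \<in> S" using r(2) u unfolding safe_def by blast
        qed
        then show ?case using le by (rule safe_mono)
      qed
      moreover have "safe S A (\<Gamma> x) (r / (2 * B) * \<bar>poly W x\<bar>)"
      proof (rule safe_mono[OF r(2)])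
        have "r / (2 * B) * \<bar>poly W x\<bar> = r * (\<bar>poly W x\<bar> / (2 * B))" by simp
        also have "\<dots> \<le> r * 1" using B r(1) by (intro mult_left_mono) (auto simp: B_def)
        finally show "r / (2 * B) * \<bar>poly W x\<bar> \<le> r" by simp
      qed
      moreover have "r / (2 * B) > 0" using r(1) B by simp
      ultimately show ?thesis by blast
    qed
  qed
  then obtain c where c: "c > 0" "\<And>t. t \<in> {a..b} \<Longrightarrow> safe S A (\<Gamma> t) (c * \<bar>poly W t\<bar>)" by blast
  \<comment> \<open>\<open>n\<close> converts an error in the coefficients into one in the values;
    the choice gives n \<epsilon> < c.\<close>
  define \<epsilon> where "\<epsilon> = c / (n + 1)"
  have \<epsilon>: "\<epsilon> > 0" "n * \<epsilon> < c" using c(1) n0 by (auto simp: \<epsilon>_def field_simps)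
  have approx: "\<exists>p. \<forall>t\<in>{a..b}. \<bar>\<Gamma> t \<alpha> i - poly p t\<bar> \<le> \<epsilon> * \<bar>poly W t\<bar>" if \<alpha>: "\<alpha> \<in> A" for \<alpha> i
  proof -
    have "\<forall>\<tau>\<in>F. \<exists>q. \<forall>\<^sub>F t in at \<tau>. \<bar>\<Gamma> t \<alpha> i - poly q t\<bar> \<le> \<bar>t - \<tau>\<bar> ^ Suc L"
      using tame_curve_jet[OF \<Gamma>, of _ "Suc L"] \<alpha> by blast
    from bchoice[OF this] obtain q where q: "\<forall>\<tau>\<in>F. \<forall>\<^sub>F t in at \<tau>. \<bar>\<Gamma> t \<alpha> i - poly (q \<tau>) t\<bar> \<le> \<bar>t - \<tau>\<bar> ^ Suc L" ..
    obtain h where h: "\<And>\<tau>. \<tau> \<in> F \<Longrightarrow> [:- \<tau>, 1:] ^ Suc L dvd h - q \<tau>"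
      using hermite_interpolation[OF F(1), of "Suc L" q] by blast
    have near: "\<exists>K. \<forall>\<^sub>F t in at \<tau>. \<bar>\<Gamma> t \<alpha> i - poly h t\<bar> \<le> K * \<bar>t - \<tau>\<bar> ^ Suc L" if \<tau>: "\<tau> \<in> F" for \<tau>
    proof -
      obtain u where u: "h - q \<tau> = [:- \<tau>, 1:] ^ Suc L * u" using h[OF \<tau>] by (rule dvdE)
      have "\<forall>\<^sub>F t in at \<tau>. \<bar>\<Gamma> t \<alpha> i - poly h t\<bar> \<le> (\<bar>poly u \<tau>\<bar> + 2) * \<bar>t - \<tau>\<bar> ^ Suc L"
        using bspec[OF q \<tau>] eventually_at_poly_bounded[of u \<tau> UNIV]
      proof eventually_elim
        case (elim t)
        have "poly h t - poly (q \<tau>) t = (t - \<tau>) ^ Suc L * poly u t"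
          using arg_cong[OF u, of "\<lambda>p. poly p t"] by (simp add: poly_power del: power_Suc)
        then have "\<bar>poly h t - poly (q \<tau>) t\<bar> = \<bar>t - \<tau>\<bar> ^ Suc L * \<bar>poly u t\<bar>"
          by (simp only: abs_mult power_abs)
        also have "\<dots> \<le> \<bar>t - \<tau>\<bar> ^ Suc L * (\<bar>poly u \<tau>\<bar> + 1)" using elim(2) by (intro mult_left_mono) auto
        finally have "\<bar>\<Gamma> t \<alpha> i - poly h t\<bar> \<le> \<bar>t - \<tau>\<bar> ^ Suc L + \<bar>t - \<tau>\<bar> ^ Suc L * (\<bar>poly u \<tau>\<bar> + 1)"
          using elim(1) by linarith
        then show ?case by (simp only: algebra_simps)
      qed
      then show ?thesis by blast
    qed
    \<comment> \<open>\<open>h\<close> matches the curve up to order L + 1, one more than the order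
      of \<open>W\<close>, so the quotient tends to the assigned value 0 at
      \<open>F\<close>.\<close>
    define v where "v t = (if t \<in> F then 0 else (\<Gamma> t \<alpha> i - poly h t) / poly W t)" for t
    have within: "at \<tau> within {a..b} = at \<tau>" if "\<tau> \<in> F" for \<tau>
      by (rule at_within_interior) (use that F(2) in \<open>auto simp: interior_atLeastAtMost_real\<close>)
    have conv: "((\<lambda>t. \<Gamma> t \<alpha> i - poly h t) \<longlongrightarrow> \<Gamma> x \<alpha> i - poly h x) (at x within {a..b})" if "x \<in> {a..b}" for x
      using cont[OF \<alpha>, of i] that by (intro tendsto_intros) (simp add: continuous_on_def)
    have "continuous_on {a..b} v"
      unfolding continuous_on_def
    proof
      fix x assume x: "x \<in> {a..b}"
      show "(v \<longlongrightarrow> v x) (at x within {a..b})"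
      proof (cases "x \<in> F")
        case True
        obtain K where K: "\<forall>\<^sub>F t in at x. \<bar>\<Gamma> t \<alpha> i - poly h t\<bar> \<le> K * \<bar>t - x\<bar> ^ Suc L" using near[OF True] by blast
        define m where "m = \<bar>poly (V x) x\<bar>"
        have m: "m > 0" using V0[of x] by (simp add: m_def)
        have "((\<lambda>t. \<bar>poly (V x) t\<bar>) \<longlongrightarrow> m) (at x)" unfolding m_def by (intro tendsto_intros)
        then have Vm: "\<forall>\<^sub>F t in at x. \<bar>poly (V x) t\<bar> > m / 2" by (rule order_tendstoD) (use m in simp)
        have "\<forall>\<^sub>F t in at x. norm (v t) \<le> \<bar>K\<bar> * 2 / m * \<bar>t - x\<bar>"
          using K Vm ev_ne[of x]
        proof eventually_elim
          case (elim t)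
          show ?case
          proof (cases "t \<in> F")
            case False
            have pos: "\<bar>t - x\<bar> ^ L > 0" using elim by simp
            have "m / 2 * \<bar>t - x\<bar> ^ L \<le> \<bar>poly (V x) t\<bar> * \<bar>t - x\<bar> ^ L" using elim(2) pos by (intro mult_right_mono) auto
            then have Wl: "m / 2 * \<bar>t - x\<bar> ^ L \<le> \<bar>poly W t\<bar>" by (simp add: WV[OF True] abs_mult power_abs mult.commute)
            have "\<bar>\<Gamma> t \<alpha> i - poly h t\<bar> \<le> \<bar>K\<bar> * \<bar>t - x\<bar> ^ Suc L"
              using elim(1) mult_right_mono[of K "\<bar>K\<bar>" "\<bar>t - x\<bar> ^ Suc L"] by force
            also have "\<dots> = (\<bar>K\<bar> * 2 / m * \<bar>t - x\<bar>) * (m / 2 * \<bar>t - x\<bar> ^ L)" using m by simp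
            also have "\<dots> \<le> (\<bar>K\<bar> * 2 / m * \<bar>t - x\<bar>) * \<bar>poly W t\<bar>" using Wl m by (intro mult_left_mono) auto
            finally show ?thesis using False W0[of t] by (simp add: v_def abs_divide pos_divide_le_eq)
          qed (use m in \<open>simp add: v_def\<close>)
        qed
        moreover have "((\<lambda>t. \<bar>K\<bar> * 2 / m * \<bar>t - x\<bar>) \<longlongrightarrow> \<bar>K\<bar> * 2 / m * \<bar>x - x\<bar>) (at x)" using m by (intro tendsto_intros) auto
        ultimately have "(v \<longlongrightarrow> 0) (at x)" by (intro Lim_null_comparison[of v]) simp_all
        then show ?thesis unfolding within[OF True] using True by (simp add: v_def)
      next
        case False
        have "((\<lambda>t. (\<Gamma> t \<alpha> i - poly h t) / poly W t) \<longlongrightarrow> (\<Gamma> x \<alpha> i - poly h x) / poly W x) (at x within {a..b})"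
          using W0[of x] False by (intro tendsto_divide conv[OF x] tendsto_intros) auto
        moreover have "open (- F)" using F(1) by (simp add: finite_imp_closed open_Compl)
        then have "\<forall>\<^sub>F t in at x within {a..b}. t \<in> - F" 
          unfolding eventually_at_topological using False by (intro exI[of _ "- F"]) simp
        then have "\<forall>\<^sub>F t in at x within {a..b}. (\<Gamma> t \<alpha> i - poly h t) / poly W t = v t"
          by eventually_elim (simp add: v_def)
        ultimately have "(v \<longlongrightarrow> (\<Gamma> x \<alpha> i - poly h x) / poly W x) (at x within {a..b})" by (rule Lim_transform_eventually)
        then show ?thesis using False by (simp add: v_def)
      qed
    qed
    then obtain g where g: "real_polynomial_function g" "\<And>t. t \<in> {a..b} \<Longrightarrow> \<bar>v t - g t\<bar> < \<epsilon>"
      using Stone_Weierstrass_real_polynomial_function[of "{a..b}" v \<epsilon>] \<epsilon>(1) by auto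
    obtain R where R: "g = poly R" using real_polynomial_function_as_poly[OF g(1)] by blast
    have "\<bar>\<Gamma> t \<alpha> i - poly (h + W * R) t\<bar> \<le> \<epsilon> * \<bar>poly W t\<bar>" if t: "t \<in> {a..b}" for t
    proof -
      have "\<Gamma> t \<alpha> i - poly h t = poly W t * v t"
      proof (cases "t \<in> F")
        case True
        obtain K where K: "\<forall>\<^sub>F s in at t. \<bar>\<Gamma> s \<alpha> i - poly h s\<bar> \<le> K * \<bar>s - t\<bar> ^ Suc L" using near[OF True] by blast
        have "((\<lambda>s. K * \<bar>s - t\<bar> ^ Suc L) \<longlongrightarrow> K * \<bar>t - t\<bar> ^ Suc L) (at t)" by (intro tendsto_intros)
        then have "((\<lambda>s. \<Gamma> s \<alpha> i - poly h s) \<longlongrightarrow> 0) (at t)"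
          using K by (intro Lim_null_comparison[of "\<lambda>s. \<Gamma> s \<alpha> i - poly h s"]) simp_all
        then have "\<Gamma> t \<alpha> i - poly h t = 0"
          using conv[OF t] unfolding within[OF True] by (intro tendsto_unique[of "at t"]) auto
        then show ?thesis using W0[of t] True by simp
      next
        case False
        then show ?thesis using W0[of t] by (simp add: v_def)
      qed
      then have "\<Gamma> t \<alpha> i - poly (h + W * R) t = poly W t * (v t - g t)" by (simp add: R algebra_simps)
      then have "\<bar>\<Gamma> t \<alpha> i - poly (h + W * R) t\<bar> = \<bar>v t - g t\<bar> * \<bar>poly W t\<bar>" by (simp add: abs_mult)
      then show ?thesis using g(2)[OF t] by (simp add: mult_right_mono)
    qed
    then show ?thesis by blast
  qed
  define p where "p \<alpha> i = (SOME p. \<forall>t\<in>{a..b}. \<bar>\<Gamma> t \<alpha> i - poly p t\<bar> \<le> \<epsilon> * \<bar>poly W t\<bar>)" for \<alpha> i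
  have p: "\<bar>\<Gamma> t \<alpha> i - poly (p \<alpha> i) t\<bar> \<le> \<epsilon> * \<bar>poly W t\<bar>" if "\<alpha> \<in> A" "t \<in> {a..b}" for \<alpha> i t
    using someI_ex[OF approx[OF that(1), of i]] that(2) unfolding p_def by blast
  have pF: "poly (p \<alpha> i) \<tau> = \<Gamma> \<tau> \<alpha> i" if "\<tau> \<in> F" "\<alpha> \<in> A" for \<tau> \<alpha> i
  proof -
    have "\<tau> \<in> {a..b}" using that(1) F(2) by auto
    then show ?thesis using p[OF that(2), of \<tau> i] W0[of \<tau>] that(1) by simp
  qed
  have "coeff_map A (\<lambda>\<alpha> i. poly (p \<alpha> i) t) ` cball 0 1 \<subseteq> S" if t: "t \<in> {a..b}" for t
  proof (cases "t \<in> F")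
    case True
    have "coeff_map A (\<lambda>\<alpha> i. poly (p \<alpha> i) t) = coeff_map A (\<Gamma> t)"
      by (rule coeff_map_cong) (simp add: pF[OF True] fun_eq_iff)
    then show ?thesis using tame_curve_image[OF \<Gamma> True] by simp
  next
    case False
    then have W: "\<bar>poly W t\<bar> > 0" using W0[of t] by simp
    show ?thesis
    proof safe
      fix x :: "real^'m" assume x: "x \<in> cball 0 1"
      have "dist (coeff_map A (\<Gamma> t) x) (coeff_map A (\<lambda>\<alpha> i. poly (p \<alpha> i) t) x) \<le> n * (\<epsilon> * \<bar>poly W t\<bar>)"
        unfolding n_def by (rule dist_coeff_map_le[OF x p[OF _ t]])
      also have "\<dots> < c * \<bar>poly W t\<bar>" using \<epsilon>(2) W by simp
      finally have "coeff_map A (\<lambda>\<alpha> i. poly (p \<alpha> i) t) x \<in> ball (coeff_map A (\<Gamma> t) x) (c * \<bar>poly W t\<bar>)" by simp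
      then show "coeff_map A (\<lambda>\<alpha> i. poly (p \<alpha> i) t) x \<in> S" using c(2)[OF t] x unfolding safe_def by blast
    qed
  qed
  then show thesis using that[of p] pF by blast
qed

section \<open>Passage to the ball of one dimension more\<close>

lemma chebyshev_polynomials:
  "\<exists>p q :: real poly. \<forall>\<theta>. cos (real k * \<theta>) = poly p (cos \<theta>) \<and> sin (real k * \<theta>) = sin \<theta> * poly q (cos \<theta>)"
proof (induction k)
  case 0
  show ?case by (rule exI[of _ 1], rule exI[of _ 0]) simp
next
  case (Suc k)
  then obtain p q :: "real poly" where pq: "\<And>\<theta>. cos (real k * \<theta>) = poly p (cos \<theta>)" "\<And>\<theta>. sin (real k * \<theta>) = sin \<theta> * poly q (cos \<theta>)"
    by blast
  have s: "real (Suc k) * \<theta> = real k * \<theta> + \<theta>" for \<theta> by (simp add: algebra_simps)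
  have "cos (real (Suc k) * \<theta>) = poly ([:0, 1:] * p - [:1, 0, -1:] * q) (cos \<theta>)" for \<theta>
  proof -
    have "sin \<theta> * sin \<theta> = 1 - cos \<theta> * cos \<theta>" using sin_squared_eq[of \<theta>] by (simp add: power2_eq_square)
    then have "sin \<theta> * poly q (cos \<theta>) * sin \<theta> = (1 - cos \<theta> * cos \<theta>) * poly q (cos \<theta>)"
      by (metis mult.assoc mult.commute)
    then show ?thesis unfolding s cos_add pq by (simp add: algebra_simps)
  qed
  moreover have "sin (real (Suc k) * \<theta>) = sin \<theta> * poly (p + [:0, 1:] * q) (cos \<theta>)" for \<theta>
    unfolding s sin_add pq by (simp add: algebra_simps)
  ultimately show ?case by blast
qed

lemma norm_vec_option:
  fixes z :: "real^('m::finite option)"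
  shows "(norm z)\<^sup>2 = (z $ None)\<^sup>2 + (norm (\<chi> j. z $ Some j))\<^sup>2"
proof -
  have "(\<Sum>i\<in>UNIV. (z $ i)\<^sup>2) = (z $ None)\<^sup>2 + (\<Sum>j\<in>UNIV. (z $ Some j)\<^sup>2)"
    unfolding UNIV_option_conv by (subst sum.insert) (auto simp: sum.reindex)
  then show ?thesis by (simp add: norm_vec_def L2_set_def sum_nonneg)
qed

lemma real_polynomial_function_poly_compose:
  "real_polynomial_function u \<Longrightarrow> real_polynomial_function (\<lambda>x. poly c (u x))"
  unfolding poly_altdef
  by (intro real_polynomial_function_sum real_polynomial_function.intros(2,4) real_polynomial_function_power) auto

lemma real_polynomial_function_prod_finite:
  "finite I \<Longrightarrow> (\<And>i. i \<in> I \<Longrightarrow> real_polynomial_function (\<lambda>x. f i x)) \<Longrightarrow> real_polynomial_function (\<lambda>x. \<Prod>i\<in>I. f i x)"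
  by (induction I rule: finite_induct) (auto intro: real_polynomial_function.intros)

text \<open>Concatenation of curves requires one exponent set for all bricks; the exponent 0 is
  added for the constant maps that link them.\<close>

lemma bricks_common_exponents:
  fixes \<T> :: "(real^'n) set set"
  assumes "finite \<T>" and bricks: "\<And>T. T \<in> \<T> \<Longrightarrow> brick TYPE('m::finite) T"
  shows "\<exists>A :: ('m \<Rightarrow> nat) set. finite A \<and> (\<lambda>_. 0) \<in> A \<and>
    (\<forall>T\<in>\<T>. \<exists>q L \<epsilon> C. \<epsilon> > 0 \<and> C > 0 \<and> coeff_map A (\<lambda>\<alpha> i. poly (q \<alpha> i) 0) ` cball 0 1 = T \<and>
       (\<forall>s. 0 < s \<and> s < \<epsilon> \<longrightarrow> safe T A (\<lambda>\<alpha> i. poly (q \<alpha> i) s) (C * s ^ L)))"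
proof -
  have "\<forall>T\<in>\<T>. \<exists>A :: ('m \<Rightarrow> nat) set. finite A \<and> (\<exists>q L \<epsilon> C. \<epsilon> > 0 \<and> C > 0 \<and> coeff_map A (\<lambda>\<alpha> i. poly (q \<alpha> i) 0) ` cball 0 1 = T \<and>
       (\<forall>s. 0 < s \<and> s < \<epsilon> \<longrightarrow> safe T A (\<lambda>\<alpha> i. poly (q \<alpha> i) s) (C * s ^ L)))"
  proof
    fix T assume "T \<in> \<T>"
    show "\<exists>A :: ('m \<Rightarrow> nat) set. finite A \<and> (\<exists>q L \<epsilon> C. \<epsilon> > 0 \<and> C > 0 \<and> coeff_map A (\<lambda>\<alpha> i. poly (q \<alpha> i) 0) ` cball 0 1 = T \<and>
       (\<forall>s. 0 < s \<and> s < \<epsilon> \<longrightarrow> safe T A (\<lambda>\<alpha> i. poly (q \<alpha> i) s) (C * s ^ L)))"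
    proof (rule brick_polynomial_curve[OF bricks[OF \<open>T \<in> \<T>\<close>]])
      fix A :: "('m \<Rightarrow> nat) set" and q :: "('m \<Rightarrow> nat) \<Rightarrow> 'n \<Rightarrow> real poly" and \<epsilon> C :: real and L :: nat
      assume *: "finite A" "\<epsilon> > 0" "C > 0" "coeff_map A (\<lambda>\<alpha> i. poly (q \<alpha> i) 0) ` cball 0 1 = T"
        "\<And>s x. 0 < s \<Longrightarrow> s < \<epsilon> \<Longrightarrow> x \<in> cball 0 1 \<Longrightarrow> ball (coeff_map A (\<lambda>\<alpha> i. poly (q \<alpha> i) s) x) (C * s ^ L) \<subseteq> T"
      then have "\<forall>s. 0 < s \<and> s < \<epsilon> \<longrightarrow> safe T A (\<lambda>\<alpha> i. poly (q \<alpha> i) s) (C * s ^ L)" by (simp add: safe_def)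
      then show ?thesis using *(1-4) by blast
    qed
  qed
  from bchoice[OF this] obtain E :: "(real^'n) set \<Rightarrow> ('m \<Rightarrow> nat) set" where E: "\<forall>T\<in>\<T>. finite (E T) \<and> (\<exists>q L \<epsilon> C. \<epsilon> > 0 \<and> C > 0 \<and>
       coeff_map (E T) (\<lambda>\<alpha> i. poly (q \<alpha> i) 0) ` cball 0 1 = T \<and>
       (\<forall>s. 0 < s \<and> s < \<epsilon> \<longrightarrow> safe T (E T) (\<lambda>\<alpha> i. poly (q \<alpha> i) s) (C * s ^ L)))" ..
  define A where "A = insert (\<lambda>_. 0) (\<Union>T\<in>\<T>. E T)"
  have A: "finite A" "(\<lambda>_. 0) \<in> A" using assms(1) E by (auto simp: A_def)
  have "\<forall>T\<in>\<T>. \<exists>q L \<epsilon> C. \<epsilon> > 0 \<and> C > 0 \<and> coeff_map A (\<lambda>\<alpha> i. poly (q \<alpha> i) 0) ` cball 0 1 = T \<and>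
       (\<forall>s. 0 < s \<and> s < \<epsilon> \<longrightarrow> safe T A (\<lambda>\<alpha> i. poly (q \<alpha> i) s) (C * s ^ L))"
  proof
    fix T assume T: "T \<in> \<T>"
    obtain q L \<epsilon> C where q: "\<epsilon> > 0" "C > 0" "coeff_map (E T) (\<lambda>\<alpha> i. poly (q \<alpha> i) 0) ` cball 0 1 = T"
       "\<forall>s. 0 < s \<and> s < \<epsilon> \<longrightarrow> safe T (E T) (\<lambda>\<alpha> i. poly (q \<alpha> i) s) (C * s ^ L)"
      using bspec[OF E T] by blast
    define q' where "q' \<alpha> i = (if \<alpha> \<in> E T then q \<alpha> i else 0)" for \<alpha> i
    have sub: "E T \<subseteq> A" using T by (auto simp: A_def)
    have "coeff_map A (\<lambda>\<alpha> i. poly (q' \<alpha> i) s) = coeff_map (E T) (\<lambda>\<alpha> i. poly (q \<alpha> i) s)" for s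
      using sub A(1) unfolding coeff_map_def fun_eq_iff vec_eq_iff
      by (auto intro!: sum.mono_neutral_cong_right simp: q'_def)
    then show "\<exists>q L \<epsilon> C. \<epsilon> > 0 \<and> C > 0 \<and> coeff_map A (\<lambda>\<alpha> i. poly (q \<alpha> i) 0) ` cball 0 1 = T \<and>
       (\<forall>s. 0 < s \<and> s < \<epsilon> \<longrightarrow> safe T A (\<lambda>\<alpha> i. poly (q \<alpha> i) s) (C * s ^ L))"
      using q by (intro exI[of _ q'] exI[of _ L] exI[of _ \<epsilon>] exI[of _ C]) (simp add: safe_def)
  qed
  with A show ?thesis by (intro exI[of _ A] conjI)
qed

theorem theorem1p6:
  fixes \<T> :: "(real^'n) set set" and S :: "(real^'n) set"
  assumes "finite \<T>" and "\<T> \<noteq> {}"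
    and "\<And>T. T \<in> \<T> \<Longrightarrow> brick TYPE('m::finite) T"
    and "S = \<Union>\<T>"
  shows "connected_by_analytic_paths S \<longleftrightarrow>
         (\<exists>f :: real^('m option) \<Rightarrow> real^'n. polynomial_function f \<and> f ` cball 0 1 = S)"
proof
  assume "\<exists>f :: real^('m option) \<Rightarrow> real^'n. polynomial_function f \<and> f ` cball 0 1 = S"
  then show "connected_by_analytic_paths S"
    using polynomial_image_connected_by_analytic_paths convex_cball by blast
next
  assume conn: "connected_by_analytic_paths S"
  obtain A :: "('m \<Rightarrow> nat) set" where A: "finite A" "(\<lambda>_. 0) \<in> A"
    and curves: "\<forall>T\<in>\<T>. \<exists>q L \<epsilon> C. \<epsilon> > 0 \<and> C > 0 \<and> coeff_map A (\<lambda>\<alpha> i. poly (q \<alpha> i) 0) ` cball 0 1 = T \<and>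
       (\<forall>s. 0 < s \<and> s < \<epsilon> \<longrightarrow> safe T A (\<lambda>\<alpha> i. poly (q \<alpha> i) s) (C * s ^ L))"
    using bricks_common_exponents[OF assms(1,3)] by blast
  from bchoice[OF curves] obtain Q where Q: "\<forall>T\<in>\<T>. \<exists>L \<epsilon> C. \<epsilon> > 0 \<and> C > 0 \<and> coeff_map A (\<lambda>\<alpha> i. poly (Q T \<alpha> i) 0) ` cball 0 1 = T \<and>
       (\<forall>s. 0 < s \<and> s < \<epsilon> \<longrightarrow> safe T A (\<lambda>\<alpha> i. poly (Q T \<alpha> i) s) (C * s ^ L))" ..
  have loop: "\<exists>y\<in>interior S. \<exists>\<Gamma> F. tame_curve S A \<Gamma> 0 1 F \<and> 1/2 \<in> F \<and> (\<forall>\<alpha>\<in>A. \<Gamma> 0 \<alpha> = const_coeff y \<alpha>) \<and>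
       (\<forall>\<alpha>\<in>A. \<Gamma> 1 \<alpha> = const_coeff y \<alpha>) \<and> (\<forall>\<alpha>\<in>A. \<Gamma> (1/2) \<alpha> = (\<lambda>i. poly (Q T \<alpha> i) 0))" if T: "T \<in> \<T>" for T
  proof -
    obtain L \<epsilon> C where q: "\<epsilon> > 0" "C > 0" "coeff_map A (\<lambda>\<alpha> i. poly (Q T \<alpha> i) 0) ` cball 0 1 = T"
       "\<And>s. 0 < s \<Longrightarrow> s < \<epsilon> \<Longrightarrow> safe T A (\<lambda>\<alpha> i. poly (Q T \<alpha> i) s) (C * s ^ L)" using bspec[OF Q T] by blast
    have "T \<subseteq> S" using T assms(4) by auto
    then have "safe S A (\<lambda>\<alpha> i. poly (Q T \<alpha> i) s) (C * s ^ L)" if "0 < s" "s < \<epsilon>" for s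
      using q(4)[OF that] unfolding safe_def by blast
    with \<open>T \<subseteq> S\<close> q(1-3) show ?thesis by (intro brick_loop[OF A, of \<epsilon> C "Q T" S L]) auto
  qed
  obtain g w where g: "real_polynomial_function g" "g w \<noteq> 0" "frontier S \<subseteq> {x. g x = 0}"
    using semialgebraic_frontier[OF semialgebraic_Union[OF assms(1)]] assms(3,4) unfolding brick_def by blast
  note link = joined_interior_points[OF A g conn]
  obtain T0 where "T0 \<in> \<T>" using assms(2) by blast
  then obtain y0 where y0: "y0 \<in> interior S" using loop by blast
  define k where "k = card \<T>"
  have k: "k > 0" using assms(1,2) by (simp add: k_def card_gt_0_iff)
  obtain f where f: "bij_betw f {0..<k} \<T>" using ex_bij_betw_nat_finite[OF assms(1)] unfolding k_def by blast
  \<comment> \<open>The \<open>k\<close> angles between 0 and pi at which |sin(k \<theta>)| = 1, one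
    for each brick.\<close>
  define \<theta> where "\<theta> j = real (2 * j + 1) * pi / real (2 * k)" for j :: nat
  have \<theta>: "0 < \<theta> j" "\<theta> j < pi" "\<bar>sin (real k * \<theta> j)\<bar> = 1" if "j < k" for j
  proof -
    show "0 < \<theta> j" using k by (simp add: \<theta>_def)
    have "real (2 * j + 1) < real (2 * k)" using that by linarith
    then have "real (2 * j + 1) * pi < real (2 * k) * pi" by (intro mult_strict_right_mono) auto
    then show "\<theta> j < pi" using k by (simp add: \<theta>_def pos_divide_less_eq mult.commute)
    have "real k * \<theta> j = real j * pi + pi / 2" using k by (simp add: \<theta>_def field_simps)
    then have "sin (real k * \<theta> j) = (-1) ^ j" by (simp add: sin_add cos_npi)
    then show "\<bar>sin (real k * \<theta> j)\<bar> = 1" by (simp add: power_abs)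
  qed
  define node where "node j = cos (\<theta> j)" for j
  have inj: "inj_on node {0..<k}"
  proof (rule inj_onI)
    fix i j assume ij: "i \<in> {0..<k}" "j \<in> {0..<k}" "node i = node j"
    have "cos (\<theta> i) = cos (\<theta> j)" using ij(3) by (simp only: node_def)
    moreover have "0 < \<theta> i" "\<theta> i < pi" "0 < \<theta> j" "\<theta> j < pi" using \<theta>(1,2) ij(1,2) by auto
    ultimately have "\<theta> i = \<theta> j" using cos_inj_pi[of "\<theta> i" "\<theta> j"] by linarith
    then have "real (2 * i + 1) * pi = real (2 * j + 1) * pi" using k by (simp add: \<theta>_def)
    then show "i = j" by simp
  qed
  define N where "N = node ` {0..<k}"
  have N: "finite N" "N \<subseteq> {-1<..<1}"
  proof -
    show "finite N" by (simp add: N_def)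
    have "cos (\<theta> j) < 1 \<and> -1 < cos (\<theta> j)" if "j < k" for j
      using \<theta>(1,2)[OF that] cos_monotone_0_pi[of 0 "\<theta> j"] cos_monotone_0_pi[of "\<theta> j" pi] by auto
    then show "N \<subseteq> {-1<..<1}" by (auto simp: N_def node_def)
  qed
  \<comment> \<open>\<open>the_inv_into\<close> recovers the index of a node, so that the brick to
    be parametrised becomes a function of the time.\<close>
  define P where "P \<tau> \<alpha> i = poly (Q (f (the_inv_into {0..<k} node \<tau>)) \<alpha> i) 0" for \<tau> \<alpha> i
  have P: "P (node j) = (\<lambda>\<alpha> i. poly (Q (f j) \<alpha> i) 0)" if "j < k" for j
    using the_inv_into_f_f[OF inj, of j] that by (simp add: P_def[abs_def])
  have fT: "f j \<in> \<T>" if "j < k" for j using f that by (auto simp: bij_betw_def)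
  have "\<exists>\<Gamma> F. \<exists>y\<in>interior S. tame_curve S A \<Gamma> (-1) 1 F \<and> N \<subseteq> F \<and> (\<forall>\<alpha>\<in>A. \<Gamma> 1 \<alpha> = const_coeff y \<alpha>) \<and>
    (\<forall>\<tau>\<in>N. \<forall>\<alpha>\<in>A. \<Gamma> \<tau> \<alpha> = P \<tau> \<alpha>)"
  proof (rule tame_curve_through[OF A y0 link _ N])
    fix \<tau> assume "\<tau> \<in> N"
    then obtain j where j: "j < k" "\<tau> = node j" by (auto simp: N_def)
    show "\<exists>y\<in>interior S. \<exists>\<Gamma> F. tame_curve S A \<Gamma> 0 1 F \<and> 1/2 \<in> F \<and> (\<forall>\<alpha>\<in>A. \<Gamma> 0 \<alpha> = const_coeff y \<alpha>) \<and>
       (\<forall>\<alpha>\<in>A. \<Gamma> 1 \<alpha> = const_coeff y \<alpha>) \<and> (\<forall>\<alpha>\<in>A. \<Gamma> (1/2) \<alpha> = P \<tau> \<alpha>)"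
      using loop[OF fT[OF j(1)]] unfolding j(2) P[OF j(1)] .
  qed auto
  then obtain \<Gamma> F where \<Gamma>: "tame_curve S A \<Gamma> (-1) 1 F" "N \<subseteq> F" "\<And>\<tau> \<alpha>. \<tau> \<in> N \<Longrightarrow> \<alpha> \<in> A \<Longrightarrow> \<Gamma> \<tau> \<alpha> = P \<tau> \<alpha>" by blast
  obtain p where p: "\<And>t. t \<in> {-1..1} \<Longrightarrow> coeff_map A (\<lambda>\<alpha> i. poly (p \<alpha> i) t) ` cball 0 1 \<subseteq> S"
    "\<And>\<tau> \<alpha> i. \<tau> \<in> F \<Longrightarrow> \<alpha> \<in> A \<Longrightarrow> poly (p \<alpha> i) \<tau> = \<Gamma> \<tau> \<alpha> i"
    using tame_curve_polynomial[OF \<Gamma>(1) A(1)] by blast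
  have image_node: "coeff_map A (\<lambda>\<alpha> i. poly (p \<alpha> i) (node j)) ` cball 0 1 = f j" if "j < k" for j
  proof -
    have jN: "node j \<in> N" using that by (simp add: N_def)
    then have "node j \<in> F" using \<Gamma>(2) by blast
    then have "coeff_map A (\<lambda>\<alpha> i. poly (p \<alpha> i) (node j)) = coeff_map A (\<lambda>\<alpha> i. poly (Q (f j) \<alpha> i) 0)"
      using p(2) \<Gamma>(3)[OF jN] P[OF that] by (intro coeff_map_cong) (simp add: fun_eq_iff)
    then show ?thesis using bspec[OF Q fT[OF that]] by auto
  qed
  obtain U :: "real poly" where U: "\<And>\<theta>. sin (real k * \<theta>) = sin \<theta> * poly U (cos \<theta>)"
    using chebyshev_polynomials[of k] by blast
  \<comment> \<open>\<open>None\<close> is the time coordinate, and the \<open>Some\<close>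
    coordinates form the point of the lower-dimensional ball before rescaling.\<close>
  define G :: "real^('m option) \<Rightarrow> real^'n" where
    "G z = coeff_map A (\<lambda>\<alpha> i. poly (p \<alpha> i) (z $ None)) (poly U (z $ None) *\<^sub>R (\<chi> j. z $ Some j))" for z
  have coord: "real_polynomial_function (\<lambda>z :: real^('m option). z $ i)" for i
    by (rule real_polynomial_function.intros(1)) (rule bounded_linear_vec_nth)
  have "polynomial_function G"
    unfolding polynomial_function_vec_iff
  proof
    fix i
    show "real_polynomial_function (\<lambda>z. G z $ i)"
      unfolding G_def coeff_map_def monomial_def
      by (simp, intro real_polynomial_function_sum real_polynomial_function.intros(4)
          real_polynomial_function_prod_finite real_polynomial_function_power real_polynomial_function_poly_compose coord A(1))
        auto
  qed
  moreover have "G ` cball 0 1 = S"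
  proof
    show "G ` cball 0 1 \<subseteq> S"
    proof safe
      fix z :: "real^('m option)" assume "z \<in> cball 0 1"
      then have "(norm z)\<^sup>2 \<le> 1" by (simp add: abs_square_le_1)
      then have le: "(z $ None)\<^sup>2 + (norm (\<chi> j. z $ Some j))\<^sup>2 \<le> 1" by (simp only: norm_vec_option)
      have "(z $ None)\<^sup>2 \<le> 1" using le zero_le_power2[of "norm (\<chi> j. z $ Some j)"] by linarith
      then have t: "\<bar>z $ None\<bar> \<le> 1" by (simp only: abs_square_le_1)
      define \<phi> where "\<phi> = arccos (z $ None)"
      have \<phi>: "cos \<phi> = z $ None" "0 \<le> \<phi>" "\<phi> \<le> pi" using t by (auto simp: \<phi>_def intro: arccos_lbound arccos_ubound)
      have s0: "0 \<le> sin \<phi>" using \<phi> by (intro sin_ge_zero) auto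
      \<comment> \<open>The slice at height cos \<phi> has radius sin \<phi>, so the rescaled point
        has norm at most |sin(k \<phi>)|.\<close>
      have "(norm (\<chi> j. z $ Some j))\<^sup>2 \<le> (sin \<phi>)\<^sup>2" using le by (simp add: sin_squared_eq \<phi>(1))
      then have "norm (\<chi> j. z $ Some j) \<le> sin \<phi>" using s0 by (rule power2_le_imp_le)
      then have "\<bar>poly U (z $ None)\<bar> * norm (\<chi> j. z $ Some j) \<le> \<bar>poly U (z $ None)\<bar> * sin \<phi>"
        by (rule mult_left_mono) simp
      also have "\<dots> = \<bar>sin (real k * \<phi>)\<bar>" using U[of \<phi>] s0 by (simp add: \<phi>(1) abs_mult)
      also have "\<dots> \<le> 1" by simp
      finally have "poly U (z $ None) *\<^sub>R (\<chi> j. z $ Some j) \<in> cball 0 1" by simp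
      moreover have "z $ None \<in> {-1..1}" using t by auto
      ultimately show "G z \<in> S" using p(1) unfolding G_def by blast
    qed
    show "S \<subseteq> G ` cball 0 1"
    proof
      fix y assume "y \<in> S"
      then obtain T where "T \<in> \<T>" "y \<in> T" using assms(4) by blast
      then obtain j where j: "j < k" "y \<in> f j" using f by (auto simp: bij_betw_def)
      obtain x :: "real^'m" where x: "x \<in> cball 0 1" "y = coeff_map A (\<lambda>\<alpha> i. poly (p \<alpha> i) (node j)) x"
        using image_node[OF j(1)] j(2) by blast
      define u where "u = poly U (node j)"
      have s: "\<bar>sin (\<theta> j) * u\<bar> = 1" using \<theta>(3)[OF j(1)] U[of "\<theta> j"] by (simp add: u_def node_def)
      then have u0: "u \<noteq> 0" by auto
      \<comment> \<open>At a node the radius of the slice is 1/|u|, so the rescaled slice is the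
        whole ball and dividing by \<open>u\<close> gives a preimage.\<close>
      define z :: "real^('m option)" where "z = (\<chi> i. case i of None \<Rightarrow> node j | Some i \<Rightarrow> x $ i / u)"
      have z: "z $ None = node j" "(\<chi> i. z $ Some i) = (1 / u) *\<^sub>R x" by (auto simp: z_def vec_eq_iff)
      have "(norm ((1 / u) *\<^sub>R x))\<^sup>2 \<le> (sin (\<theta> j))\<^sup>2"
      proof -
        have "norm ((1 / u) *\<^sub>R x) \<le> 1 / \<bar>u\<bar>" using x(1) u0 by (simp add: divide_right_mono)
        also have "\<dots> = \<bar>sin (\<theta> j)\<bar>" using s u0 by (simp add: abs_mult field_simps)
        finally show ?thesis by (metis abs_le_square_iff abs_idempotent abs_norm_cancel)
      qed
      then have "(norm z)\<^sup>2 \<le> 1" unfolding norm_vec_option z by (simp add: node_def sin_squared_eq)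
      then have "z \<in> cball 0 1" by (simp add: abs_square_le_1)
      moreover have "G z = y" unfolding G_def z x(2) using u0 by (simp add: u_def)
      ultimately show "y \<in> G ` cball 0 1" by blast
    qed
  qed
  ultimately show "\<exists>f :: real^('m option) \<Rightarrow> real^'n. polynomial_function f \<and> f ` cball 0 1 = S" by blast
qed

end
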